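(* Let $K_{3,N}$ be the complete bipartite graph with parts $\{1,2,3\}$ and $\{w_1,\dots,w_N\}$, with all nodes binary. (1) For every integer $N\ge 1$, the Markov degree of the binary hierarchical model of $K_{3,N}$ is at most $12$. (2) For every $N\ge 1$ there is a kernel Markov basis for $K_{3,N}$ of degree at most $6$. Moreover, there is a projected fiber (PF) Markov basis $G\subset\mathbb{Z}^{\{0,1\}^3}$ (independent of $N$) of degree $4$ whose lifting defect is $2$. (3) Consequently, for every $N\ge 1$, the Markov degree of the binary hierarchical model of $K_{3,N}$ is also at most $4+2N$.
   Context: **Hierarchical models.** Let $\Gamma$ be a simplicial complex on a finite vertex set $V$ (a graph is viewed as the complex of its edges and vertices). The binary hierarchical model of $\Gamma$ is given by the linear map $\mathcal{B}_\Gamma:\mathbb{Z}^{\{0,1\}^V}\to\bigoplus_{F}\mathbb{Z}^{\{0,1\}^F}$, with $F$ running over the facets (maximal faces) of $\Gamma$, that sends a table $u$ to the collection of its $F$-marginals $u^F_{y}=\sum_{x\in\{0,1\}^V:\,x|_F=y}u_x$. **Fibers, moves, Markov bases.** The fiber of $b$ is $\mathbf{F}_\Gamma(b)=\{u\in\mathbb{N}^{\{0,1\}^V}:\mathcal{B}_\Gamma u=b\}$, where $\mathbb{N}=\{0,1,2,\dots\}$. For a finite set $M$ of integer vectors and a set $S$ of integer vectors, say that $M$ connects $S$ if the graph on $S$ with edges $\{u,u'\}$ whenever $u-u'\in M\cup(-M)$ is connected. A Markov basis of $\Gamma$ is a finite set $M\subset\ker_{\mathbb{Z}}\mathcal{B}_\Gamma$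 that connects every non-empty fiber $\mathbf{F}_\Gamma(b)$. **Degree.** Every integer vector is written $m=m^+-m^-$ with $m^\pm\ge 0$ of disjoint supports. In all situations considered here the sums of the entries of $m^+$ and $m^-$ agree, and this common number is $\deg(m)$. The degree of a finite set of moves is the maximum of the degrees of its elements. The Markov degree of $\Gamma$ is the minimum of the degrees of all Markov bases of $\Gamma$. **Kernel Markov basis.** The graph $K_{3,N}$ is obtained by gluing $N$ copies of the three-star $T$ (the graph with nodes $1,2,3,4$ and edges $14,24,34$) along the nodes $1,2,3$; node $4$ of the $j$-th copy becomes $w_j$. A kernel Markov basis for $K_{3,N}$ is a Markov basis of the complex obtained from $K_{3,N}$ by adding the full simplex on $\{1,2,3\}$ (the "associated codimension-zero product"). **Projected fibers and PF Markov basis.** Let $\xi:\mathbb{Z}^{\{0,1\}^4}\to\mathbb{Z}^{\{0,1\}^3}$ be the $\{1,2,3\}$-marginal map. The projected fibers are the sets $\xi(\mathbf{F}_T(b))\subset\mathbb{N}^{\{0,1\}^3}$. A PF Markov basis is a finite set $G\subset\mathbb{Z}^{\{0,1\}^3}$ of vectors all of whose one-node marginals (for nodes $1,2,3$) vanish, such that $G$ connects every non-empty intersection $\xi(\mathbf{F}_T(b_1))\cap\dots\cap\xi(\mathbf{F}_T(b_k))$ of finitely many ($k\ge1$) projected fibers. **Lifting and lifting defect.** For $g\in G$, a lifting of $g$ is a finite set $L_g\subset\ker_{\mathbb{Z}}\mathcal{B}_T$ with $\xi(m)=g$ for all $m\in L_g$ such that, for every $b$ and all $u,u'\in\xi(\mathbf{F}_T(b))$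 with $u-u'=g$, there are $v,v'\in\mathbf{F}_T(b)$ with $\xi(v)=u$, $\xi(v')=u'$ and $v-v'\in L_g$. The lifting defect of $G$ is the smallest integer $d$ such that every $g\in G$ has a lifting $L_g$ with $\deg(m)\le\deg(g)+d$ for all $m\in L_g$. *)

theory Defs
  imports "HOL-Library.FuncSet" "HOL-Library.Function_Algebras" "HOL-Library.Extended_Nat"
begin

section \<open>Simplicial complexes\<close>

definition simplicial_complex :: "'a set set \<Rightarrow> bool" where
  "simplicial_complex \<Gamma> \<longleftrightarrow> finite (\<Union>\<Gamma>) \<and> (\<forall>F\<in>\<Gamma>. \<forall>F'. F' \<subseteq> F \<longrightarrow> F' \<in> \<Gamma>)"

definition facets :: "'a set set \<Rightarrow> 'a set set" where
  "facets \<Gamma> = {F \<in> \<Gamma>. \<forall>F'\<in>\<Gamma>. F \<subseteq> F' \<longrightarrow> F' = F}"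

definition graph_complex :: "'a set \<Rightarrow> 'a set set \<Rightarrow> 'a set set" where
  "graph_complex V E = {{}} \<union> {{v} |v. v \<in> V} \<union> E"

section \<open>Binary hierarchical models\<close>

definition configs :: "'a set \<Rightarrow> ('a \<Rightarrow> nat) set" where
  "configs V = (V \<rightarrow>\<^sub>E {0, 1})"

text \<open>Integer vectors indexed by the configurations on \<open>V\<close>. Entries at arguments that are not
  configurations on \<open>V\<close> are \<open>0\<close>, so that equality and subtraction of tables are those of
  functions.\<close>

definition tables :: "'a set \<Rightarrow> (('a \<Rightarrow> nat) \<Rightarrow> int) set" where
  "tables V = {u. \<forall>x. x \<notin> configs V \<longrightarrow> u x = 0}"

definition marginal ::
    "'a set \<Rightarrow> 'a set \<Rightarrow> (('a \<Rightarrow> nat) \<Rightarrow> int) \<Rightarrow> (('a \<Rightarrow> nat) \<Rightarrow> int)" where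
  "marginal V F u =
     (\<lambda>y. if y \<in> configs F then \<Sum>x\<in>{x \<in> configs V. restrict x F = y}. u x else 0)"

text \<open>The model is taken on the vertex set of \<open>\<Gamma>\<close>, which is \<open>\<Union>\<Gamma>\<close>.\<close>

definition hierarchical_map ::
    "'a set set \<Rightarrow> (('a \<Rightarrow> nat) \<Rightarrow> int) \<Rightarrow> ('a set \<Rightarrow> ('a \<Rightarrow> nat) \<Rightarrow> int)" where
  "hierarchical_map \<Gamma> u = (\<lambda>F\<in>facets \<Gamma>. marginal (\<Union>\<Gamma>) F u)"

definition hierarchical_kernel :: "'a set set \<Rightarrow> (('a \<Rightarrow> nat) \<Rightarrow> int) set" where
  "hierarchical_kernel \<Gamma> = {m \<in> tables (\<Union>\<Gamma>). hierarchical_map \<Gamma> m = (\<lambda>F\<in>facets \<Gamma>. 0)}"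

definition fiber ::
    "'a set set \<Rightarrow> ('a set \<Rightarrow> ('a \<Rightarrow> nat) \<Rightarrow> int) \<Rightarrow> (('a \<Rightarrow> nat) \<Rightarrow> int) set" where
  "fiber \<Gamma> b = {u \<in> tables (\<Union>\<Gamma>). (\<forall>x. 0 \<le> u x) \<and> hierarchical_map \<Gamma> u = b}"

section \<open>Markov bases and degrees\<close>

definition connects :: "('x \<Rightarrow> int) set \<Rightarrow> ('x \<Rightarrow> int) set \<Rightarrow> bool" where
  "connects M S \<longleftrightarrow>
     (\<forall>u\<in>S. \<forall>u'\<in>S. (u, u') \<in> {(v, v'). v \<in> S \<and> v' \<in> S \<and> v - v' \<in> M \<union> uminus ` M}\<^sup>*)"

definition markov_basis :: "'a set set \<Rightarrow> (('a \<Rightarrow> nat) \<Rightarrow> int) set \<Rightarrow> bool" where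
  "markov_basis \<Gamma> M \<longleftrightarrow>
     finite M \<and> M \<subseteq> hierarchical_kernel \<Gamma> \<and>
     (\<forall>b. fiber \<Gamma> b \<noteq> {} \<longrightarrow> connects M (fiber \<Gamma> b))"

text \<open>The sum of the entries of the positive part. It is only used for vectors of finite support
  whose entries sum to \<open>0\<close>, for which the negative part has the same sum.\<close>

definition deg :: "('x \<Rightarrow> int) \<Rightarrow> nat" where
  "deg m = (\<Sum>x | 0 < m x. nat (m x))"

text \<open>For finite sets only; the empty set has degree \<open>0\<close>.\<close>

definition moves_degree :: "('x \<Rightarrow> int) set \<Rightarrow> nat" where
  "moves_degree M = Max (insert 0 (deg ` M))"

text \<open>The infimum is attained as soon as a Markov basis exists; otherwise it would be \<open>\<infinity>\<close>. So a
  finite upper bound on it yields a Markov basis within that bound.\<close>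

definition markov_degree :: "'a set set \<Rightarrow> enat" where
  "markov_degree \<Gamma> = (INF M\<in>{M. markov_basis \<Gamma> M}. enat (moves_degree M))"

section \<open>The graphs \<open>K\<^sub>3\<^sub>,\<^sub>N\<close> and the three-star\<close>

definition wnode :: "nat \<Rightarrow> nat" where
  "wnode j = 3 + j"

definition K3 :: "nat \<Rightarrow> nat set set" where
  "K3 N = graph_complex ({1, 2, 3} \<union> wnode ` {1..N})
     {{i, wnode j} |i j. i \<in> {1, 2, 3} \<and> j \<in> {1..N}}"

definition star3 :: "nat set set" where
  "star3 = graph_complex {1, 2, 3, 4} {{1, 4}, {2, 4}, {3, 4}}"

lemma K3_glued_stars:
  assumes "1 \<le> N"
  shows "K3 N = (\<Union>j\<in>{1..N}. image (id(4 := wnode j)) ` star3)"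
proof
  show "(\<Union>j\<in>{1..N}. image (id(4 := wnode j)) ` star3) \<subseteq> K3 N"
  proof
    fix F assume "F \<in> (\<Union>j\<in>{1..N}. image (id(4 := wnode j)) ` star3)"
    then obtain j F' where j: "j \<in> {1..N}" and F': "F' \<in> star3"
      and F: "F = (id(4 := wnode j)) ` F'"
      by (elim UN_E imageE)
    have "F' \<in> {{}, {1}, {2}, {3}, {4}, {1, 4}, {2, 4}, {3, 4}}"
      using F' unfolding star3_def graph_complex_def
      by (elim UnE CollectE exE conjE insertE emptyE) simp_all
    then have "F \<in> {{}, {1}, {2}, {3}, {wnode j}, {1, wnode j}, {2, wnode j}, {3, wnode j}}"
      unfolding F by (elim insertE emptyE) simp_all
    with j show "F \<in> K3 N" unfolding K3_def graph_complex_def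
      by (elim insertE emptyE) blast+
  qed
  show "K3 N \<subseteq> (\<Union>j\<in>{1..N}. image (id(4 := wnode j)) ` star3)"
  proof
    fix F assume "F \<in> K3 N"
    then consider "F = {}" | i where "F = {i}" "i \<in> {1, 2, 3}"
      | j where "F = {wnode j}" "j \<in> {1..N}"
      | i j where "F = {i, wnode j}" "i \<in> {1, 2, 3}" "j \<in> {1..N}"
      unfolding K3_def graph_complex_def by blast
    then show "F \<in> (\<Union>j\<in>{1..N}. image (id(4 := wnode j)) ` star3)"
    proof cases
      case 1
      have "F = (id(4 := wnode 1)) ` {}" using 1 by simp
      moreover have "{} \<in> star3" by (simp add: star3_def graph_complex_def)
      ultimately show ?thesis using assms by (intro UN_I[of 1] image_eqI) auto
    next
      case (2 i)
      have "F = (id(4 := wnode 1)) ` {i}" using 2 by auto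
      moreover have "{i} \<in> star3" using 2 by (auto simp: star3_def graph_complex_def)
      ultimately show ?thesis using assms by (intro UN_I[of 1] image_eqI) auto
    next
      case (3 j)
      have "F = (id(4 := wnode j)) ` {4}" using 3 by auto
      moreover have "{4} \<in> star3" by (auto simp: star3_def graph_complex_def)
      ultimately show ?thesis using 3 by (intro UN_I[of j] image_eqI) auto
    next
      case (4 i j)
      have "F = (id(4 := wnode j)) ` {i, 4}" using 4 by auto
      moreover have "{i, 4} \<in> star3" using 4 by (auto simp: star3_def graph_complex_def)
      ultimately show ?thesis using 4 by (intro UN_I[of j] image_eqI) auto
    qed
  qed
qed

lemma simplicial_complex_graph_complex:
  assumes "finite V" "\<And>e. e \<in> E \<Longrightarrow> \<exists>i\<in>V. \<exists>j\<in>V. e = {i, j}"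
  shows "simplicial_complex (graph_complex V E)"
proof -
  have sub: "\<Union>(graph_complex V E) \<subseteq> V"
  proof
    fix i assume "i \<in> \<Union>(graph_complex V E)"
    then obtain F where F: "i \<in> F" "F \<in> graph_complex V E" by blast
    show "i \<in> V"
    proof (cases "F \<in> E")
      case True
      with assms(2)[OF True] F(1) show ?thesis by blast
    next
      case False
      with F show ?thesis unfolding graph_complex_def by blast
    qed
  qed
  have down: "F' \<in> graph_complex V E" if F: "F \<in> graph_complex V E" "F' \<subseteq> F" for F F'
  proof (cases "F \<in> E")
    case True
    then obtain i j where ij: "i \<in> V" "j \<in> V" "F = {i, j}" using assms(2) by blast
    then have "F' = {} \<or> F' = {i} \<or> F' = {j} \<or> F' = F" using F(2) by blast
    then show ?thesis using ij F(1) unfolding graph_complex_def by blast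
  next
    case False
    then have "F = {} \<or> (\<exists>v\<in>V. F = {v})" using F(1) unfolding graph_complex_def by blast
    then have "F' = {} \<or> F' = F" using F(2) by blast
    then show ?thesis using F(1) unfolding graph_complex_def by blast
  qed
  show ?thesis
    unfolding simplicial_complex_def
    by (intro conjI ballI allI impI finite_subset[OF sub assms(1)]) (rule down)
qed

lemma simplicial_complex_K3: "simplicial_complex (K3 N)"
  unfolding K3_def
proof (rule simplicial_complex_graph_complex)
  show "finite ({1, 2, 3} \<union> wnode ` {1..N})" by simp
next
  fix e assume "e \<in> {{i, wnode j} |i j. i \<in> {1, 2, 3} \<and> j \<in> {1..N}}"
  then obtain i j where "i \<in> {1, 2, 3}" "j \<in> {1..N}" "e = {i, wnode j}" by blast
  then show "\<exists>i\<in>{1, 2, 3} \<union> wnode ` {1..N}. \<exists>j\<in>{1, 2, 3} \<union> wnode ` {1..N}. e = {i, j}"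
    by blast
qed

lemma simplicial_complex_star3: "simplicial_complex star3"
  unfolding star3_def
proof (rule simplicial_complex_graph_complex)
  show "finite {1, 2, 3, 4::nat}" by simp
next
  fix e :: "nat set" assume "e \<in> {{1, 4}, {2, 4}, {3, 4}}"
  then show "\<exists>i\<in>{1, 2, 3, 4}. \<exists>j\<in>{1, 2, 3, 4}. e = {i, j}" by blast
qed

lemma simplicial_complex_K3_Un_Pow: "simplicial_complex (K3 N \<union> Pow {1, 2, 3})"
  unfolding simplicial_complex_def
proof (intro conjI ballI allI impI)
  show "finite (\<Union>(K3 N \<union> Pow {1, 2, 3}))"
    using simplicial_complex_K3[of N] unfolding simplicial_complex_def
    by (simp only: Union_Un_distrib Union_Pow_eq finite_Un) simp
next
  fix F F' assume "F \<in> K3 N \<union> Pow {1, 2, 3}" "F' \<subseteq> F"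
  then show "F' \<in> K3 N \<union> Pow {1, 2, 3}"
    using simplicial_complex_K3[of N] unfolding simplicial_complex_def by blast
qed

section \<open>Kernel Markov bases, PF Markov bases and liftings\<close>

definition kernel_markov_basis :: "nat \<Rightarrow> ((nat \<Rightarrow> nat) \<Rightarrow> int) set \<Rightarrow> bool" where
  "kernel_markov_basis N M \<longleftrightarrow> markov_basis (K3 N \<union> Pow {1, 2, 3}) M"

definition \<xi> :: "((nat \<Rightarrow> nat) \<Rightarrow> int) \<Rightarrow> ((nat \<Rightarrow> nat) \<Rightarrow> int)" where
  "\<xi> = marginal {1, 2, 3, 4} {1, 2, 3}"

definition pf_markov_basis :: "((nat \<Rightarrow> nat) \<Rightarrow> int) set \<Rightarrow> bool" where
  "pf_markov_basis G \<longleftrightarrow>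
     finite G \<and> G \<subseteq> tables {1, 2, 3} \<and>
     (\<forall>g\<in>G. \<forall>i\<in>{1, 2, 3}. marginal {1, 2, 3} {i} g = 0) \<and>
     (\<forall>B. finite B \<and> B \<noteq> {} \<and> (\<Inter>b\<in>B. \<xi> ` fiber star3 b) \<noteq> {} \<longrightarrow>
        connects G (\<Inter>b\<in>B. \<xi> ` fiber star3 b))"

definition is_lifting :: "((nat \<Rightarrow> nat) \<Rightarrow> int) \<Rightarrow> ((nat \<Rightarrow> nat) \<Rightarrow> int) set \<Rightarrow> bool" where
  "is_lifting g L \<longleftrightarrow>
     finite L \<and> L \<subseteq> hierarchical_kernel star3 \<and> (\<forall>m\<in>L. \<xi> m = g) \<and>
     (\<forall>b. \<forall>u\<in>\<xi> ` fiber star3 b. \<forall>u'\<in>\<xi> ` fiber star3 b. u - u' = g \<longrightarrow>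
        (\<exists>v\<in>fiber star3 b. \<exists>v'\<in>fiber star3 b. \<xi> v = u \<and> \<xi> v' = u' \<and> v - v' \<in> L))"

definition liftable_with_defect :: "((nat \<Rightarrow> nat) \<Rightarrow> int) set \<Rightarrow> int \<Rightarrow> bool" where
  "liftable_with_defect G d \<longleftrightarrow>
     (\<forall>g\<in>G. \<exists>L. is_lifting g L \<and> (\<forall>m\<in>L. int (deg m) \<le> int (deg g) + d))"

text \<open>A relation rather than a function: for instance, the empty set has no lifting defect, since
  every integer qualifies.\<close>

definition has_lifting_defect :: "((nat \<Rightarrow> nat) \<Rightarrow> int) set \<Rightarrow> int \<Rightarrow> bool" where
  "has_lifting_defect G d \<longleftrightarrow>
     liftable_with_defect G d \<and> (\<forall>d'. liftable_with_defect G d' \<longrightarrow> d \<le> d')"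

end

theory Submission
  imports Defs "HOL-Combinatorics.Permutations"
begin

text \<open>A nonnegative table of the \<open>K\<^sub>3\<^sub>,\<^sub>N\<close> model is a family of individuals, each carrying a vertex of the
  cube (its values at the nodes 1, 2, 3) and \<open>N\<close> binary labels. The fiber fixes, for every label, the
  one-node marginals of the cube vertices of the individuals with label 1 and with label 0. Changing
  \<open>r\<close> individuals is a move of degree at most \<open>r\<close>.

  If two tables have the same cube vertices, the labels can be corrected one label at a time: the
  conformal (Graver) decomposition of the one-node marginal kernel has elements of degree at most 3,
  so at most 6 individuals change at once.

  The cube vertices themselves are moved along a PF Markov basis \<open>G\<close>: 24 quadrics and 8 quartics. A
  projected fiber consists of the tables \<open>u\<close> that dominate some \<open>a \<ge> 0\<close> with prescribed marginals, so
  membership says that a marginal vector is a sum attained in the box below \<open>u\<close>. Such sums are the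
  lattice points of a zonotope, with facets given by the vertex counts and edge counts of \<open>u\<close>, except
  that parity obstructions occur if \<open>u\<close> is supported on one of the two inscribed tetrahedra. Hence an
  intersection of projected fibers is cut out by lower bounds on vertex and edge counts, up to the
  tetrahedral points, and \<open>G\<close> contains a move that stays inside and shortens the distance.

  A move \<open>g \<in> G\<close> is lifted by a pair \<open>(m, g - m)\<close>. If the pair has minimal degree, no quadric can be
  exchanged between its two parts, which leaves finitely many \<open>m\<close>; all of them have excess at most 2
  in total and at most 1 at each vertex. So the liftings for the \<open>N\<close> labels are supported on common
  \<open>4 + min 8 (2N)\<close> individuals, which gives both bounds.\<close>

text \<open>The facet description is decisive because it does not refer to the prescribed marginals:
  a table \<open>v\<close> with the marginals of \<open>u\<close> and \<open>u'\<close> that at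
  every vertex and every edge is at least as large as one of them, and respects the tetrahedral
  exceptions, lies in every projected fiber that contains both. One step therefore serves an
  arbitrary intersection, and with it all labels at once. Since the kernel of the marginals has rank
  4, the Graver property, the existence of a good step and the completeness of the lists of
  irreducible liftings are statements of linear integer arithmetic in few variables. A change of
  cube vertices must leave the labels untouched outside the common support. Label corrections are
  therefore made beforehand, which costs degree 6 besides \<open>4 + min 8 (2 * N)\<close>; for
  \<open>N \<ge> 1\<close> the latter is at least 6 anyway.\<close>

section \<open>The one-node marginals of the cube\<close>

text \<open>Vertices 0 to 3 are 111, 100, 010, 001, and vertex \<open>4 + n\<close> is antipodal to vertex \<open>n\<close>. With this
  order the kernel of the one-node marginals consists of the vectors
  \<open>(d, d - h)\<close> with \<open>d\<^sub>0 + d\<^sub>1 + d\<^sub>2 + d\<^sub>3 = 2 h\<close>. The tetrahedra are \<open>{0..3}\<close> and \<open>{4..7}\<close>.\<close>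

definition vertex_bit :: "nat \<Rightarrow> nat \<Rightarrow> nat" where
  "vertex_bit i n = [[1, 1, 0, 0, 0, 0, 1, 1], [1, 0, 1, 0, 0, 1, 0, 1], [1, 0, 0, 1, 0, 1, 1, 0]] ! (i - 1) ! n"

definition same_marg :: "(nat \<Rightarrow> int) \<Rightarrow> (nat \<Rightarrow> int) \<Rightarrow> bool" where
  "same_marg f f' \<longleftrightarrow> (\<forall>i\<in>{1, 2, 3}. \<forall>a\<in>{0, 1}.
     (\<Sum>n<8. if vertex_bit i n = a then f n else 0) = (\<Sum>n<8. if vertex_bit i n = a then f' n else 0))"

text \<open>Up to sign: one quadric for each of the six square faces (one diagonal against the
  other) and one for each of the six pairs of space diagonals of the cube.\<close>

definition half_quadrics :: "int list list" where
  "half_quadrics =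
  [[0, 0, 1, -1, 0, 0, 1, -1],
   [0, 0, 1, 1, -1, -1, 0, 0],
   [0, 1, -1, 0, 0, 1, -1, 0],
   [0, 1, 0, -1, 0, 1, 0, -1],
   [0, 1, 0, 1, -1, 0, -1, 0],
   [0, 1, 1, 0, -1, 0, 0, -1],
   [1, -1, 0, 0, 1, -1, 0, 0],
   [1, 0, -1, 0, 1, 0, -1, 0],
   [1, 0, 0, -1, 1, 0, 0, -1],
   [1, 0, 0, 1, 0, -1, -1, 0],
   [1, 0, 1, 0, 0, -1, 0, -1],
   [1, 1, 0, 0, 0, 0, -1, -1]]"

text \<open>One cubic for each vertex of the cube, up to sign: twice the vertex plus its antipode
  against its three neighbours.\<close>

definition half_cubics :: "int list list" where
  "half_cubics =
  [[0, 0, 0, 2, -1, -1, -1, 1],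
   [0, 0, 2, 0, -1, -1, 1, -1],
   [0, 2, 0, 0, -1, 1, -1, -1],
   [1, -1, -1, -1, 2, 0, 0, 0],
   [1, -1, 1, 1, 0, -2, 0, 0],
   [1, 1, -1, 1, 0, 0, -2, 0],
   [1, 1, 1, -1, 0, 0, 0, -2],
   [2, 0, 0, 0, 1, -1, -1, -1]]"

text \<open>The three ways of playing two space diagonals against the other two, and the odd
  tetrahedron against the even one. The last is, up to a factor, the only kernel vector for which
  every edge count vanishes.\<close>

definition half_quartics :: "int list list" where
  "half_quartics =
  [[1, 1, -1, -1, 1, 1, -1, -1],
   [1, -1, 1, -1, 1, -1, 1, -1],
   [1, -1, -1, 1, 1, -1, -1, 1],
   [1, 1, 1, 1, -1, -1, -1, -1]]"

definition both_signs :: "int list list \<Rightarrow> int list list" where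
  "both_signs ks = ks @ map (map uminus) ks"

lemma sum8: "(\<Sum>n<8::nat. f n) = f 0 + f 1 + f 2 + f 3 + f 4 + f 5 + f 6 + f 7"
  for f :: "nat \<Rightarrow> 'b::comm_monoid_add"
  by (simp add: eval_nat_numeral add.assoc)

lemma all8: "(\<forall>n<8::nat. P n) \<longleftrightarrow> P 0 \<and> P 1 \<and> P 2 \<and> P 3 \<and> P 4 \<and> P 5 \<and> P 6 \<and> P 7"
  by (simp add: eval_nat_numeral All_less_Suc) blast

lemma ex8: "(\<exists>n<8::nat. P n) \<longleftrightarrow> P 0 \<or> P 1 \<or> P 2 \<or> P 3 \<or> P 4 \<or> P 5 \<or> P 6 \<or> P 7"
  by (simp add: eval_nat_numeral Ex_less_Suc) blast

lemma same_marg_iff: "same_marg f f' \<longleftrightarrow>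
    f 0 + f 1 + f 6 + f 7 = f' 0 + f' 1 + f' 6 + f' 7 \<and>
    f 2 + f 3 + f 4 + f 5 = f' 2 + f' 3 + f' 4 + f' 5 \<and>
    f 0 + f 2 + f 5 + f 7 = f' 0 + f' 2 + f' 5 + f' 7 \<and>
    f 1 + f 3 + f 4 + f 6 = f' 1 + f' 3 + f' 4 + f' 6 \<and>
    f 0 + f 3 + f 5 + f 6 = f' 0 + f' 3 + f' 5 + f' 6 \<and>
    f 1 + f 2 + f 4 + f 7 = f' 1 + f' 2 + f' 4 + f' 7"
  by (simp add: same_marg_def sum8 vertex_bit_def) linarith

lemma same_marg_refl [simp]: "same_marg f f" by (simp add: same_marg_def)
lemma same_marg_sym: "same_marg f g \<Longrightarrow> same_marg g f" by (simp add: same_marg_def)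
lemma same_marg_trans: "same_marg f g \<Longrightarrow> same_marg g h \<Longrightarrow> same_marg f h" by (simp add: same_marg_def)
lemma same_marg_add: "same_marg f g \<Longrightarrow> same_marg f' g' \<Longrightarrow> same_marg (\<lambda>n. f n + f' n) (\<lambda>n. g n + g' n)"
  unfolding same_marg_iff by linarith
lemma same_marg_diff: "same_marg f g \<Longrightarrow> same_marg f' g' \<Longrightarrow> same_marg (\<lambda>n. f n - f' n) (\<lambda>n. g n - g' n)"
  unfolding same_marg_iff by linarith

text \<open>The sign-compatible order of Graver bases: \<open>k\<close> is a part of
  \<open>m\<close> without cancellation.\<close>

definition conformal :: "(nat \<Rightarrow> int) \<Rightarrow> (nat \<Rightarrow> int) \<Rightarrow> bool" where
  "conformal k m \<longleftrightarrow> (\<forall>n<8. (0 < k n \<longrightarrow> k n \<le> m n) \<and> (k n < 0 \<longrightarrow> m n \<le> k n))"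

lemma kernel_coords:
  assumes "same_marg m (\<lambda>_. 0)"
  obtains h where "m 0 + m 1 + m 2 + m 3 = 2 * h"
    "m 4 = m 0 - h" "m 5 = m 1 - h" "m 6 = m 2 - h" "m 7 = m 3 - h"
proof (rule that[of "m 0 - m 4"])
qed (use assms[unfolded same_marg_iff] in simp_all)

text \<open>The Graver property of the marginal kernel, as a case analysis on the four free
  coordinates and \<open>h\<close>. Cubics cannot be avoided here: their two sides contain no
  quadric. Their degree 3, once for each of the two label values, is the origin of the kernel degree
  6.\<close>

lemma conformal_graver:
  assumes "same_marg m (\<lambda>_. 0)" "\<exists>n<8. m n \<noteq> 0"
  shows "\<exists>k\<in>set (both_signs (half_quadrics @ half_cubics)). conformal (nth k) m"
proof -
  obtain h where h: "m 0 + m 1 + m 2 + m 3 = 2 * h"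
    "m 4 = m 0 - h" "m 5 = m 1 - h" "m 6 = m 2 - h" "m 7 = m 3 - h"
    using kernel_coords[OF assms(1)] .
  have "m 0 \<noteq> 0 \<or> m 1 \<noteq> 0 \<or> m 2 \<noteq> 0 \<or> m 3 \<noteq> 0"
    using assms(2) h unfolding ex8 by linarith
  with h(1) show ?thesis
    unfolding conformal_def all8 both_signs_def half_quadrics_def half_cubics_def
    by (simp add: h(2-5)) (smt (verit))
qed

section \<open>Lattice points of cube zonotopes\<close>

text \<open>Greedy choice: each coordinate is taken as large as the lower bounds of the later ones
  permit.\<close>

lemma ex_point_in_box:
  fixes l r :: "nat \<Rightarrow> int"
  assumes "l 0 \<le> r 0" "l 1 \<le> r 1" "l 2 \<le> r 2" "l 3 \<le> r 3"
    "l 0 + l 1 + l 2 + l 3 \<le> s" "s \<le> r 0 + r 1 + r 2 + r 3"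
  obtains x0 x1 x2 x3 where "l 0 \<le> x0" "x0 \<le> r 0" "l 1 \<le> x1" "x1 \<le> r 1"
    "l 2 \<le> x2" "x2 \<le> r 2" "l 3 \<le> x3" "x3 \<le> r 3" "x0 + x1 + x2 + x3 = s"
proof -
  define x0 where "x0 = min (r 0) (s - l 1 - l 2 - l 3)"
  define x1 where "x1 = min (r 1) (s - x0 - l 2 - l 3)"
  define x2 where "x2 = min (r 2) (s - x0 - x1 - l 3)"
  show ?thesis
    by (rule that[of x0 x1 x2 "s - x0 - x1 - x2"]) (use assms in \<open>simp_all add: x0_def x1_def x2_def min_def\<close>)
qed

text \<open>Looking for \<open>0 \<le> x \<le> p\<close> and \<open>0 \<le> y \<le> q\<close> on the two tetrahedra with given marginals, one finds
  \<open>y\<^sub>i = x\<^sub>i + c\<^sub>i - t\<close> and \<open>x\<^sub>0 + x\<^sub>1 + x\<^sub>2 + x\<^sub>3 = 2 t + e\<close>, where \<open>c\<close> and the parity \<open>e\<close> are determined by the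
  marginals. So only the integer \<open>t\<close> has to be found, and the facet inequalities are what is left
  after eliminating it; the assumptions \<open>par1\<close> and \<open>par2\<close> exclude the parity obstructions.\<close>

locale facet_bounds =
  fixes p0 p1 p2 p3 q0 q1 q2 q3 c0 c1 c2 c3 e :: int
  assumes nonneg: "0 \<le> p0" "0 \<le> p1" "0 \<le> p2" "0 \<le> p3" "0 \<le> q0" "0 \<le> q1" "0 \<le> q2" "0 \<le> q3"
  and e: "0 \<le> e" "e \<le> 1"
  and f1: "0 \<le> p0 + 2 * c0 + e" "0 \<le> p1 + 2 * c1 + e" "0 \<le> p2 + 2 * c2 + e" "0 \<le> p3 + 2 * c3 + e"
  and f2: "2 * c0 + e \<le> 2 * q0 + p1 + p2 + p3" "2 * c1 + e \<le> 2 * q1 + p0 + p2 + p3"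
    "2 * c2 + e \<le> 2 * q2 + p0 + p1 + p3" "2 * c3 + e \<le> 2 * q3 + p0 + p1 + p2"
  and f3: "c0 \<le> q0 + c1 + c2 + c3 + e" "c1 \<le> q1 + c0 + c2 + c3 + e"
    "c2 \<le> q2 + c0 + c1 + c3 + e" "c3 \<le> q3 + c0 + c1 + c2 + e"
  and f4: "c1 + c2 + c3 + e \<le> c0 + 2 * p0 + q1 + q2 + q3" "c0 + c2 + c3 + e \<le> c1 + 2 * p1 + q0 + q2 + q3"
    "c0 + c1 + c3 + e \<le> c2 + 2 * p2 + q0 + q1 + q3" "c0 + c1 + c2 + e \<le> c3 + 2 * p3 + q0 + q1 + q2"
  and f5: "c0 \<le> c1 + q0 + p1" "c0 \<le> c2 + q0 + p2" "c0 \<le> c3 + q0 + p3"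
    "c1 \<le> c0 + q1 + p0" "c1 \<le> c2 + q1 + p2" "c1 \<le> c3 + q1 + p3"
    "c2 \<le> c0 + q2 + p0" "c2 \<le> c1 + q2 + p1" "c2 \<le> c3 + q2 + p3"
    "c3 \<le> c0 + q3 + p0" "c3 \<le> c1 + q3 + p1" "c3 \<le> c2 + q3 + p2"
  and f6: "0 \<le> c0 + c1 + e" "0 \<le> c0 + c2 + e" "0 \<le> c0 + c3 + e"
    "0 \<le> c1 + c2 + e" "0 \<le> c1 + c3 + e" "0 \<le> c2 + c3 + e"
  and f7: "c0 + c1 + e \<le> q0 + q1 + p2 + p3" "c0 + c2 + e \<le> q0 + q2 + p1 + p3"
    "c0 + c3 + e \<le> q0 + q3 + p1 + p2" "c1 + c2 + e \<le> q1 + q2 + p0 + p3"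
    "c1 + c3 + e \<le> q1 + q3 + p0 + p2" "c2 + c3 + e \<le> q2 + q3 + p0 + p1"
  and par1: "p0 + p1 + p2 + p3 = 0 \<Longrightarrow> e = 0"
  and par2: "q0 + q1 + q2 + q3 = 0 \<Longrightarrow> (c0 + c1 + c2 + c3 + e) mod 2 = 0"
begin

text \<open>For fixed \<open>t\<close> the vector \<open>x\<close> ranges over a box with lower
  corner \<open>max 0 (t - c i)\<close> and upper corner \<open>min (p i) (q i + t - c i)\<close>.
  The listed bounds say that the box is nonempty and that the coordinate sums of its corners enclose
  \<open>2 * t + e\<close>, with one inequality for each way of resolving the maxima or minima.
  Resolving two of the four each way cancels \<open>t\<close>; this is \<open>f6\<close> and
  \<open>f7\<close>. The assumptions \<open>f1\<close> to \<open>f5\<close> compare lower with upper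
  bounds on \<open>t\<close>, and the bounds on \<open>2 * t\<close> need rounding, which is where
  \<open>par1\<close> and \<open>par2\<close> enter.\<close>

lemma ex_tau:
  obtains t where
    "- e \<le> 2 * t" "t \<le> c0 + p0" "t \<le> c1 + p1" "t \<le> c2 + p2" "t \<le> c3 + p3"
    "c0 \<le> q0 + t" "c1 \<le> q1 + t" "c2 \<le> q2 + t" "c3 \<le> q3 + t"
    "- c0 - e \<le> t" "- c1 - e \<le> t" "- c2 - e \<le> t" "- c3 - e \<le> t"
    "c1 + c2 + c3 + e \<le> q1 + q2 + q3 + p0 + t" "c0 + c2 + c3 + e \<le> q0 + q2 + q3 + p1 + t"
    "c0 + c1 + c3 + e \<le> q0 + q1 + q3 + p2 + t" "c0 + c1 + c2 + e \<le> q0 + q1 + q2 + p3 + t"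
    "c0 + c1 + c2 + c3 + e \<le> q0 + q1 + q2 + q3 + 2 * t"
    "2 * t + e \<le> p0 + p1 + p2 + p3" "2 * t \<le> c0 + c1 + c2 + c3 + e"
    "t \<le> c1 + c2 + c3 + e" "t \<le> c0 + c2 + c3 + e" "t \<le> c0 + c1 + c3 + e" "t \<le> c0 + c1 + c2 + e"
    "t + c0 + e \<le> q0 + p1 + p2 + p3" "t + c1 + e \<le> q1 + p0 + p2 + p3"
    "t + c2 + e \<le> q2 + p0 + p1 + p3" "t + c3 + e \<le> q3 + p0 + p1 + p2"
proof -
  \<comment> \<open>The bound
    \<open>c0 + c1 + c2 + c3 + e - (q0 + q1 + q2 + q3) \<le> 2 * t\<close>, halved and rounded
    up.\<close>
  define z where "z = (c0 + c1 + c2 + c3 + e - (q0 + q1 + q2 + q3) + 1) div 2"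
  \<comment> \<open>All lower bounds on \<open>t\<close>. The entry \<open>0\<close> is what
    \<open>- e \<le> 2 * t\<close> means for an integer, because \<open>e\<close> is 0 or 1.\<close>
  define L where "L = {0, c0 - q0, c1 - q1, c2 - q2, c3 - q3, - c0 - e, - c1 - e, - c2 - e, - c3 - e,
     c1 + c2 + c3 + e - (q1 + q2 + q3 + p0), c0 + c2 + c3 + e - (q0 + q2 + q3 + p1),
     c0 + c1 + c3 + e - (q0 + q1 + q3 + p2), c0 + c1 + c2 + e - (q0 + q1 + q2 + p3), z}"
  define t where "t = Max L"
  have L: "finite L" "L \<noteq> {}" unfolding L_def by simp_all
  have "Max L \<in> L" by (rule Max_in[OF L])
  then have eq: "t = 0 \<or> t = c0 - q0 \<or> t = c1 - q1 \<or> t = c2 - q2 \<or> t = c3 - q3 \<or> t = - c0 - e \<or> t = - c1 - e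
    \<or> t = - c2 - e \<or> t = - c3 - e \<or>
     t = c1 + c2 + c3 + e - (q1 + q2 + q3 + p0) \<or> t = c0 + c2 + c3 + e - (q0 + q2 + q3 + p1) \<or>
     t = c0 + c1 + c3 + e - (q0 + q1 + q3 + p2) \<or> t = c0 + c1 + c2 + e - (q0 + q1 + q2 + p3) \<or> t = z"
    unfolding t_def[symmetric] by (simp add: L_def)
  have "\<forall>l\<in>L. l \<le> t" using L by (simp add: t_def)
  then have lower: "0 \<le> t" "c0 - q0 \<le> t" "c1 - q1 \<le> t" "c2 - q2 \<le> t" "c3 - q3 \<le> t"
    "- c0 - e \<le> t" "- c1 - e \<le> t" "- c2 - e \<le> t" "- c3 - e \<le> t"
    "c1 + c2 + c3 + e - (q1 + q2 + q3 + p0) \<le> t" "c0 + c2 + c3 + e - (q0 + q2 + q3 + p1) \<le> t"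
    "c0 + c1 + c3 + e - (q0 + q1 + q3 + p2) \<le> t" "c0 + c1 + c2 + e - (q0 + q1 + q2 + p3) \<le> t" "z \<le> t"
    unfolding L_def by simp_all
  have z: "c0 + c1 + c2 + c3 + e - (q0 + q1 + q2 + q3) \<le> 2 * z"
    "2 * z \<le> c0 + c1 + c2 + c3 + e - (q0 + q1 + q2 + q3) + 1" unfolding z_def by linarith+
  have par1': "e = 0 \<or> 1 \<le> p0 + p1 + p2 + p3" using par1 nonneg by linarith
  have par2': "1 \<le> q0 + q1 + q2 + q3 \<or> 2 * z = c0 + c1 + c2 + c3 + e - (q0 + q1 + q2 + q3)"
  proof (cases "q0 + q1 + q2 + q3 = 0")
    case True
    have "S mod 2 = 0 \<Longrightarrow> 2 * ((S + 1) div 2) = S" for S :: int by presburger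
    then show ?thesis using par2[OF True] True unfolding z_def by simp
  qed (use nonneg in linarith)
  note bounds = nonneg e f1 f2 f3 f4 f5 f6 f7 par1' par2' z
  show ?thesis
    by (rule that[of t]) (use lower eq bounds in \<open>smt (verit)\<close>)+
qed

lemma ex_point:
  obtains x0 x1 x2 x3 t where
    "0 \<le> x0" "x0 \<le> p0" "0 \<le> x1" "x1 \<le> p1" "0 \<le> x2" "x2 \<le> p2" "0 \<le> x3" "x3 \<le> p3"
    "x0 + x1 + x2 + x3 = 2 * t + e"
    "0 \<le> x0 + c0 - t" "x0 + c0 - t \<le> q0" "0 \<le> x1 + c1 - t" "x1 + c1 - t \<le> q1"
    "0 \<le> x2 + c2 - t" "x2 + c2 - t \<le> q2" "0 \<le> x3 + c3 - t" "x3 + c3 - t \<le> q3"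
proof (rule ex_tau)
  fix t
  assume t: "- e \<le> 2 * t" "t \<le> c0 + p0" "t \<le> c1 + p1" "t \<le> c2 + p2" "t \<le> c3 + p3"
    "c0 \<le> q0 + t" "c1 \<le> q1 + t" "c2 \<le> q2 + t" "c3 \<le> q3 + t"
    "- c0 - e \<le> t" "- c1 - e \<le> t" "- c2 - e \<le> t" "- c3 - e \<le> t"
    "c1 + c2 + c3 + e \<le> q1 + q2 + q3 + p0 + t" "c0 + c2 + c3 + e \<le> q0 + q2 + q3 + p1 + t"
    "c0 + c1 + c3 + e \<le> q0 + q1 + q3 + p2 + t" "c0 + c1 + c2 + e \<le> q0 + q1 + q2 + p3 + t"
    "c0 + c1 + c2 + c3 + e \<le> q0 + q1 + q2 + q3 + 2 * t"
    "2 * t + e \<le> p0 + p1 + p2 + p3" "2 * t \<le> c0 + c1 + c2 + c3 + e"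
    "t \<le> c1 + c2 + c3 + e" "t \<le> c0 + c2 + c3 + e" "t \<le> c0 + c1 + c3 + e" "t \<le> c0 + c1 + c2 + e"
    "t + c0 + e \<le> q0 + p1 + p2 + p3" "t + c1 + e \<le> q1 + p0 + p2 + p3"
    "t + c2 + e \<le> q2 + p0 + p1 + p3" "t + c3 + e \<le> q3 + p0 + p1 + p2"
  define l where "l = nth [max 0 (t - c0), max 0 (t - c1), max 0 (t - c2), max 0 (t - c3)]"
  define r where "r = nth [min p0 (q0 + t - c0), min p1 (q1 + t - c1), min p2 (q2 + t - c2), min p3 (q3 + t - c3)]"
  have lr: "l 0 = max 0 (t - c0)" "l 1 = max 0 (t - c1)" "l 2 = max 0 (t - c2)" "l 3 = max 0 (t - c3)"
    "r 0 = min p0 (q0 + t - c0)" "r 1 = min p1 (q1 + t - c1)" "r 2 = min p2 (q2 + t - c2)" "r 3 = min p3 (q3 + t - c3)"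
    unfolding l_def r_def by simp_all
  \<comment> \<open>With every maximum and minimum resolved, each of the sixteen cases of a corner
    sum is one of the bounds on \<open>t\<close>, or one of \<open>f6\<close> and
    \<open>f7\<close>.\<close>
  have l: "l 0 = 0 \<or> l 0 = t - c0" "l 1 = 0 \<or> l 1 = t - c1" "l 2 = 0 \<or> l 2 = t - c2" "l 3 = 0 \<or> l 3 = t - c3"
    and r: "r 0 = p0 \<or> r 0 = q0 + t - c0" "r 1 = p1 \<or> r 1 = q1 + t - c1"
      "r 2 = p2 \<or> r 2 = q2 + t - c2" "r 3 = p3 \<or> r 3 = q3 + t - c3"
    unfolding lr by linarith+
  have "l 0 + l 1 + l 2 + l 3 \<le> 2 * t + e"
    using l t(1) t(10-13) f6 t(20-24) by (smt (verit))
  moreover have "2 * t + e \<le> r 0 + r 1 + r 2 + r 3"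
    using r t(14-19) t(25-28) f7 by (smt (verit))
  moreover have "l 0 \<le> r 0" "l 1 \<le> r 1" "l 2 \<le> r 2" "l 3 \<le> r 3"
    unfolding lr using t(2-9) nonneg by simp_all
  ultimately obtain x0 x1 x2 x3 where
    "l 0 \<le> x0" "x0 \<le> r 0" "l 1 \<le> x1" "x1 \<le> r 1"
    "l 2 \<le> x2" "x2 \<le> r 2" "l 3 \<le> x3" "x3 \<le> r 3" "x0 + x1 + x2 + x3 = 2 * t + e"
    using ex_point_in_box[of l r "2 * t + e"] by blast
  then show thesis unfolding lr by (intro that[of x0 x1 x2 x3 t]) simp_all
qed

end

lemma same_marg_coords:
  assumes "same_marg f g"
  obtains h where "f 0 + f 1 + f 2 + f 3 = g 0 + g 1 + g 2 + g 3 + 2 * h"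
    "f 4 = g 4 + f 0 - g 0 - h" "f 5 = g 5 + f 1 - g 1 - h"
    "f 6 = g 6 + f 2 - g 2 - h" "f 7 = g 7 + f 3 - g 3 - h"
proof (rule that[of "f 0 - g 0 - (f 4 - g 4)"])
qed (use assms[unfolded same_marg_iff] in simp_all)

lemma all4: "(\<forall>n<4::nat. P n) \<longleftrightarrow> P 0 \<and> P 1 \<and> P 2 \<and> P 3"
  by (simp add: eval_nat_numeral All_less_Suc) blast

text \<open>Modulo the common marginals, every facet inequality bounds a single vertex or edge count
  of the upper table from below. Indeed the counts of square faces (\<open>f6\<close>,
  \<open>f7\<close>) are determined by the marginals, and so is the difference between the antipodal
  count and the sum of twice a vertex count and its three neighbours (\<open>f2\<close>,
  \<open>f4\<close>). Each inequality holds for \<open>u\<close> and for \<open>u'\<close>, because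
  \<open>a\<close> and \<open>a'\<close> exist, and passes to \<open>v\<close> from whichever of the
  two lies below \<open>v\<close> at that vertex or edge.\<close>

lemma zonotope_between:
  fixes u u' v a a' :: "nat \<Rightarrow> int"
  assumes a: "\<forall>n<8. 0 \<le> a n \<and> a n \<le> u n" and a': "\<forall>n<8. 0 \<le> a' n \<and> a' n \<le> u' n"
    and sims: "same_marg a' a" "same_marg u' u" "same_marg v u"
    and vertices: "\<forall>n<8. u n \<le> v n \<or> u' n \<le> v n"
    and edges: "\<forall>i<4. \<forall>j<4. i \<noteq> j \<longrightarrow> u (4 + i) + u j \<le> v (4 + i) + v j \<or> u' (4 + i) + u' j \<le> v (4 + i) + v j"
    and odd: "v 0 + v 1 + v 2 + v 3 = 0 \<Longrightarrow> u 0 + u 1 + u 2 + u 3 = 0 \<or> u' 0 + u' 1 + u' 2 + u' 3 = 0"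
    and even: "v 4 + v 5 + v 6 + v 7 = 0 \<Longrightarrow> u 4 + u 5 + u 6 + u 7 = 0 \<or> u' 4 + u' 5 + u' 6 + u' 7 = 0"
  shows "\<exists>x. (\<forall>n<8. 0 \<le> x n \<and> x n \<le> v n) \<and> same_marg x a"
proof -
  obtain s where s: "a' 0 + a' 1 + a' 2 + a' 3 = a 0 + a 1 + a 2 + a 3 + 2 * s"
    "a' 4 = a 4 + a' 0 - a 0 - s" "a' 5 = a 5 + a' 1 - a 1 - s" "a' 6 = a 6 + a' 2 - a 2 - s" "a' 7 = a 7 + a' 3 - a 3 - s"
    using same_marg_coords[OF sims(1)] .
  obtain h where h: "u' 0 + u' 1 + u' 2 + u' 3 = u 0 + u 1 + u 2 + u 3 + 2 * h"
    "u' 4 = u 4 + u' 0 - u 0 - h" "u' 5 = u 5 + u' 1 - u 1 - h" "u' 6 = u 6 + u' 2 - u 2 - h" "u' 7 = u 7 + u' 3 - u 3 - h"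
    using same_marg_coords[OF sims(2)] .
  obtain k where k: "v 0 + v 1 + v 2 + v 3 = u 0 + u 1 + u 2 + u 3 + 2 * k"
    "v 4 = u 4 + v 0 - u 0 - k" "v 5 = u 5 + v 1 - u 1 - k" "v 6 = u 6 + v 2 - u 2 - k" "v 7 = u 7 + v 3 - u 3 - k"
    using same_marg_coords[OF sims(3)] .
  define t e where "t = (a 0 + a 1 + a 2 + a 3) div 2" and "e = (a 0 + a 1 + a 2 + a 3) mod 2"
  have te: "a 0 + a 1 + a 2 + a 3 = 2 * t + e" and e: "0 \<le> e" "e \<le> 1"
    unfolding t_def e_def by simp_all linarith?
  define c where "c i = a (4 + i) - a i + t" for i
  have c: "a 4 = a 0 + c 0 - t" "a 5 = a 1 + c 1 - t" "a 6 = a 2 + c 2 - t" "a 7 = a 3 + c 3 - t"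
    unfolding c_def by simp_all
  note a = a[unfolded all8] and a' = a'[unfolded all8] and vertices = vertices[unfolded all8]
  note edges = edges[unfolded all4, simplified]
  interpret facet_bounds "v 0" "v 1" "v 2" "v 3" "v 4" "v 5" "v 6" "v 7" "c 0" "c 1" "c 2" "c 3" e
  proof
    show "0 \<le> v 0" "0 \<le> v 1" "0 \<le> v 2" "0 \<le> v 3" "0 \<le> v 4" "0 \<le> v 5" "0 \<le> v 6" "0 \<le> v 7"
      using vertices a a' by linarith+
    show "0 \<le> e" "e \<le> 1" by fact+
    \<comment> \<open>If \<open>v\<close> vanishes on a tetrahedron, so does \<open>u\<close> or
      \<open>u'\<close>, hence \<open>a\<close> or \<open>a'\<close> does. Their sums over the odd
      tetrahedron differ by the even number \<open>2 * s\<close>, so either of them determines the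
      parity.\<close>
    show "e = 0" if "v 0 + v 1 + v 2 + v 3 = 0"
      using odd[OF that] a a' s te e by smt
    show "(c 0 + c 1 + c 2 + c 3 + e) mod 2 = 0" if "v 4 + v 5 + v 6 + v 7 = 0"
    proof -
      have "c 0 + c 1 + c 2 + c 3 + e = 2 * t \<or> c 0 + c 1 + c 2 + c 3 + e = 2 * (t + s)"
        using even[OF that] a a' s te e c by smt
      then show ?thesis by auto
    qed
  qed (use vertices edges a a' s h k te e c in \<open>smt (verit)\<close>)+
  obtain x0 x1 x2 x3 t' where x:
    "0 \<le> x0" "x0 \<le> v 0" "0 \<le> x1" "x1 \<le> v 1" "0 \<le> x2" "x2 \<le> v 2" "0 \<le> x3" "x3 \<le> v 3"
    "x0 + x1 + x2 + x3 = 2 * t' + e"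
    "0 \<le> x0 + c 0 - t'" "x0 + c 0 - t' \<le> v 4" "0 \<le> x1 + c 1 - t'" "x1 + c 1 - t' \<le> v 5"
    "0 \<le> x2 + c 2 - t'" "x2 + c 2 - t' \<le> v 6" "0 \<le> x3 + c 3 - t'" "x3 + c 3 - t' \<le> v 7"
    using ex_point by blast
  define x where "x = nth [x0, x1, x2, x3, x0 + c 0 - t', x1 + c 1 - t', x2 + c 2 - t', x3 + c 3 - t']"
  have "\<forall>n<8. 0 \<le> x n \<and> x n \<le> v n"
    unfolding all8 using x by (simp add: x_def)
  moreover have "same_marg x a"
    unfolding same_marg_iff using x(9) te c by (simp add: x_def)
  ultimately show ?thesis by blast
qed

section \<open>Connecting projected fibers\<close>

definition moves :: "int list list" where
  "moves = both_signs (half_quadrics @ half_quartics)"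

text \<open>For \<open>i \<noteq> j\<close> the vertices \<open>4 + i\<close> and \<open>j\<close>
  are adjacent, and all twelve edges of the cube arise in this way.\<close>

definition edge :: "nat \<Rightarrow> nat \<Rightarrow> (nat \<Rightarrow> int) \<Rightarrow> int" where
  "edge i j f = f (4 + i) + f j"

definition edge_conformal :: "(nat \<Rightarrow> int) \<Rightarrow> (nat \<Rightarrow> int) \<Rightarrow> bool" where
  "edge_conformal g m \<longleftrightarrow> (\<forall>i<4. \<forall>j<4. i \<noteq> j \<longrightarrow>
     (0 < edge i j g \<longrightarrow> edge i j g \<le> edge i j m) \<and> (edge i j g < 0 \<longrightarrow> edge i j m \<le> edge i j g))"

text \<open>The vertex and tetrahedron hypotheses of \<open>zonotope_between\<close>. Edge counts
  are left out, since along an edge-conformal move they stay between those of \<open>u\<close> and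
  \<open>u'\<close>.\<close>

definition between :: "(nat \<Rightarrow> int) \<Rightarrow> (nat \<Rightarrow> int) \<Rightarrow> (nat \<Rightarrow> int) \<Rightarrow> bool" where
  "between u u' v \<longleftrightarrow>
     (\<forall>n<8. u n \<le> v n \<or> u' n \<le> v n) \<and>
     (v 0 + v 1 + v 2 + v 3 = 0 \<longrightarrow> u 0 + u 1 + u 2 + u 3 = 0 \<or> u' 0 + u' 1 + u' 2 + u' 3 = 0) \<and>
     (v 4 + v 5 + v 6 + v 7 = 0 \<longrightarrow> u 4 + u 5 + u 6 + u 7 = 0 \<or> u' 4 + u' 5 + u' 6 + u' 7 = 0)"

text \<open>Conformality at the vertices would be too much to ask: if \<open>u' - u\<close> is a
  cubic, no move has it. It is required at the edges, while at the vertices one of the two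
  candidates \<open>u + g\<close> and \<open>u' - g\<close> only has to stay above \<open>u\<close>
  or \<open>u'\<close>. The disjunction in the middle guarantees progress for the tetrahedral
  quartic, which is invisible to the edge counts.\<close>

lemma pf_step:
  assumes u: "\<forall>n<8. 0 \<le> u n" and u': "\<forall>n<8. 0 \<le> u' n" and same_marg: "same_marg u' u"
    and neq: "\<exists>n<8. u' n \<noteq> u n"
  shows "\<exists>g\<in>set moves. edge_conformal (nth g) (\<lambda>n. u' n - u n) \<and>
     ((\<exists>i<4. \<exists>j<4. i \<noteq> j \<and> edge i j (nth g) \<noteq> 0) \<or> conformal (nth g) (\<lambda>n. u' n - u n)) \<and>
     (between u u' (\<lambda>n. u n + g ! n) \<or> between u u' (\<lambda>n. u' n - g ! n))"
proof -
  obtain h where h: "u' 0 + u' 1 + u' 2 + u' 3 = u 0 + u 1 + u 2 + u 3 + 2 * h"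
    "u' 4 = u 4 + u' 0 - u 0 - h" "u' 5 = u 5 + u' 1 - u 1 - h" "u' 6 = u 6 + u' 2 - u 2 - h" "u' 7 = u 7 + u' 3 - u 3 - h"
    using same_marg_coords[OF same_marg] .
  have ex4: "(\<exists>n<4::nat. P n) \<longleftrightarrow> P 0 \<or> P 1 \<or> P 2 \<or> P 3" for P
    by (simp add: eval_nat_numeral Ex_less_Suc) blast
  note u = u[unfolded all8] and u' = u'[unfolded all8]
  have neq: "u' 0 \<noteq> u 0 \<or> u' 1 \<noteq> u 1 \<or> u' 2 \<noteq> u 2 \<or> u' 3 \<noteq> u 3"
    using neq h unfolding ex8 by linarith
  show ?thesis
    unfolding moves_def both_signs_def half_quadrics_def half_quartics_def edge_conformal_def conformal_def
      between_def edge_def all8 all4 ex4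
    by (simp del: One_nat_def) (use u u' h neq in \<open>smt (verit)\<close>)
qed

lemma moves_abs_le: "\<forall>g\<in>set moves. \<forall>n<8. \<bar>g ! n\<bar> \<le> 1"
  unfolding moves_def both_signs_def half_quadrics_def half_quartics_def all8 by simp

lemma moves_nonzero: "\<forall>g\<in>set moves. \<exists>n<8. g ! n \<noteq> 0"
  unfolding moves_def both_signs_def half_quadrics_def half_quartics_def ex8 by simp

lemma moves_same_marg: "\<forall>g\<in>set moves. same_marg (nth g) (\<lambda>_. 0)"
  unfolding moves_def both_signs_def half_quadrics_def half_quartics_def same_marg_iff by simp

lemma moves_uminus: "g \<in> set moves \<Longrightarrow> map uminus g \<in> set moves"
  unfolding moves_def both_signs_def by (auto simp: image_image comp_def)

lemma moves_length: "\<forall>g\<in>set moves. length g = 8"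
  unfolding moves_def both_signs_def half_quadrics_def half_quartics_def by simp

definition edge_norm :: "(nat \<Rightarrow> int) \<Rightarrow> int" where
  "edge_norm m = (\<Sum>(i, j)\<in>{(i, j). i < 4 \<and> j < 4 \<and> i \<noteq> j}. \<bar>edge i j m\<bar>)"

text \<open>A move changes the vertex counts by at most 8 in total, so progress in the edge counts
  outweighs it.\<close>

definition move_dist :: "(nat \<Rightarrow> int) \<Rightarrow> nat" where
  "move_dist m = nat (9 * edge_norm m + (\<Sum>n<8. \<bar>m n\<bar>))"

lemma move_dist_less:
  assumes g: "g \<in> set moves" and conf: "edge_conformal (nth g) m"
    and or: "(\<exists>i<4. \<exists>j<4. i \<noteq> j \<and> edge i j (nth g) \<noteq> 0) \<or> conformal (nth g) m"
  shows "move_dist (\<lambda>n. m n - g ! n) < move_dist m"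
proof -
  let ?E = "{(i::nat, j::nat). i < 4 \<and> j < 4 \<and> i \<noteq> j}"
  have fin: "finite ?E" by (rule finite_subset[of _ "{..<4} \<times> {..<4}"]) auto
  have E: "\<bar>edge i j (\<lambda>n. m n - g ! n)\<bar> \<le> \<bar>edge i j m\<bar>"
    "edge i j (nth g) \<noteq> 0 \<Longrightarrow> \<bar>edge i j (\<lambda>n. m n - g ! n)\<bar> < \<bar>edge i j m\<bar>"
    if "(i, j) \<in> ?E" for i j
  proof -
    have "edge i j (\<lambda>n. m n - g ! n) = edge i j m - edge i j (nth g)"
      by (simp add: edge_def)
    moreover have "0 < edge i j (nth g) \<longrightarrow> edge i j (nth g) \<le> edge i j m"
      "edge i j (nth g) < 0 \<longrightarrow> edge i j m \<le> edge i j (nth g)"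
      using conf that unfolding edge_conformal_def by auto
    ultimately show "\<bar>edge i j (\<lambda>n. m n - g ! n)\<bar> \<le> \<bar>edge i j m\<bar>"
      "edge i j (nth g) \<noteq> 0 \<Longrightarrow> \<bar>edge i j (\<lambda>n. m n - g ! n)\<bar> < \<bar>edge i j m\<bar>" by linarith+
  qed
  have le: "edge_norm (\<lambda>n. m n - g ! n) \<le> edge_norm m"
    unfolding edge_norm_def by (rule sum_mono) (use E(1) in auto)
  have pos: "0 \<le> edge_norm f" for f unfolding edge_norm_def by (rule sum_nonneg) auto
  have abs: "\<bar>g ! n\<bar> \<le> 1" if "n < 8" for n using g moves_abs_le that by blast
  have "9 * edge_norm (\<lambda>n. m n - g ! n) + (\<Sum>n<8. \<bar>m n - g ! n\<bar>) < 9 * edge_norm m + (\<Sum>n<8. \<bar>m n\<bar>)"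
    using or
  proof
    assume "\<exists>i<4. \<exists>j<4. i \<noteq> j \<and> edge i j (nth g) \<noteq> 0"
    then obtain i j where ij: "(i, j) \<in> ?E" "edge i j (nth g) \<noteq> 0" by auto
    have "edge_norm (\<lambda>n. m n - g ! n) < edge_norm m"
      unfolding edge_norm_def
      by (rule sum_strict_mono_ex1[OF fin]) (use E(1) E(2)[OF ij] ij(1) in \<open>auto intro!: bexI[of _ "(i, j)"]\<close>)
    moreover have "(\<Sum>n<8. \<bar>m n - g ! n\<bar>) \<le> (\<Sum>n<8::nat. \<bar>m n\<bar> + 1)"
      by (rule sum_mono) (use abs in force)
    then have "(\<Sum>n<8. \<bar>m n - g ! n\<bar>) \<le> (\<Sum>n<8. \<bar>m n\<bar>) + 8" by (simp add: sum.distrib)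
    ultimately show ?thesis by linarith
  next
    assume c: "conformal (nth g) m"
    have c': "\<bar>m n - g ! n\<bar> \<le> \<bar>m n\<bar>" "g ! n \<noteq> 0 \<Longrightarrow> \<bar>m n - g ! n\<bar> < \<bar>m n\<bar>" if "n < 8" for n
      using c that unfolding conformal_def by force+
    obtain n0 where "n0 < 8" "g ! n0 \<noteq> 0" using moves_nonzero g by blast
    then have "(\<Sum>n<8. \<bar>m n - g ! n\<bar>) < (\<Sum>n<8. \<bar>m n\<bar>)"
      by (intro sum_strict_mono_ex1) (use c' in auto)
    with le show ?thesis by linarith
  qed
  moreover have "0 \<le> 9 * edge_norm (\<lambda>n. m n - g ! n) + (\<Sum>n<8. \<bar>m n - g ! n\<bar>)"
    using pos[of "\<lambda>n. m n - g ! n"] by (simp add: sum_nonneg)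
  ultimately show ?thesis unfolding move_dist_def by linarith
qed

lemma between_zonotope:
  assumes same_marg: "same_marg u' u" "same_marg v u" and v: "between u u' v"
    and edges: "\<And>i j. i < 4 \<Longrightarrow> j < 4 \<Longrightarrow> i \<noteq> j \<Longrightarrow> edge i j u \<le> edge i j v \<or> edge i j u' \<le> edge i j v"
    and a: "\<forall>n<8. 0 \<le> a n \<and> a n \<le> u n" and a': "\<forall>n<8. 0 \<le> a' n \<and> a' n \<le> u' n" and "same_marg a' a"
  shows "\<exists>x. (\<forall>n<8. 0 \<le> x n \<and> x n \<le> v n) \<and> same_marg x a"
  using a a' \<open>same_marg a' a\<close> same_marg
proof (rule zonotope_between)
  show "\<forall>i<4. \<forall>j<4. i \<noteq> j \<longrightarrow> u (4 + i) + u j \<le> v (4 + i) + v j \<or> u' (4 + i) + u' j \<le> v (4 + i) + v j"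
    using edges unfolding edge_def by blast
qed (use v in \<open>auto simp: between_def\<close>)

text \<open>The last conclusion quantifies over all pairs \<open>a\<close>, \<open>a'\<close>, so
  the single table \<open>v\<close> stays in every projected fiber containing both \<open>u\<close>
  and \<open>u'\<close>. It is a neighbour of one of them and closer to the other.\<close>

lemma pf_progress:
  assumes u: "\<forall>n<8. 0 \<le> u n" and u': "\<forall>n<8. 0 \<le> u' n" and same_marg: "same_marg u' u"
    and neq: "\<exists>n<8. u' n \<noteq> u n"
  obtains g v where "g \<in> set moves"
    "(v = (\<lambda>n. u n + g ! n) \<and> move_dist (\<lambda>n. u' n - v n) < move_dist (\<lambda>n. u' n - u n)) \<or>
     (v = (\<lambda>n. u' n - g ! n) \<and> move_dist (\<lambda>n. v n - u n) < move_dist (\<lambda>n. u' n - u n))"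
    "same_marg v u"
    "\<forall>a a'. (\<forall>n<8. 0 \<le> a n \<and> a n \<le> u n) \<longrightarrow> (\<forall>n<8. 0 \<le> a' n \<and> a' n \<le> u' n) \<longrightarrow> same_marg a' a \<longrightarrow>
       (\<exists>x. (\<forall>n<8. 0 \<le> x n \<and> x n \<le> v n) \<and> same_marg x a)"
proof -
  obtain g where g: "g \<in> set moves" and conf: "edge_conformal (nth g) (\<lambda>n. u' n - u n)"
    and or: "(\<exists>i<4. \<exists>j<4. i \<noteq> j \<and> edge i j (nth g) \<noteq> 0) \<or> conformal (nth g) (\<lambda>n. u' n - u n)"
    and btw: "between u u' (\<lambda>n. u n + g ! n) \<or> between u u' (\<lambda>n. u' n - g ! n)"
    using pf_step[OF assms] by blast
  define v where "v = (if between u u' (\<lambda>n. u n + g ! n) then (\<lambda>n. u n + g ! n) else (\<lambda>n. u' n - g ! n))"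
  have v: "between u u' v" and v_cases: "v = (\<lambda>n. u n + g ! n) \<or> v = (\<lambda>n. u' n - g ! n)"
    using btw by (auto simp: v_def)
  have g0: "same_marg (nth g) (\<lambda>_. 0)" using moves_same_marg g by blast
  have simv: "same_marg v u"
    using v_cases
  proof
    assume "v = (\<lambda>n. u n + g ! n)"
    then show ?thesis using same_marg_add[OF same_marg_refl[of u] g0] by simp
  next
    assume "v = (\<lambda>n. u' n - g ! n)"
    then show ?thesis using same_marg_diff[OF same_marg g0] by simp
  qed
  have edges: "edge i j u \<le> edge i j v \<or> edge i j u' \<le> edge i j v" if "i < 4" "j < 4" "i \<noteq> j" for i j
  proof -
    have "0 < edge i j (nth g) \<longrightarrow> edge i j (nth g) \<le> edge i j (\<lambda>n. u' n - u n)"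
      "edge i j (nth g) < 0 \<longrightarrow> edge i j (\<lambda>n. u' n - u n) \<le> edge i j (nth g)"
      using conf that unfolding edge_conformal_def by auto
    then show ?thesis using v_cases unfolding edge_def by auto
  qed
  have less: "move_dist (\<lambda>n. (u' n - u n) - g ! n) < move_dist (\<lambda>n. u' n - u n)"
    by (rule move_dist_less[OF g conf or])
  show ?thesis
  proof (rule that[OF g _ simv])
    show "(v = (\<lambda>n. u n + g ! n) \<and> move_dist (\<lambda>n. u' n - v n) < move_dist (\<lambda>n. u' n - u n)) \<or>
     (v = (\<lambda>n. u' n - g ! n) \<and> move_dist (\<lambda>n. v n - u n) < move_dist (\<lambda>n. u' n - u n))"
      using v_cases less by (auto simp: algebra_simps)
    show "\<forall>a a'. (\<forall>n<8. 0 \<le> a n \<and> a n \<le> u n) \<longrightarrow> (\<forall>n<8. 0 \<le> a' n \<and> a' n \<le> u' n) \<longrightarrow> same_marg a' a \<longrightarrow>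
       (\<exists>x. (\<forall>n<8. 0 \<le> x n \<and> x n \<le> v n) \<and> same_marg x a)"
      using between_zonotope[OF same_marg simv v edges] by blast
  qed
qed

text \<open>A vertex occurring in both \<open>p\<close> and \<open>q\<close> can be exchanged alone.
  Otherwise the supports are disjoint, so a part conformal to \<open>p - q\<close> has its positive
  part below \<open>p\<close> and its negative part below \<open>q\<close>.\<close>

lemma graver_pair:
  assumes p: "\<forall>n<8. 0 \<le> p n" and q: "\<forall>n<8. 0 \<le> q n" and same_marg: "same_marg p q" and pos: "\<exists>n<8. 0 < p n"
  obtains e f where "\<forall>n<8. 0 \<le> e n \<and> e n \<le> p n" "\<forall>n<8. 0 \<le> f n \<and> f n \<le> q n" "same_marg e f"
    "0 < (\<Sum>n<8. e n)" "(\<Sum>n<8. e n) \<le> 3" "(\<Sum>n<8. f n) \<le> 3"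
proof (cases "\<exists>n<8. 0 < p n \<and> 0 < q n")
  case True
  then obtain n0 where n0: "n0 < 8" "0 < p n0" "0 < q n0" by blast
  let ?e = "\<lambda>n. if n = n0 then 1 else 0 :: int"
  have "(\<Sum>n<8. ?e n) = 1" using n0 by simp
  then show ?thesis using n0 p q by (intro that[of ?e ?e]) auto
next
  case False
  have m: "same_marg (\<lambda>n. p n - q n) (\<lambda>_. 0)"
    using same_marg_diff[OF same_marg same_marg_refl[of q]] by simp
  moreover have "\<exists>n<8. p n - q n \<noteq> 0" using pos False q by force
  ultimately obtain k where k: "k \<in> set (both_signs (half_quadrics @ half_cubics))"
    and conf: "conformal (nth k) (\<lambda>n. p n - q n)" using conformal_graver by blast
  have *: "\<forall>k\<in>set (both_signs (half_quadrics @ half_cubics)).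
     same_marg (\<lambda>n. max (k ! n) 0) (\<lambda>n. max (- (k ! n)) 0) \<and> 0 < (\<Sum>n<8. max (k ! n) 0) \<and>
     (\<Sum>n<8. max (k ! n) 0) \<le> 3 \<and> (\<Sum>n<8. max (- (k ! n)) 0) \<le> 3"
    unfolding both_signs_def half_quadrics_def half_cubics_def sum8 same_marg_iff by simp
  show ?thesis
  proof (rule that[of "\<lambda>n. max (k ! n) 0" "\<lambda>n. max (- (k ! n)) 0"])
    show "\<forall>n<8. 0 \<le> max (k ! n) 0 \<and> max (k ! n) 0 \<le> p n"
      "\<forall>n<8. 0 \<le> max (- (k ! n)) 0 \<and> max (- (k ! n)) 0 \<le> q n"
      using conf p q unfolding conformal_def by fastforce+
  qed (use bspec[OF * k] in auto)
qed

section \<open>Lifting moves\<close>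

lemma quadrics_abs_le: "\<forall>k\<in>set (both_signs half_quadrics). \<forall>n<8. \<bar>k ! n\<bar> \<le> 1"
  unfolding both_signs_def half_quadrics_def all8 by simp

lemma quadrics_same_marg: "\<forall>k\<in>set (both_signs half_quadrics). same_marg (nth k) (\<lambda>_. 0)"
  unfolding both_signs_def half_quadrics_def same_marg_iff by simp

text \<open>If \<open>a - a' = m\<close> and \<open>c - c' = g - m\<close> with nonnegative \<open>a\<close>, \<open>a'\<close>, \<open>c\<close>, \<open>c'\<close>, then a reducing quadric \<open>k\<close>
  can be exchanged between \<open>a\<close> and \<open>c\<close> (between \<open>a'\<close> and \<open>c'\<close> for the primed version). The last
  conjunct makes the exchange strictly decrease the degree.\<close>

definition reducing :: "(nat \<Rightarrow> int) \<Rightarrow> (nat \<Rightarrow> int) \<Rightarrow> (nat \<Rightarrow> int) \<Rightarrow> bool" where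
  "reducing k g m \<longleftrightarrow>
     (\<forall>n<8. (0 < k n \<longrightarrow> k n \<le> m n) \<and> (k n < 0 \<longrightarrow> m n \<le> g n + k n)) \<and> (\<exists>n<8. k n \<noteq> 0 \<and> g n \<noteq> 1)"

definition reducing' :: "(nat \<Rightarrow> int) \<Rightarrow> (nat \<Rightarrow> int) \<Rightarrow> (nat \<Rightarrow> int) \<Rightarrow> bool" where
  "reducing' k g m \<longleftrightarrow>
     (\<forall>n<8. (0 < k n \<longrightarrow> g n + k n \<le> m n) \<and> (k n < 0 \<longrightarrow> m n \<le> k n)) \<and> (\<exists>n<8. k n \<noteq> 0 \<and> g n \<noteq> - 1)"

definition irreducible_lift :: "(nat \<Rightarrow> int) \<Rightarrow> (nat \<Rightarrow> int) \<Rightarrow> bool" where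
  "irreducible_lift g m \<longleftrightarrow> same_marg m (\<lambda>_. 0) \<and>
    (\<forall>k\<in>set (both_signs half_quadrics). \<not> reducing (nth k) g m \<and> \<not> reducing' (nth k) g m)"

text \<open>Twice the degree of the pair \<open>(m, g - m)\<close> if \<open>m\<close> and
  \<open>g\<close> are in the marginal kernel, where entries sum to 0.\<close>

definition lift_cost :: "(nat \<Rightarrow> int) \<Rightarrow> (nat \<Rightarrow> int) \<Rightarrow> int" where
  "lift_cost g m = (\<Sum>n<8. \<bar>m n\<bar> + \<bar>g n - m n\<bar>)"

text \<open>As a function of \<open>m n\<close>, the cost at \<open>n\<close> is convex and constant
  exactly between \<open>0\<close> and \<open>g n\<close>. The conditions on \<open>k\<close> make
  each changed entry move by one unit towards this interval or inside it; a unit step inside the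
  interval is possible only if \<open>g n = 1\<close> in the first case and only if
  \<open>g n = - 1\<close> in the primed one.\<close>

lemma lift_cost_less:
  assumes "\<forall>n<8. \<bar>k n\<bar> \<le> 1" "\<forall>n<8. \<bar>g n\<bar> \<le> 1" and red: "reducing k g m \<or> reducing' k g m"
  shows "lift_cost g (\<lambda>n. m n - k n) < lift_cost g m"
proof -
  have step: "\<bar>m n - k n\<bar> + \<bar>g n - (m n - k n)\<bar> \<le> \<bar>m n\<bar> + \<bar>g n - m n\<bar> \<and>
      (k n \<noteq> 0 \<and> g n \<noteq> c \<longrightarrow> \<bar>m n - k n\<bar> + \<bar>g n - (m n - k n)\<bar> < \<bar>m n\<bar> + \<bar>g n - m n\<bar>)"
    if "n < 8" and "c = 1 \<and> (0 < k n \<longrightarrow> k n \<le> m n) \<and> (k n < 0 \<longrightarrow> m n \<le> g n + k n) \<or>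
      c = - 1 \<and> (0 < k n \<longrightarrow> g n + k n \<le> m n) \<and> (k n < 0 \<longrightarrow> m n \<le> k n)" for n c
    using assms(1,2) that by (smt (verit))
  obtain c where *: "\<forall>n<8. c = 1 \<and> (0 < k n \<longrightarrow> k n \<le> m n) \<and> (k n < 0 \<longrightarrow> m n \<le> g n + k n) \<or>
      c = - 1 \<and> (0 < k n \<longrightarrow> g n + k n \<le> m n) \<and> (k n < 0 \<longrightarrow> m n \<le> k n)"
    and ex: "\<exists>n<8. k n \<noteq> 0 \<and> g n \<noteq> c"
    using red unfolding reducing_def reducing'_def by blast
  have **: "\<bar>m n - k n\<bar> + \<bar>g n - (m n - k n)\<bar> \<le> \<bar>m n\<bar> + \<bar>g n - m n\<bar>"
    "k n \<noteq> 0 \<Longrightarrow> g n \<noteq> c \<Longrightarrow>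
      \<bar>m n - k n\<bar> + \<bar>g n - (m n - k n)\<bar> < \<bar>m n\<bar> + \<bar>g n - m n\<bar>" if "n < 8" for n
    using step[OF that *[rule_format, OF that]] by blast+
  obtain n where "n < 8" "k n \<noteq> 0" "g n \<noteq> c" using ex by blast
  then show ?thesis
    unfolding lift_cost_def
    by (intro sum_strict_mono_ex1) (use ** in auto)
qed

text \<open>A pair of least cost is irreducible: a reducing quadric would be subtracted from
  \<open>x\<close> alone, a primed one added to \<open>x'\<close> alone. The identity
  \<open>u - u' = g\<close> keeps the altered table in its box.\<close>

lemma ex_irreducible_lift:
  assumes g: "g \<in> set moves" and a: "\<forall>n<8. 0 \<le> a n \<and> a n \<le> u n" and a': "\<forall>n<8. 0 \<le> a' n \<and> a' n \<le> u' n"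
    and same_marg: "same_marg a' a" and u: "\<forall>n<8. u n - u' n = g ! n"
  obtains x x' where "\<forall>n<8. 0 \<le> x n \<and> x n \<le> u n" "\<forall>n<8. 0 \<le> x' n \<and> x' n \<le> u' n"
    "same_marg x a" "same_marg x' a" "irreducible_lift (nth g) (\<lambda>n. x n - x' n)"
proof -
  define P where "P = (\<lambda>(x, x'). (\<forall>n<8. 0 \<le> x n \<and> x n \<le> u n) \<and> (\<forall>n<8. 0 \<le> x' n \<and> x' n \<le> u' n) \<and>
    same_marg x a \<and> same_marg x' a)"
  define c where "c = (\<lambda>(x, x'). nat (lift_cost (nth g) (\<lambda>n. x n - x' n)))"
  have "P (a, a')" using a a' same_marg unfolding P_def by simp
  then obtain y where y: "P y" "\<And>z. P z \<Longrightarrow> c y \<le> c z"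
    using ex_has_least_nat[of P "(a, a')" c] by blast
  obtain x x' where xx: "y = (x, x')" by (cases y)
  have x: "\<forall>n<8. 0 \<le> x n \<and> x n \<le> u n" "\<forall>n<8. 0 \<le> x' n \<and> x' n \<le> u' n" "same_marg x a" "same_marg x' a"
    using y(1) unfolding xx P_def by auto
  have nonneg: "0 \<le> lift_cost (nth g) m" for m unfolding lift_cost_def by (rule sum_nonneg) auto
  have g1: "\<forall>n<8. \<bar>g ! n\<bar> \<le> 1" using moves_abs_le g by blast
  have "\<not> reducing (nth k) (nth g) (\<lambda>n. x n - x' n) \<and> \<not> reducing' (nth k) (nth g) (\<lambda>n. x n - x' n)"
    if k: "k \<in> set (both_signs half_quadrics)" for k
  proof (rule ccontr)
    have k1: "\<forall>n<8. \<bar>k ! n\<bar> \<le> 1" using quadrics_abs_le k by blast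
    have k0: "same_marg (nth k) (\<lambda>_. 0)" using quadrics_same_marg k by blast
    assume "\<not> ?thesis"
    then have red: "reducing (nth k) (nth g) (\<lambda>n. x n - x' n) \<or> reducing' (nth k) (nth g) (\<lambda>n. x n - x' n)"
      by blast
    have less: "lift_cost (nth g) (\<lambda>n. x n - x' n - k ! n) < lift_cost (nth g) (\<lambda>n. x n - x' n)"
      by (rule lift_cost_less[OF k1 g1 red])
    show False
      using red
    proof
      assume r: "reducing (nth k) (nth g) (\<lambda>n. x n - x' n)"
      have "\<forall>n<8. 0 \<le> x n - k ! n \<and> x n - k ! n \<le> u n"
        using r x(1,2) u unfolding reducing_def by smt
      then have "P (\<lambda>n. x n - k ! n, x')"
        using x same_marg_diff[OF x(3) k0] unfolding P_def by simp
      from y(2)[OF this] less nonneg[of "\<lambda>n. x n - k ! n - x' n"] show False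
        unfolding xx c_def by (simp add: algebra_simps)
    next
      assume r: "reducing' (nth k) (nth g) (\<lambda>n. x n - x' n)"
      have "\<forall>n<8. 0 \<le> x' n + k ! n \<and> x' n + k ! n \<le> u' n"
        using r x(1,2) u unfolding reducing'_def by smt
      then have "P (x, \<lambda>n. x' n + k ! n)"
        using x same_marg_add[OF x(4) k0] unfolding P_def by simp
      from y(2)[OF this] less nonneg[of "\<lambda>n. x n - (x' n + k ! n)"] show False
        unfolding xx c_def by (simp add: algebra_simps)
    qed
  qed
  moreover have "same_marg (\<lambda>n. x n - x' n) (\<lambda>_. 0)"
    using same_marg_diff[OF x(3) same_marg_trans[OF x(4) same_marg_refl]] unfolding same_marg_iff by simp
  ultimately show ?thesis by (intro that[OF x]) (simp add: irreducible_lift_def)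
qed

lemmas irreducible_lift_expand = iffD1[OF irreducible_lift_def, THEN conjunct2,
  unfolded both_signs_def half_quadrics_def reducing_def reducing'_def all8 ex8, simplified, folded One_nat_def]

text \<open>A row \<open>(g, ds)\<close> lists the coordinates 0 to 3 of all irreducible \<open>m\<close> for \<open>g\<close>; the kernel condition
  determines the other four.\<close>

definition quadric_lifts :: "(int list \<times> (int \<times> int \<times> int \<times> int) list) list" where
  "quadric_lifts = [
   ([-1, -1, 0, 0, 0, 0, 1, 1],
    [(-1, -1, 0, 0), (-1, 0, -1, 0), (-1, 0, 0, -1), (-1, 0, 0, 1), (-1, 0, 1, 0), (0, -1, -1, 0), (0, -1, 0, -1),
     (0, -1, 0, 1), (0, -1, 1, 0), (0, 0, 0, 0)]),
   ([-1, 0, -1, 0, 0, 1, 0, 1],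
    [(-1, -1, 0, 0), (-1, 0, -1, 0), (-1, 0, 0, -1), (-1, 0, 0, 1), (-1, 1, 0, 0), (0, -1, -1, 0), (0, 0, -1, -1),
     (0, 0, -1, 1), (0, 1, -1, 0), (0, 0, 0, 0)]),
   ([-1, 0, 0, -1, 0, 1, 1, 0],
    [(-1, -1, 0, 0), (-1, 0, -1, 0), (-1, 0, 0, -1), (-1, 0, 1, 0), (-1, 1, 0, 0), (0, -1, 0, -1), (0, 0, -1, -1),
     (0, 0, 1, -1), (0, 1, 0, -1), (0, 0, 0, 0)]),
   ([-1, 0, 0, 1, -1, 0, 0, 1],
    [(-1, -1, 0, 0), (-1, 0, -1, 0), (-1, 0, 0, 1), (-1, 0, 1, 0), (-1, 1, 0, 0), (0, -1, 0, 1), (0, 0, -1, 1),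
     (0, 0, 1, 1), (0, 1, 0, 1), (0, 0, 0, 0)]),
   ([-1, 0, 1, 0, -1, 0, 1, 0],
    [(-1, -1, 0, 0), (-1, 0, 0, -1), (-1, 0, 0, 1), (-1, 0, 1, 0), (-1, 1, 0, 0), (0, -1, 1, 0), (0, 0, 1, -1),
     (0, 0, 1, 1), (0, 1, 1, 0), (0, 0, 0, 0)]),
   ([-1, 1, 0, 0, -1, 1, 0, 0],
    [(-1, 0, -1, 0), (-1, 0, 0, -1), (-1, 0, 0, 1), (-1, 0, 1, 0), (-1, 1, 0, 0), (0, 1, -1, 0), (0, 1, 0, -1),
     (0, 1, 0, 1), (0, 1, 1, 0), (0, 0, 0, 0)]),
   ([0, -1, -1, 0, 1, 0, 0, 1],
    [(-1, -1, 0, 0), (-1, 0, -1, 0), (0, -1, -1, 0), (0, -1, 0, -1), (0, -1, 0, 1), (0, 0, -1, -1), (0, 0, -1, 1),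
     (1, -1, 0, 0), (1, 0, -1, 0), (0, 0, 0, 0)]),
   ([0, -1, 0, -1, 1, 0, 1, 0],
    [(-1, -1, 0, 0), (-1, 0, 0, -1), (0, -1, -1, 0), (0, -1, 0, -1), (0, -1, 1, 0), (0, 0, -1, -1), (0, 0, 1, -1),
     (1, -1, 0, 0), (1, 0, 0, -1), (0, 0, 0, 0)]),
   ([0, -1, 0, 1, 0, -1, 0, 1],
    [(-1, -1, 0, 0), (-1, 0, 0, 1), (0, -1, -1, 0), (0, -1, 0, 1), (0, -1, 1, 0), (0, 0, -1, 1), (0, 0, 1, 1),
     (1, -1, 0, 0), (1, 0, 0, 1), (0, 0, 0, 0)]),
   ([0, -1, 1, 0, 0, -1, 1, 0],
    [(-1, -1, 0, 0), (-1, 0, 1, 0), (0, -1, 0, -1), (0, -1, 0, 1), (0, -1, 1, 0), (0, 0, 1, -1), (0, 0, 1, 1),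
     (1, -1, 0, 0), (1, 0, 1, 0), (0, 0, 0, 0)]),
   ([0, 0, -1, -1, 1, 1, 0, 0],
    [(-1, 0, -1, 0), (-1, 0, 0, -1), (0, -1, -1, 0), (0, -1, 0, -1), (0, 0, -1, -1), (0, 1, -1, 0), (0, 1, 0, -1),
     (1, 0, -1, 0), (1, 0, 0, -1), (0, 0, 0, 0)]),
   ([0, 0, -1, 1, 0, 0, -1, 1],
    [(-1, 0, -1, 0), (-1, 0, 0, 1), (0, -1, -1, 0), (0, -1, 0, 1), (0, 0, -1, 1), (0, 1, -1, 0), (0, 1, 0, 1),
     (1, 0, -1, 0), (1, 0, 0, 1), (0, 0, 0, 0)]),
   ([0, 0, 1, -1, 0, 0, 1, -1],
    [(-1, 0, 0, -1), (-1, 0, 1, 0), (0, -1, 0, -1), (0, -1, 1, 0), (0, 0, 1, -1), (0, 1, 0, -1), (0, 1, 1, 0),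
     (1, 0, 0, -1), (1, 0, 1, 0), (0, 0, 0, 0)]),
   ([0, 0, 1, 1, -1, -1, 0, 0],
    [(-1, 0, 0, 1), (-1, 0, 1, 0), (0, -1, 0, 1), (0, -1, 1, 0), (0, 0, 1, 1), (0, 1, 0, 1), (0, 1, 1, 0),
     (1, 0, 0, 1), (1, 0, 1, 0), (0, 0, 0, 0)]),
   ([0, 1, -1, 0, 0, 1, -1, 0],
    [(-1, 0, -1, 0), (-1, 1, 0, 0), (0, 0, -1, -1), (0, 0, -1, 1), (0, 1, -1, 0), (0, 1, 0, -1), (0, 1, 0, 1),
     (1, 0, -1, 0), (1, 1, 0, 0), (0, 0, 0, 0)]),
   ([0, 1, 0, -1, 0, 1, 0, -1],
    [(-1, 0, 0, -1), (-1, 1, 0, 0), (0, 0, -1, -1), (0, 0, 1, -1), (0, 1, -1, 0), (0, 1, 0, -1), (0, 1, 1, 0),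
     (1, 0, 0, -1), (1, 1, 0, 0), (0, 0, 0, 0)]),
   ([0, 1, 0, 1, -1, 0, -1, 0],
    [(-1, 0, 0, 1), (-1, 1, 0, 0), (0, 0, -1, 1), (0, 0, 1, 1), (0, 1, -1, 0), (0, 1, 0, 1), (0, 1, 1, 0),
     (1, 0, 0, 1), (1, 1, 0, 0), (0, 0, 0, 0)]),
   ([0, 1, 1, 0, -1, 0, 0, -1],
    [(-1, 0, 1, 0), (-1, 1, 0, 0), (0, 0, 1, -1), (0, 0, 1, 1), (0, 1, 0, -1), (0, 1, 0, 1), (0, 1, 1, 0),
     (1, 0, 1, 0), (1, 1, 0, 0), (0, 0, 0, 0)]),
   ([1, -1, 0, 0, 1, -1, 0, 0],
    [(0, -1, -1, 0), (0, -1, 0, -1), (0, -1, 0, 1), (0, -1, 1, 0), (1, -1, 0, 0), (1, 0, -1, 0), (1, 0, 0, -1),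
     (1, 0, 0, 1), (1, 0, 1, 0), (0, 0, 0, 0)]),
   ([1, 0, -1, 0, 1, 0, -1, 0],
    [(0, -1, -1, 0), (0, 0, -1, -1), (0, 0, -1, 1), (0, 1, -1, 0), (1, -1, 0, 0), (1, 0, -1, 0), (1, 0, 0, -1),
     (1, 0, 0, 1), (1, 1, 0, 0), (0, 0, 0, 0)]),
   ([1, 0, 0, -1, 1, 0, 0, -1],
    [(0, -1, 0, -1), (0, 0, -1, -1), (0, 0, 1, -1), (0, 1, 0, -1), (1, -1, 0, 0), (1, 0, -1, 0), (1, 0, 0, -1),
     (1, 0, 1, 0), (1, 1, 0, 0), (0, 0, 0, 0)]),
   ([1, 0, 0, 1, 0, -1, -1, 0],
    [(0, -1, 0, 1), (0, 0, -1, 1), (0, 0, 1, 1), (0, 1, 0, 1), (1, -1, 0, 0), (1, 0, -1, 0), (1, 0, 0, 1),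
     (1, 0, 1, 0), (1, 1, 0, 0), (0, 0, 0, 0)]),
   ([1, 0, 1, 0, 0, -1, 0, -1],
    [(0, -1, 1, 0), (0, 0, 1, -1), (0, 0, 1, 1), (0, 1, 1, 0), (1, -1, 0, 0), (1, 0, 0, -1), (1, 0, 0, 1),
     (1, 0, 1, 0), (1, 1, 0, 0), (0, 0, 0, 0)]),
   ([1, 1, 0, 0, 0, 0, -1, -1],
    [(0, 1, -1, 0), (0, 1, 0, -1), (0, 1, 0, 1), (0, 1, 1, 0), (1, 0, -1, 0), (1, 0, 0, -1), (1, 0, 0, 1),
     (1, 0, 1, 0), (1, 1, 0, 0), (0, 0, 0, 0)])]"

definition quartic_lifts :: "(int list \<times> (int \<times> int \<times> int \<times> int) list) list" where
  "quartic_lifts = [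
   ([1, 1, -1, -1, 1, 1, -1, -1],
    [(-1, 0, -1, 0), (-1, 0, 0, -1), (-1, 1, -1, -1), (-1, 1, 0, 0), (0, -1, -1, 0), (0, -1, 0, -1),
     (0, 0, -2, 0), (0, 0, -1, -1), (0, 0, -1, 1), (0, 0, 0, -2), (0, 0, 1, -1), (0, 1, -2, -1), (0, 1, -1, -2),
     (0, 1, -1, 0), (0, 1, 0, -1), (0, 1, 0, 1), (0, 1, 1, 0), (0, 2, -1, -1), (0, 2, 0, 0), (1, -1, -1, -1),
     (1, -1, 0, 0), (1, 0, -2, -1), (1, 0, -1, -2), (1, 0, -1, 0), (1, 0, 0, -1), (1, 0, 0, 1), (1, 0, 1, 0),
     (1, 1, -2, 0), (1, 1, -1, -1), (1, 1, -1, 1), (1, 1, 0, -2), (1, 1, 0, 0), (1, 1, 1, -1), (1, 2, -1, 0),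
     (1, 2, 0, -1), (2, 0, -1, -1), (2, 0, 0, 0), (2, 1, -1, 0), (2, 1, 0, -1), (0, 0, 0, 0)]),
   ([1, -1, 1, -1, 1, -1, 1, -1],
    [(-1, -1, 0, 0), (-1, -1, 1, -1), (-1, 0, 0, -1), (-1, 0, 1, 0), (0, -2, 0, 0), (0, -2, 1, -1),
     (0, -1, -1, 0), (0, -1, 0, -1), (0, -1, 0, 1), (0, -1, 1, -2), (0, -1, 1, 0), (0, -1, 2, -1), (0, 0, -1, -1),
     (0, 0, 0, -2), (0, 0, 1, -1), (0, 0, 1, 1), (0, 0, 2, 0), (0, 1, 0, -1), (0, 1, 1, 0), (1, -2, 0, -1),
     (1, -2, 1, 0), (1, -1, -1, -1), (1, -1, 0, -2), (1, -1, 0, 0), (1, -1, 1, -1), (1, -1, 1, 1), (1, -1, 2, 0),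
     (1, 0, -1, 0), (1, 0, 0, -1), (1, 0, 0, 1), (1, 0, 1, -2), (1, 0, 1, 0), (1, 0, 2, -1), (1, 1, 0, 0),
     (1, 1, 1, -1), (2, -1, 0, -1), (2, -1, 1, 0), (2, 0, 0, 0), (2, 0, 1, -1), (0, 0, 0, 0)]),
   ([1, -1, -1, 1, 1, -1, -1, 1],
    [(-1, -1, -1, 1), (-1, -1, 0, 0), (-1, 0, -1, 0), (-1, 0, 0, 1), (0, -2, -1, 1), (0, -2, 0, 0),
     (0, -1, -2, 1), (0, -1, -1, 0), (0, -1, -1, 2), (0, -1, 0, -1), (0, -1, 0, 1), (0, -1, 1, 0), (0, 0, -2, 0),
     (0, 0, -1, -1), (0, 0, -1, 1), (0, 0, 0, 2), (0, 0, 1, 1), (0, 1, -1, 0), (0, 1, 0, 1), (1, -2, -1, 0),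
     (1, -2, 0, 1), (1, -1, -2, 0), (1, -1, -1, -1), (1, -1, -1, 1), (1, -1, 0, 0), (1, -1, 0, 2), (1, -1, 1, 1),
     (1, 0, -2, 1), (1, 0, -1, 0), (1, 0, -1, 2), (1, 0, 0, -1), (1, 0, 0, 1), (1, 0, 1, 0), (1, 1, -1, 1),
     (1, 1, 0, 0), (2, -1, -1, 0), (2, -1, 0, 1), (2, 0, -1, 1), (2, 0, 0, 0), (0, 0, 0, 0)]),
   ([-1, 1, 1, -1, -1, 1, 1, -1],
    [(-2, 0, 0, 0), (-2, 0, 1, -1), (-2, 1, 0, -1), (-2, 1, 1, 0), (-1, -1, 0, 0), (-1, -1, 1, -1),
     (-1, 0, -1, 0), (-1, 0, 0, -1), (-1, 0, 0, 1), (-1, 0, 1, -2), (-1, 0, 1, 0), (-1, 0, 2, -1),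
     (-1, 1, -1, -1), (-1, 1, 0, -2), (-1, 1, 0, 0), (-1, 1, 1, -1), (-1, 1, 1, 1), (-1, 1, 2, 0), (-1, 2, 0, -1),
     (-1, 2, 1, 0), (0, -1, 0, -1), (0, -1, 1, 0), (0, 0, -1, -1), (0, 0, 0, -2), (0, 0, 1, -1), (0, 0, 1, 1),
     (0, 0, 2, 0), (0, 1, -1, 0), (0, 1, 0, -1), (0, 1, 0, 1), (0, 1, 1, -2), (0, 1, 1, 0), (0, 1, 2, -1),
     (0, 2, 0, 0), (0, 2, 1, -1), (1, 0, 0, -1), (1, 0, 1, 0), (1, 1, 0, 0), (1, 1, 1, -1), (0, 0, 0, 0)]),
   ([-1, 1, -1, 1, -1, 1, -1, 1],
    [(-2, 0, -1, 1), (-2, 0, 0, 0), (-2, 1, -1, 0), (-2, 1, 0, 1), (-1, -1, -1, 1), (-1, -1, 0, 0),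
     (-1, 0, -2, 1), (-1, 0, -1, 0), (-1, 0, -1, 2), (-1, 0, 0, -1), (-1, 0, 0, 1), (-1, 0, 1, 0), (-1, 1, -2, 0),
     (-1, 1, -1, -1), (-1, 1, -1, 1), (-1, 1, 0, 0), (-1, 1, 0, 2), (-1, 1, 1, 1), (-1, 2, -1, 0), (-1, 2, 0, 1),
     (0, -1, -1, 0), (0, -1, 0, 1), (0, 0, -2, 0), (0, 0, -1, -1), (0, 0, -1, 1), (0, 0, 0, 2), (0, 0, 1, 1),
     (0, 1, -2, 1), (0, 1, -1, 0), (0, 1, -1, 2), (0, 1, 0, -1), (0, 1, 0, 1), (0, 1, 1, 0), (0, 2, -1, 1),
     (0, 2, 0, 0), (1, 0, -1, 0), (1, 0, 0, 1), (1, 1, -1, 1), (1, 1, 0, 0), (0, 0, 0, 0)]),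
   ([-1, -1, 1, 1, -1, -1, 1, 1],
    [(-2, -1, 0, 1), (-2, -1, 1, 0), (-2, 0, 0, 0), (-2, 0, 1, 1), (-1, -2, 0, 1), (-1, -2, 1, 0),
     (-1, -1, -1, 1), (-1, -1, 0, 0), (-1, -1, 0, 2), (-1, -1, 1, -1), (-1, -1, 1, 1), (-1, -1, 2, 0),
     (-1, 0, -1, 0), (-1, 0, 0, -1), (-1, 0, 0, 1), (-1, 0, 1, 0), (-1, 0, 1, 2), (-1, 0, 2, 1), (-1, 1, 0, 0),
     (-1, 1, 1, 1), (0, -2, 0, 0), (0, -2, 1, 1), (0, -1, -1, 0), (0, -1, 0, -1), (0, -1, 0, 1), (0, -1, 1, 0),
     (0, -1, 1, 2), (0, -1, 2, 1), (0, 0, -1, 1), (0, 0, 0, 2), (0, 0, 1, -1), (0, 0, 1, 1), (0, 0, 2, 0),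
     (0, 1, 0, 1), (0, 1, 1, 0), (1, -1, 0, 0), (1, -1, 1, 1), (1, 0, 0, 1), (1, 0, 1, 0), (0, 0, 0, 0)]),
   ([1, 1, 1, 1, -1, -1, -1, -1],
    [(-1, 0, 0, 1), (-1, 0, 1, 0), (-1, 1, 0, 0), (-1, 1, 1, 1), (0, -1, 0, 1), (0, -1, 1, 0), (0, 0, -1, 1),
     (0, 0, 0, 2), (0, 0, 1, -1), (0, 0, 1, 1), (0, 0, 2, 0), (0, 1, -1, 0), (0, 1, 0, -1), (0, 1, 0, 1),
     (0, 1, 1, 0), (0, 1, 1, 2), (0, 1, 2, 1), (0, 2, 0, 0), (0, 2, 1, 1), (1, -1, 0, 0), (1, -1, 1, 1),
     (1, 0, -1, 0), (1, 0, 0, -1), (1, 0, 0, 1), (1, 0, 1, 0), (1, 0, 1, 2), (1, 0, 2, 1), (1, 1, -1, 1),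
     (1, 1, 0, 0), (1, 1, 0, 2), (1, 1, 1, -1), (1, 1, 1, 1), (1, 1, 2, 0), (1, 2, 0, 1), (1, 2, 1, 0),
     (2, 0, 0, 0), (2, 0, 1, 1), (2, 1, 0, 1), (2, 1, 1, 0), (0, 0, 0, 0)]),
   ([-1, -1, -1, -1, 1, 1, 1, 1],
    [(-2, -1, -1, 0), (-2, -1, 0, -1), (-2, 0, -1, -1), (-2, 0, 0, 0), (-1, -2, -1, 0), (-1, -2, 0, -1),
     (-1, -1, -2, 0), (-1, -1, -1, -1), (-1, -1, -1, 1), (-1, -1, 0, -2), (-1, -1, 0, 0), (-1, -1, 1, -1),
     (-1, 0, -2, -1), (-1, 0, -1, -2), (-1, 0, -1, 0), (-1, 0, 0, -1), (-1, 0, 0, 1), (-1, 0, 1, 0),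
     (-1, 1, -1, -1), (-1, 1, 0, 0), (0, -2, -1, -1), (0, -2, 0, 0), (0, -1, -2, -1), (0, -1, -1, -2),
     (0, -1, -1, 0), (0, -1, 0, -1), (0, -1, 0, 1), (0, -1, 1, 0), (0, 0, -2, 0), (0, 0, -1, -1), (0, 0, -1, 1),
     (0, 0, 0, -2), (0, 0, 1, -1), (0, 1, -1, 0), (0, 1, 0, -1), (1, -1, -1, -1), (1, -1, 0, 0), (1, 0, -1, 0),
     (1, 0, 0, -1), (0, 0, 0, 0)])]"

lemma irreducible_lift_coords:
  assumes "irreducible_lift g m"
  shows "\<exists>h. m 0 + m 1 + m 2 + m 3 = 2 * h \<and>
    m 4 = m 0 - h \<and> m 5 = m 1 - h \<and> m 6 = m 2 - h \<and> m 7 = m 3 - h"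
  using assms kernel_coords[of m] unfolding irreducible_lift_def by metis

text \<open>Only completeness of the rows is needed, not that their entries are irreducible. For
  each row, failure of the 48 exchanges (24 quadrics, between the positive or between the negative
  parts) together with the kernel equations leaves just the listed values.\<close>

lemma irreducible_quadric_lifts:
  "list_all (\<lambda>(g, ds). \<forall>m. irreducible_lift (nth g) m \<longrightarrow> (m 0, m 1, m 2, m 3) \<in> set ds) quadric_lifts"
  unfolding quadric_lifts_def list.pred_inject prod.case simp_thms list.set insert_iff empty_iff prod.inject
  by (intro conjI allI impI list.pred_inject(1);
      frule irreducible_lift_coords; drule irreducible_lift_expand; elim exE;
      simp del: One_nat_def; smt (verit))

lemma irreducible_quartic_lifts:
  "list_all (\<lambda>(g, ds). \<forall>m. irreducible_lift (nth g) m \<longrightarrow> (m 0, m 1, m 2, m 3) \<in> set ds) quartic_lifts"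
  unfolding quartic_lifts_def list.pred_inject prod.case simp_thms list.set insert_iff empty_iff prod.inject
  by (intro conjI allI impI list.pred_inject(1);
      frule irreducible_lift_coords; drule irreducible_lift_expand; elim exE;
      simp del: One_nat_def; smt (verit))

declare One_nat_def [simp del]

definition lift_table :: "(int list \<times> (int \<times> int \<times> int \<times> int) list) list" where
  "lift_table = quadric_lifts @ quartic_lifts"

lemma irreducible_lift_table:
  "list_all (\<lambda>(g, ds). \<forall>m. irreducible_lift (nth g) m \<longrightarrow> (m 0, m 1, m 2, m 3) \<in> set ds) lift_table"
  unfolding lift_table_def list_all_append
  by (intro conjI irreducible_quadric_lifts irreducible_quartic_lifts)

lemma lift_table_complete: "\<forall>g\<in>set moves. \<exists>(g', ds)\<in>set lift_table. g' = g"
  unfolding moves_def both_signs_def half_quadrics_def half_quartics_def lift_table_def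
    quadric_lifts_def quartic_lifts_def by simp

definition lift_vector :: "int \<times> int \<times> int \<times> int \<Rightarrow> int list" where
  "lift_vector = (\<lambda>(a, b, c, d). let h = (a + b + c + d) div 2 in [a, b, c, d, a - h, b - h, c - h, d - h])"

text \<open>The second bound is the lifting defect and leads to \<open>4 + 2 * N\<close>. The first
  bounds the excess over the positive part of \<open>g\<close> vertex by vertex; being independent
  of the number of labels, it leads to \<open>4 + 8 = 12\<close>.\<close>

definition small_lift :: "int list \<Rightarrow> int list \<Rightarrow> bool" where
  "small_lift g m \<longleftrightarrow> list_all (\<lambda>(x, y). y \<le> max x 0 + 1 \<and> x - y \<le> max x 0 + 1) (zip g m) \<and>
     sum_list (map (\<lambda>(x, y). max y 0 + max (x - y) 0) (zip g m)) \<le> sum_list (map (\<lambda>x. max x 0) g) + 2"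

lemma lift_table_small: "list_all (\<lambda>(g, ds). list_all (\<lambda>d. small_lift g (lift_vector d)) ds) lift_table"
  by code_simp

lemma irreducible_lift_bound:
  assumes g: "g \<in> set moves" and irr: "irreducible_lift (nth g) m"
  shows "\<forall>n<8. m n \<le> max (g ! n) 0 + 1 \<and> g ! n - m n \<le> max (g ! n) 0 + 1"
    "(\<Sum>n<8. max (m n) 0 + max (g ! n - m n) 0) \<le> (\<Sum>n<8. max (g ! n) 0) + 2"
proof -
  obtain ds where ds: "(g, ds) \<in> set lift_table" using lift_table_complete g by blast
  let ?m = "lift_vector (m 0, m 1, m 2, m 3)"
  have "(m 0, m 1, m 2, m 3) \<in> set ds"
    using irreducible_lift_table ds irr unfolding list_all_iff by blast
  then have small: "small_lift g ?m"
    using lift_table_small ds unfolding list_all_iff by blast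
  obtain h where h: "m 0 + m 1 + m 2 + m 3 = 2 * h"
    "m 4 = m 0 - h" "m 5 = m 1 - h" "m 6 = m 2 - h" "m 7 = m 3 - h"
    using irreducible_lift_coords[OF irr] by blast
  have m: "?m = [m 0, m 1, m 2, m 3, m 4, m 5, m 6, m 7]"
    unfolding lift_vector_def by (simp add: h Let_def)
  have len: "length g = 8" using moves_length g by blast
  have "g = [g ! 0, g ! 1, g ! 2, g ! 3, g ! 4, g ! 5, g ! 6, g ! 7]"
  proof (rule nth_equalityI)
    have "\<forall>i<8. g ! i = [g ! 0, g ! 1, g ! 2, g ! 3, g ! 4, g ! 5, g ! 6, g ! 7] ! i"
      unfolding all8 by simp
    then show "g ! i = [g ! 0, g ! 1, g ! 2, g ! 3, g ! 4, g ! 5, g ! 6, g ! 7] ! i" if "i < length g" for i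
      using that unfolding len by blast
  qed (simp add: len)
  then obtain g0 g1 g2 g3 g4 g5 g6 g7 where g_eq: "g = [g0, g1, g2, g3, g4, g5, g6, g7]" by blast
  show "\<forall>n<8. m n \<le> max (g ! n) 0 + 1 \<and> g ! n - m n \<le> max (g ! n) 0 + 1"
    "(\<Sum>n<8. max (m n) 0 + max (g ! n - m n) 0) \<le> (\<Sum>n<8. max (g ! n) 0) + 2"
    using small unfolding m g_eq small_lift_def all8 sum8 by simp_all
qed

section \<open>Tables on the cube and on the three-star\<close>

lemma finite_configs: "finite V \<Longrightarrow> finite (configs V)"
  unfolding configs_def by (rule finite_PiE) auto

definition cube_vertex :: "nat \<Rightarrow> nat \<Rightarrow> nat" where
  "cube_vertex n = (\<lambda>i\<in>{1, 2, 3}. vertex_bit i n)"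

lemma vertex_bit_binary: "n < 8 \<Longrightarrow> i \<in> {1, 2, 3} \<Longrightarrow> vertex_bit i n \<in> {0, 1}"
proof -
  have "\<forall>n<8. \<forall>i\<in>{1, 2, 3}. vertex_bit i n \<in> {0, 1}" unfolding all8 by (simp add: vertex_bit_def)
  then show "n < 8 \<Longrightarrow> i \<in> {1, 2, 3} \<Longrightarrow> vertex_bit i n \<in> {0, 1}" by (meson bspec)
qed

lemma vertex_bit_inj: "n < 8 \<Longrightarrow> m < 8 \<Longrightarrow> (\<And>i. i \<in> {1, 2, 3} \<Longrightarrow> vertex_bit i n = vertex_bit i m) \<Longrightarrow> n = m"
proof -
  have "\<forall>n<8. \<forall>m<8. vertex_bit 1 n = vertex_bit 1 m \<longrightarrow> vertex_bit 2 n = vertex_bit 2 m \<longrightarrow> vertex_bit 3 n = vertex_bit 3 m \<longrightarrow> n = m"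
    unfolding all8 by (simp add: vertex_bit_def)
  then show "n < 8 \<Longrightarrow> m < 8 \<Longrightarrow> (\<And>i. i \<in> {1, 2, 3} \<Longrightarrow> vertex_bit i n = vertex_bit i m) \<Longrightarrow> n = m" by blast
qed

lemma vertex_bit_surj:
  fixes x :: "nat \<Rightarrow> nat"
  assumes "\<And>i. i \<in> {1, 2, 3} \<Longrightarrow> x i \<in> {0, 1}"
  obtains n where "n < 8" "\<And>i. i \<in> {1, 2, 3} \<Longrightarrow> vertex_bit i n = x i"
proof -
  have "x 1 \<in> {0, 1}" "x 2 \<in> {0, 1}" "x 3 \<in> {0, 1}" using assms by blast+
  then have "\<exists>n<8. vertex_bit 1 n = x 1 \<and> vertex_bit 2 n = x 2 \<and> vertex_bit 3 n = x 3"
    unfolding ex8 by (auto simp: vertex_bit_def)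
  then show ?thesis using that by blast
qed

lemma cube_vertex_apply: "i \<in> {1, 2, 3} \<Longrightarrow> cube_vertex n i = vertex_bit i n"
  unfolding cube_vertex_def by (simp only: restrict_apply if_True)

lemma cube_vertex_eqI: "x \<in> configs {1, 2, 3} \<Longrightarrow> (\<And>i. i \<in> {1, 2, 3} \<Longrightarrow> vertex_bit i n = x i) \<Longrightarrow> x = cube_vertex n"
  unfolding configs_def cube_vertex_def by (intro PiE_ext[of x _ _ "\<lambda>i\<in>{1, 2, 3}. vertex_bit i n"]) (auto simp: restrict_def extensional_def PiE_def)

lemma cube_vertex_in: "n < 8 \<Longrightarrow> cube_vertex n \<in> configs {1, 2, 3}"
  unfolding configs_def cube_vertex_def by (intro restrict_PiE_iff[THEN iffD2] ballI vertex_bit_binary)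

lemma bij_cube_vertex: "bij_betw cube_vertex {..<8} (configs {1, 2, 3})"
proof (rule bij_betw_imageI)
  show "inj_on cube_vertex {..<8}"
    by (rule inj_onI) (metis vertex_bit_inj cube_vertex_apply lessThan_iff)
  show "cube_vertex ` {..<8} = configs {1, 2, 3}"
  proof
    show "configs {1, 2, 3} \<subseteq> cube_vertex ` {..<8}"
    proof
      fix x :: "nat \<Rightarrow> nat" assume x: "x \<in> configs {1, 2, 3}"
      then have "\<And>i. i \<in> {1, 2, 3} \<Longrightarrow> x i \<in> {0, 1}" unfolding configs_def by (rule PiE_mem)
      then obtain n where "n < 8" "\<And>i. i \<in> {1, 2, 3} \<Longrightarrow> vertex_bit i n = x i" using vertex_bit_surj by blast
      then show "x \<in> cube_vertex ` {..<8}" using cube_vertex_eqI[OF x] by blast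
    qed
  qed (use cube_vertex_in in blast)
qed

lemma cube_vertex_inject: "n < 8 \<Longrightarrow> m < 8 \<Longrightarrow> cube_vertex n = cube_vertex m \<longleftrightarrow> n = m"
  using bij_cube_vertex unfolding bij_betw_def inj_on_def by blast

definition star_vertex :: "nat \<Rightarrow> nat \<Rightarrow> nat \<Rightarrow> nat" where
  "star_vertex n b = (cube_vertex n)(4 := b)"

lemma restrict_star_vertex: "restrict (star_vertex n b) {1, 2, 3} = cube_vertex n"
  unfolding star_vertex_def cube_vertex_def by (auto simp: fun_eq_iff restrict_def)

lemma star_vertex_4 [simp]: "star_vertex n b 4 = b" by (simp add: star_vertex_def)

lemma star_vertex_in: "n < 8 \<Longrightarrow> b \<in> {0, 1} \<Longrightarrow> star_vertex n b \<in> configs {1, 2, 3, 4}"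
  using cube_vertex_in[of n] unfolding star_vertex_def configs_def by (auto simp: PiE_iff extensional_def)

lemma configs4E:
  fixes x :: "nat \<Rightarrow> nat"
  assumes "x \<in> configs {1, 2, 3, 4}"
  obtains n b where "n < 8" "b \<in> {0, 1}" "x = star_vertex n b"
proof -
  have "restrict x {1, 2, 3} \<in> configs {1, 2, 3}"
    using assms unfolding configs_def by (auto simp: PiE_iff)
  then obtain n where n: "n < 8" "restrict x {1, 2, 3} = cube_vertex n"
    using bij_cube_vertex unfolding bij_betw_def by blast
  have "x 4 \<in> {0, 1}" using assms unfolding configs_def by (auto simp: PiE_iff)
  moreover have "x = star_vertex n (x 4)"
  proof
    fix i show "x i = star_vertex n (x 4) i"
    proof (cases "i \<in> {1, 2, 3, 4}")
      case True
      then show ?thesis using fun_cong[OF n(2), of i] unfolding star_vertex_def by auto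
    next
      case False
      then show ?thesis using assms unfolding star_vertex_def cube_vertex_def configs_def by (auto simp: PiE_iff extensional_def)
    qed
  qed
  ultimately show ?thesis using n(1) that by blast
qed

lemma star_vertex_inject: "n < 8 \<Longrightarrow> m < 8 \<Longrightarrow> star_vertex n b = star_vertex m c \<longleftrightarrow> n = m \<and> b = c"
  using restrict_star_vertex[of n b] restrict_star_vertex[of m c] star_vertex_4[of n b] star_vertex_4[of m c] cube_vertex_inject by metis

lemma bij_star_vertex: "bij_betw (\<lambda>(n, b). star_vertex n b) ({..<8} \<times> {0, 1}) (configs {1, 2, 3, 4})"
proof (rule bij_betw_imageI)
  show "inj_on (\<lambda>(n, b). star_vertex n b) ({..<8} \<times> {0, 1})"
    by (rule inj_onI) (auto simp: star_vertex_inject)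
  show "(\<lambda>(n, b). star_vertex n b) ` ({..<8} \<times> {0, 1}) = configs {1, 2, 3, 4}"
  proof
    show "configs {1, 2, 3, 4} \<subseteq> (\<lambda>(n, b). star_vertex n b) ` ({..<8} \<times> {0, 1})"
    proof
      fix x :: "nat \<Rightarrow> nat" assume "x \<in> configs {1, 2, 3, 4}"
      then obtain n b where "n < 8" "b \<in> {0, 1}" "x = star_vertex n b" by (rule configs4E)
      then show "x \<in> (\<lambda>(n, b). star_vertex n b) ` ({..<8} \<times> {0, 1})" by force
    qed
    show "(\<lambda>(n, b). star_vertex n b) ` ({..<8} \<times> {0, 1}) \<subseteq> configs {1, 2, 3, 4}"
      using star_vertex_in by (intro image_subsetI) auto
  qed
qed

section \<open>Tables on the cube and on the three-star in terms of eight entries\<close>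

definition cube_table :: "(nat \<Rightarrow> int) \<Rightarrow> (nat \<Rightarrow> nat) \<Rightarrow> int" where
  "cube_table f x = (\<Sum>n<8. if x = cube_vertex n then f n else 0)"

definition star_table :: "(nat \<Rightarrow> int) \<Rightarrow> (nat \<Rightarrow> int) \<Rightarrow> (nat \<Rightarrow> nat) \<Rightarrow> int" where
  "star_table a c x = (\<Sum>n<8. if x = star_vertex n 1 then a n else if x = star_vertex n 0 then c n else 0)"

lemma cube_table_vertex: "n < 8 \<Longrightarrow> cube_table f (cube_vertex n) = f n"
proof -
  assume n: "n < 8"
  have "cube_table f (cube_vertex n) = (\<Sum>m<8. if m = n then f m else 0)"
    unfolding cube_table_def by (rule sum.cong) (use cube_vertex_inject n in auto)
  with n show ?thesis by simp
qed

lemma cube_table_0: "x \<notin> configs {1, 2, 3} \<Longrightarrow> cube_table f x = 0"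
  unfolding cube_table_def by (rule sum.neutral) (use cube_vertex_in in auto)

lemma cube_table_in: "cube_table f \<in> tables {1, 2, 3}"
  unfolding tables_def using cube_table_0 by blast

lemma cube_table_eqI:
  assumes "u \<in> tables {1, 2, 3}" "\<And>n. n < 8 \<Longrightarrow> u (cube_vertex n) = f n"
  shows "u = cube_table f"
proof
  fix x show "u x = cube_table f x"
  proof (cases "x \<in> configs {1, 2, 3}")
    case True
    then obtain n where "n < 8" "x = cube_vertex n" using bij_cube_vertex unfolding bij_betw_def by blast
    then show ?thesis using assms(2) by (simp add: cube_table_vertex)
  next
    case False
    then show ?thesis using assms(1) cube_table_0 unfolding tables_def by auto
  qed
qed

lemma cube_table_cong: "(\<And>n. n < 8 \<Longrightarrow> f n = f' n) \<Longrightarrow> cube_table f = cube_table f'"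
  by (rule cube_table_eqI[OF cube_table_in]) (simp add: cube_table_vertex)

lemma cube_table_eq_iff: "cube_table f = cube_table f' \<longleftrightarrow> (\<forall>n<8. f n = f' n)"
  using cube_table_cong cube_table_vertex by metis

lemma cube_table_diff: "cube_table f - cube_table f' = cube_table (\<lambda>n. f n - f' n)"
  by (rule cube_table_eqI) (simp_all add: tables_def cube_table_0 cube_table_vertex)

lemma star_table_vertex:
  assumes "n < 8" shows "star_table a c (star_vertex n 1) = a n" "star_table a c (star_vertex n 0) = c n"
proof -
  have "star_table a c (star_vertex n 1) = (\<Sum>m<8. if m = n then a m else 0)"
    "star_table a c (star_vertex n 0) = (\<Sum>m<8. if m = n then c m else 0)"
    unfolding star_table_def by (rule sum.cong; use star_vertex_inject assms in auto)+
  with assms show "star_table a c (star_vertex n 1) = a n" "star_table a c (star_vertex n 0) = c n" by simp_all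
qed

lemma star_table_0: "x \<notin> configs {1, 2, 3, 4} \<Longrightarrow> star_table a c x = 0"
  unfolding star_table_def by (rule sum.neutral) (use star_vertex_in in auto)

lemma star_table_in: "star_table a c \<in> tables {1, 2, 3, 4}"
  unfolding tables_def using star_table_0 by blast

lemma star_table_eqI:
  assumes "v \<in> tables {1, 2, 3, 4}" "\<And>n. n < 8 \<Longrightarrow> v (star_vertex n 1) = a n" "\<And>n. n < 8 \<Longrightarrow> v (star_vertex n 0) = c n"
  shows "v = star_table a c"
proof
  fix x show "v x = star_table a c x"
  proof (cases "x \<in> configs {1, 2, 3, 4}")
    case True
    then obtain n b where "n < 8" "b \<in> {0, 1}" "x = star_vertex n b" by (rule configs4E)
    then show ?thesis using assms(2,3) star_table_vertex[of n a c] by auto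
  next
    case False
    then show ?thesis using assms(1) star_table_0 unfolding tables_def by auto
  qed
qed

lemma star_table_diff:
  "star_table a c - star_table a' c' = star_table (\<lambda>n. a n - a' n) (\<lambda>n. c n - c' n)"
  by (rule star_table_eqI) (simp_all add: tables_def star_table_0 star_table_vertex)

lemma deg_cube_table: "deg (cube_table f) = (\<Sum>n<8. nat (f n))"
proof -
  have "deg (cube_table f) = (\<Sum>x\<in>configs {1, 2, 3}. nat (cube_table f x))"
    unfolding deg_def using cube_table_0[of _ f]
    by (intro sum.mono_neutral_left finite_configs) force+
  also have "\<dots> = (\<Sum>n<8. nat (cube_table f (cube_vertex n)))"
    by (rule sum.reindex_bij_betw[OF bij_cube_vertex, symmetric])
  finally show ?thesis by (simp add: cube_table_vertex)
qed

lemma sum_configs4: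
  "(\<Sum>x\<in>configs {1, 2, 3, 4}. f x) = (\<Sum>n<8. f (star_vertex n 1) + f (star_vertex n 0))" for f :: "_ \<Rightarrow> 'b::comm_monoid_add"
proof -
  have "(\<Sum>x\<in>configs {1, 2, 3, 4}. f x) = (\<Sum>(n, b)\<in>{..<8} \<times> {0, 1}. f (star_vertex n b))"
    using sum.reindex_bij_betw[OF bij_star_vertex, of f] by (simp add: case_prod_unfold)
  also have "\<dots> = (\<Sum>n<8. \<Sum>b\<in>{0, 1}. f (star_vertex n b))" by (rule sum.cartesian_product[symmetric])
  finally show ?thesis by (simp add: add.commute)
qed

lemma deg_star_table: "deg (star_table a c) = (\<Sum>n<8. nat (a n) + nat (c n))"
proof -
  have "deg (star_table a c) = (\<Sum>x\<in>configs {1, 2, 3, 4}. nat (star_table a c x))"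
    unfolding deg_def using star_table_0[of _ a c]
    by (intro sum.mono_neutral_left finite_configs) force+
  then show ?thesis by (simp add: sum_configs4 star_table_vertex)
qed

lemma \<xi>_star_table: "\<xi> (star_table a c) = cube_table (\<lambda>n. a n + c n)"
proof (rule cube_table_eqI)
  show "\<xi> (star_table a c) \<in> tables {1, 2, 3}" unfolding \<xi>_def marginal_def tables_def by auto
  fix n :: nat assume n: "n < 8"
  have "\<xi> (star_table a c) (cube_vertex n) =
      (\<Sum>x\<in>configs {1, 2, 3, 4}. if restrict x {1, 2, 3} = cube_vertex n then star_table a c x else 0)"
    unfolding \<xi>_def marginal_def using cube_vertex_in[OF n] finite_configs[of "{1, 2, 3, 4::nat}"]
    by (simp add: sum.inter_filter)
  also have "\<dots> = (\<Sum>m<8. if m = n then a m + c m else 0)"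
    unfolding sum_configs4 restrict_star_vertex by (rule sum.cong) (use n star_table_vertex cube_vertex_inject in auto)
  finally show "\<xi> (star_table a c) (cube_vertex n) = a n + c n" using n by simp
qed

lemma marginal_star_table:
  assumes i: "i \<in> {1, 2, 3}" and y: "y \<in> configs {i, 4}"
  shows "marginal {1, 2, 3, 4} {i, 4} (star_table a c) y =
    (\<Sum>n<8. if vertex_bit i n = y i then (if y 4 = 1 then a n else c n) else 0)"
proof -
  have y4: "y 4 = 0 \<or> y 4 = 1" using y unfolding configs_def by (auto simp: PiE_iff)
  have r: "restrict (star_vertex n b) {i, 4} = y \<longleftrightarrow> vertex_bit i n = y i \<and> b = y 4" for n b
  proof -
    have "star_vertex n b i = vertex_bit i n" using i cube_vertex_apply[OF i, of n] unfolding star_vertex_def by auto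
    then have *: "restrict (star_vertex n b) {i, 4} i = vertex_bit i n" "restrict (star_vertex n b) {i, 4} 4 = b" by auto
    show ?thesis
    proof
      assume "vertex_bit i n = y i \<and> b = y 4"
      then show "restrict (star_vertex n b) {i, 4} = y"
        using * y unfolding configs_def by (intro PiE_ext[of _ "{i, 4}" "\<lambda>_. {0, 1}"]) (auto simp: PiE_iff)
    qed (use * in auto)
  qed
  have "marginal {1, 2, 3, 4} {i, 4} (star_table a c) y =
      (\<Sum>x\<in>configs {1, 2, 3, 4}. if restrict x {i, 4} = y then star_table a c x else 0)"
    unfolding marginal_def using y finite_configs[of "{1, 2, 3, 4::nat}"] by (simp add: sum.inter_filter)
  also have "\<dots> = (\<Sum>n<8. if vertex_bit i n = y i then (if y 4 = 1 then a n else c n) else 0)"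
    unfolding sum_configs4 r by (rule sum.cong) (use y4 star_table_vertex in auto)
  finally show ?thesis .
qed

lemma facets_star3: "facets star3 = {{1, 4}, {2, 4}, {3, 4}}"
proof
  have ne: "star3 = {{}, {1}, {2}, {3}, {4}, {1, 4}, {2, 4}, {3, 4}}"
    unfolding star3_def graph_complex_def by blast
  show "facets star3 \<subseteq> {{1, 4}, {2, 4}, {3, 4}}"
    unfolding facets_def ne by auto
  show "{{1, 4}, {2, 4}, {3, 4}} \<subseteq> facets star3"
    unfolding facets_def ne by auto
qed

lemma Union_star3: "\<Union>star3 = {1, 2, 3, 4}"
  unfolding star3_def graph_complex_def by auto

lemma configs_pair:
  fixes i w :: "'a"
  assumes "i \<noteq> w" "p \<in> {0, 1}" "b \<in> {0, 1}"
  obtains y where "y \<in> configs {i, w}" "y i = p" "y w = b"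
proof (rule that[of "\<lambda>k\<in>{i, w}. if k = i then p else b"])
qed (use assms in \<open>auto simp: configs_def\<close>)

lemma restrict_eq_iff: "restrict f S = restrict g S \<longleftrightarrow> (\<forall>x\<in>S. f x = g x)"
proof
  assume "restrict f S = restrict g S"
  then show "\<forall>x\<in>S. f x = g x" by (metis restrict_apply)
qed (rule FuncSet.restrict_ext, simp)

text \<open>The marginal on \<open>{i, 4}\<close> splits by the value at node 4 into the marginals
  at node \<open>i\<close> of the two layers.\<close>

lemma star_map_eq_iff:
  "hierarchical_map star3 (star_table a c) = hierarchical_map star3 (star_table a' c') \<longleftrightarrow> same_marg a a' \<and> same_marg c c'"
proof -
  let ?m = "\<lambda>i. marginal {1, 2, 3, 4} {i, 4}"
  have "hierarchical_map star3 (star_table a c) = hierarchical_map star3 (star_table a' c') \<longleftrightarrow>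
      (\<forall>i\<in>{1, 2, 3}. ?m i (star_table a c) = ?m i (star_table a' c'))"
    unfolding hierarchical_map_def facets_star3 Union_star3 restrict_eq_iff by simp
  also have "\<dots> \<longleftrightarrow> same_marg a a' \<and> same_marg c c'"
  proof
    assume *: "\<forall>i\<in>{1, 2, 3}. ?m i (star_table a c) = ?m i (star_table a' c')"
    have eq: "(\<Sum>n<8. if vertex_bit i n = p then (if b = 1 then a n else c n) else 0) =
        (\<Sum>n<8. if vertex_bit i n = p then (if b = 1 then a' n else c' n) else 0)"
      if i: "i \<in> {1, 2, 3}" "p \<in> {0, 1}" "b \<in> {0, 1}" for i p and b :: nat
    proof -
      have "i \<noteq> 4" using i by auto
      then obtain y where y: "y \<in> configs {i, 4}" "y i = p" "y 4 = b" using configs_pair i(2,3) by metis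
      from *[rule_format, OF i(1)] have "?m i (star_table a c) y = ?m i (star_table a' c') y" by simp
      then show ?thesis unfolding marginal_star_table[OF i(1) y(1)] y(2,3) .
    qed
    show "same_marg a a' \<and> same_marg c c'"
      unfolding same_marg_def
    proof (intro conjI ballI)
      fix i p :: nat assume ip: "i \<in> {1, 2, 3}" "p \<in> {0, 1}"
      show "(\<Sum>n<8. if vertex_bit i n = p then a n else 0) = (\<Sum>n<8. if vertex_bit i n = p then a' n else 0)"
        using eq[OF ip, of 1] by (simp cong: if_cong)
      show "(\<Sum>n<8. if vertex_bit i n = p then c n else 0) = (\<Sum>n<8. if vertex_bit i n = p then c' n else 0)"
        using eq[OF ip, of 0] by (simp cong: if_cong)
    qed
  next
    assume s: "same_marg a a' \<and> same_marg c c'"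
    show "\<forall>i\<in>{1, 2, 3}. ?m i (star_table a c) = ?m i (star_table a' c')"
    proof (intro ballI HOL.ext)
      fix i :: nat and y :: "nat \<Rightarrow> nat" assume i: "i \<in> {1, 2, 3}"
      show "?m i (star_table a c) y = ?m i (star_table a' c') y"
      proof (cases "y \<in> configs {i, 4}")
        case True
        then have "y i \<in> {0, 1}" unfolding configs_def by (auto simp: PiE_iff)
        then show ?thesis
          using s i unfolding same_marg_def marginal_star_table[OF i True] by (cases "y 4 = 1") (auto cong: if_cong)
      qed (simp add: marginal_def)
    qed
  qed
  finally show ?thesis .
qed

lemma star_tableE:
  assumes "v \<in> tables {1, 2, 3, 4}"
  obtains a c where "v = star_table a c"
  by (rule that, rule star_table_eqI[OF assms refl refl])

lemma star_table_nonneg: "(\<forall>x. 0 \<le> star_table a c x) \<longleftrightarrow> (\<forall>n<8. 0 \<le> a n \<and> 0 \<le> c n)"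
proof
  assume "\<forall>n<8. 0 \<le> a n \<and> 0 \<le> c n"
  then show "\<forall>x. 0 \<le> star_table a c x" unfolding star_table_def by (auto intro!: sum_nonneg)
qed (metis star_table_vertex)

lemma star_fiber_iff:
  "star_table a c \<in> fiber star3 (hierarchical_map star3 (star_table a0 c0)) \<longleftrightarrow>
     (\<forall>n<8. 0 \<le> a n \<and> 0 \<le> c n) \<and> same_marg a a0 \<and> same_marg c c0"
  unfolding fiber_def Union_star3 using star_table_in[of a c] star_table_nonneg[of a c]
    star_map_eq_iff[of a c a0 c0] by auto

lemma star_fiberE:
  assumes "v \<in> fiber star3 b"
  obtains a c where "v = star_table a c" "b = hierarchical_map star3 (star_table a c)"
    "\<forall>n<8. 0 \<le> a n \<and> 0 \<le> c n"
proof -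
  have v: "v \<in> tables {1, 2, 3, 4}" "hierarchical_map star3 v = b" "\<forall>x. 0 \<le> v x"
    using assms unfolding fiber_def Union_star3 by auto
  obtain a c where ac: "v = star_table a c" using v(1) by (rule star_tableE)
  then show ?thesis using v(2,3) star_table_nonneg[of a c] that by auto
qed

text \<open>Here \<open>a\<close> is the layer with value 1 at node 4 and \<open>f - a\<close> the
  other one, so that membership becomes the search for a point in the box below
  \<open>f\<close>.\<close>

lemma projected_fiber_iff:
  "cube_table f \<in> \<xi> ` fiber star3 (hierarchical_map star3 (star_table a0 c0)) \<longleftrightarrow>
     (\<exists>a. (\<forall>n<8. 0 \<le> a n \<and> a n \<le> f n) \<and> same_marg a a0 \<and> same_marg (\<lambda>n. f n - a n) c0)"
proof
  assume "cube_table f \<in> \<xi> ` fiber star3 (hierarchical_map star3 (star_table a0 c0))"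
  then obtain v where v: "v \<in> fiber star3 (hierarchical_map star3 (star_table a0 c0))" "cube_table f = \<xi> v" by blast
  obtain a c where ac: "v = star_table a c" using star_fiberE[OF v(1)] by blast
  have f: "\<forall>n<8. f n = a n + c n" using v(2) unfolding ac \<xi>_star_table cube_table_eq_iff .
  have *: "(\<forall>n<8. 0 \<le> a n \<and> 0 \<le> c n) \<and> same_marg a a0 \<and> same_marg c c0" using v(1) unfolding ac star_fiber_iff .
  moreover have "same_marg (\<lambda>n. f n - a n) c" using f unfolding same_marg_iff by simp
  ultimately show "\<exists>a. (\<forall>n<8. 0 \<le> a n \<and> a n \<le> f n) \<and> same_marg a a0 \<and> same_marg (\<lambda>n. f n - a n) c0"
    using f same_marg_trans by (intro exI[of _ a]) auto
next
  assume "\<exists>a. (\<forall>n<8. 0 \<le> a n \<and> a n \<le> f n) \<and> same_marg a a0 \<and> same_marg (\<lambda>n. f n - a n) c0"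
  then obtain a where "(\<forall>n<8. 0 \<le> a n \<and> a n \<le> f n) \<and> same_marg a a0 \<and> same_marg (\<lambda>n. f n - a n) c0" by blast
  then have "star_table a (\<lambda>n. f n - a n) \<in> fiber star3 (hierarchical_map star3 (star_table a0 c0))"
    unfolding star_fiber_iff by auto
  moreover have "\<xi> (star_table a (\<lambda>n. f n - a n)) = cube_table f" by (simp add: \<xi>_star_table)
  ultimately show "cube_table f \<in> \<xi> ` fiber star3 (hierarchical_map star3 (star_table a0 c0))" by force
qed

section \<open>The PF Markov basis and its lifting defect\<close>

definition PF_moves :: "((nat \<Rightarrow> nat) \<Rightarrow> int) set" where
  "PF_moves = cube_table ` nth ` set moves"

lemma projected_fiberE:
  assumes "u \<in> \<xi> ` fiber star3 b"
  obtains f a where "u = cube_table f" "b = hierarchical_map star3 (star_table a (\<lambda>n. f n - a n))"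
    "\<forall>n<8. 0 \<le> a n \<and> a n \<le> f n"
proof -
  obtain v where v: "v \<in> fiber star3 b" "u = \<xi> v" using assms by blast
  obtain a c where ac: "v = star_table a c" "b = hierarchical_map star3 (star_table a c)"
    "\<forall>n<8. 0 \<le> a n \<and> 0 \<le> c n" by (rule star_fiberE[OF v(1)])
  show ?thesis
    by (rule that[of "\<lambda>n. a n + c n" a]) (use ac v(2) \<xi>_star_table in auto)
qed

text \<open>Induction on the distance of the two end points. Depending on whether the table supplied
  by \<open>pf_progress\<close> is a neighbour of the first or of the second end, the new edge is
  put at the beginning or at the end of the path.\<close>

lemma pf_connects:
  assumes B: "B \<noteq> {}"
  shows "connects PF_moves (\<Inter>b\<in>B. \<xi> ` fiber star3 b)"
proof -
  define S where "S = (\<Inter>b\<in>B. \<xi> ` fiber star3 b)"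
  let ?R = "{(v, v'). v \<in> S \<and> v' \<in> S \<and> v - v' \<in> PF_moves \<union> uminus ` PF_moves}"
  have "(cube_table f, cube_table f') \<in> ?R\<^sup>*" if "cube_table f \<in> S" "cube_table f' \<in> S" for f f'
    using that
  proof (induction "move_dist (\<lambda>n. f' n - f n)" arbitrary: f f' rule: less_induct)
    case less
    obtain b0 where b0: "b0 \<in> B" using B by blast
    have mem: "\<exists>a c a'. b = hierarchical_map star3 (star_table a c) \<and>
        (\<forall>n<8. 0 \<le> a n \<and> a n \<le> f n) \<and> same_marg (\<lambda>n. f n - a n) c \<and>
        (\<forall>n<8. 0 \<le> a' n \<and> a' n \<le> f' n) \<and> same_marg a' a \<and> same_marg (\<lambda>n. f' n - a' n) c" if b: "b \<in> B" for b
    proof -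
      have "cube_table f \<in> \<xi> ` fiber star3 b" using less.prems(1) b unfolding S_def by blast
      then obtain h a where h: "cube_table f = cube_table h" "b = hierarchical_map star3 (star_table a (\<lambda>n. h n - a n))"
        "\<forall>n<8. 0 \<le> a n \<and> a n \<le> h n" by (rule projected_fiberE)
      have "cube_table f' \<in> \<xi> ` fiber star3 b" using less.prems(2) b unfolding S_def by blast
      then obtain a' where "(\<forall>n<8. 0 \<le> a' n \<and> a' n \<le> f' n) \<and> same_marg a' a \<and> same_marg (\<lambda>n. f' n - a' n) (\<lambda>n. h n - a n)"
        unfolding h(2) projected_fiber_iff by blast
      moreover have "\<forall>n<8. f n = h n" using h(1) unfolding cube_table_eq_iff .
      moreover from this have "same_marg (\<lambda>n. f n - a n) (\<lambda>n. h n - a n)" unfolding same_marg_iff by simp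
      ultimately show ?thesis using h(2,3)
        by (intro exI[of _ a] exI[of _ "\<lambda>n. h n - a n"] exI[of _ a'] conjI) auto
    qed
    \<comment> \<open>One member of \<open>B\<close> suffices: adding the marginals of the two
      layers shows that \<open>f\<close> and \<open>f'\<close> have the same marginals.\<close>
    have f: "\<forall>n<8. 0 \<le> f n" "\<forall>n<8. 0 \<le> f' n" "same_marg f' f"
    proof -
      obtain a c a' where *: "\<forall>n<8. 0 \<le> a n \<and> a n \<le> f n" "same_marg (\<lambda>n. f n - a n) c"
        "\<forall>n<8. 0 \<le> a' n \<and> a' n \<le> f' n" "same_marg a' a" "same_marg (\<lambda>n. f' n - a' n) c" using mem[OF b0] by blast
      show "\<forall>n<8. 0 \<le> f n" "\<forall>n<8. 0 \<le> f' n" using *(1,3) by (meson order_trans)+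
      from same_marg_add[OF *(4) same_marg_trans[OF *(5) same_marg_sym[OF *(2)]]] show "same_marg f' f" by simp
    qed
    show ?case
    proof (cases "\<exists>n<8. f' n \<noteq> f n")
      case False
      then have "cube_table f = cube_table f'" by (intro cube_table_cong) auto
      then show ?thesis by simp
    next
      case True
      obtain g v where g: "g \<in> set moves"
        and v: "(v = (\<lambda>n. f n + g ! n) \<and> move_dist (\<lambda>n. f' n - v n) < move_dist (\<lambda>n. f' n - f n)) \<or>
          (v = (\<lambda>n. f' n - g ! n) \<and> move_dist (\<lambda>n. v n - f n) < move_dist (\<lambda>n. f' n - f n))"
        and simv: "same_marg v f"
        and zon: "\<forall>a a'. (\<forall>n<8. 0 \<le> a n \<and> a n \<le> f n) \<longrightarrow> (\<forall>n<8. 0 \<le> a' n \<and> a' n \<le> f' n) \<longrightarrow>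
          same_marg a' a \<longrightarrow> (\<exists>x. (\<forall>n<8. 0 \<le> x n \<and> x n \<le> v n) \<and> same_marg x a)"
        by (rule pf_progress[OF f True])
      have vS: "cube_table v \<in> S"
        unfolding S_def
      proof (rule INT_I)
        fix b assume "b \<in> B"
        from mem[OF this] obtain a c a' where *: "b = hierarchical_map star3 (star_table a c)"
          "\<forall>n<8. 0 \<le> a n \<and> a n \<le> f n" "same_marg (\<lambda>n. f n - a n) c"
          "\<forall>n<8. 0 \<le> a' n \<and> a' n \<le> f' n" "same_marg a' a" by blast
        obtain x where x: "\<forall>n<8. 0 \<le> x n \<and> x n \<le> v n" "same_marg x a" using zon *(2,4,5) by blast
        have "same_marg (\<lambda>n. v n - x n) c" using same_marg_trans[OF same_marg_diff[OF simv x(2)] *(3)] .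
        then show "cube_table v \<in> \<xi> ` fiber star3 b"
          unfolding *(1) projected_fiber_iff using x by blast
      qed
      have gG: "cube_table (nth g) \<in> PF_moves" unfolding PF_moves_def using g by blast
      have gG': "- cube_table (nth g) \<in> PF_moves \<union> uminus ` PF_moves" using gG by blast
      from v show ?thesis
      proof (elim disjE conjE)
        assume vd: "v = (\<lambda>n. f n + g ! n)" and d: "move_dist (\<lambda>n. f' n - v n) < move_dist (\<lambda>n. f' n - f n)"
        have "cube_table v - cube_table f = cube_table (nth g)"
          unfolding cube_table_diff by (rule cube_table_cong) (simp add: vd)
        then have "cube_table f - cube_table v = - cube_table (nth g)" by (metis minus_diff_eq)
        then have "(cube_table f, cube_table v) \<in> ?R" using less.prems(1) vS gG' by simp
        moreover have "(cube_table v, cube_table f') \<in> ?R\<^sup>*" by (rule less.hyps[OF d vS less.prems(2)])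
        ultimately show ?thesis by (rule converse_rtrancl_into_rtrancl)
      next
        assume vd: "v = (\<lambda>n. f' n - g ! n)" and d: "move_dist (\<lambda>n. v n - f n) < move_dist (\<lambda>n. f' n - f n)"
        have "cube_table f' - cube_table v = cube_table (nth g)"
          unfolding cube_table_diff by (rule cube_table_cong) (simp add: vd)
        then have "cube_table v - cube_table f' = - cube_table (nth g)" by (metis minus_diff_eq)
        then have "(cube_table v, cube_table f') \<in> ?R" using less.prems(2) vS gG' by simp
        moreover have "(cube_table f, cube_table v) \<in> ?R\<^sup>*" by (rule less.hyps[OF d less.prems(1) vS])
        ultimately show ?thesis by (rule rtrancl_into_rtrancl[rotated])
      qed
    qed
  qed
  moreover have "\<exists>f. u = cube_table f" if "u \<in> S" for u
  proof -
    obtain b where "b \<in> B" using B by blast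
    then have "u \<in> \<xi> ` fiber star3 b" using that unfolding S_def by blast
    then show ?thesis by (rule projected_fiberE) blast
  qed
  ultimately show ?thesis
    unfolding connects_def S_def[symmetric] by blast
qed

lemma pf_markov_basis_moves: "pf_markov_basis PF_moves"
  unfolding pf_markov_basis_def
proof (intro conjI ballI allI impI)
  show "finite PF_moves" unfolding PF_moves_def by simp
  show "PF_moves \<subseteq> tables {1, 2, 3}" unfolding PF_moves_def using cube_table_in by auto
next
  fix g i assume "g \<in> PF_moves" and i: "i \<in> {1, 2, 3::nat}"
  then obtain k where k: "k \<in> set moves" "g = cube_table (nth k)" unfolding PF_moves_def by blast
  have "same_marg (nth k) (\<lambda>_. 0)" using moves_same_marg k(1) by blast
  have "marginal {1, 2, 3} {i} g y = 0" for y
  proof (cases "y \<in> configs {i}")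
    case True
    then have yi: "y i \<in> {0, 1}" unfolding configs_def by (auto simp: PiE_iff)
    have r: "restrict (cube_vertex n) {i} = y \<longleftrightarrow> vertex_bit i n = y i" for n
    proof
      assume "vertex_bit i n = y i"
      then show "restrict (cube_vertex n) {i} = y"
        using True cube_vertex_apply[OF i, of n] unfolding configs_def
        by (intro PiE_ext[of _ "{i}" "\<lambda>_. {0, 1}"]) (auto simp: PiE_iff)
    qed (use cube_vertex_apply[OF i, of n] in auto)
    have "marginal {1, 2, 3} {i} g y = (\<Sum>x\<in>configs {1, 2, 3}. if restrict x {i} = y then g x else 0)"
      unfolding marginal_def using True finite_configs[of "{1, 2, 3::nat}"] by (simp add: sum.inter_filter)
    also have "\<dots> = (\<Sum>n<8. if restrict (cube_vertex n) {i} = y then g (cube_vertex n) else 0)"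
      by (rule sum.reindex_bij_betw[OF bij_cube_vertex, symmetric])
    also have "\<dots> = (\<Sum>n<8. if vertex_bit i n = y i then k ! n else 0)"
      unfolding r k(2) by (rule sum.cong) (auto simp: cube_table_vertex)
    also have "\<dots> = 0" using \<open>same_marg (nth k) (\<lambda>_. 0)\<close>[unfolded same_marg_def, rule_format, OF i yi] by simp
    finally show ?thesis .
  qed (simp add: marginal_def)
  then show "marginal {1, 2, 3} {i} g = 0" by (simp add: fun_eq_iff)
next
  fix B :: "(nat set \<Rightarrow> (nat \<Rightarrow> nat) \<Rightarrow> int) set"
  assume "finite B \<and> B \<noteq> {} \<and> (\<Inter>b\<in>B. \<xi> ` fiber star3 b) \<noteq> {}"
  then show "connects PF_moves (\<Inter>b\<in>B. \<xi> ` fiber star3 b)" using pf_connects by blast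
qed

lemma moves_degree_PF_moves: "moves_degree PF_moves = 4"
proof -
  have "(\<Sum>n<8. nat (g ! n)) \<le> 4" if "g \<in> set moves" for g
  proof -
    have "\<forall>g\<in>set moves. (\<Sum>n<8. nat (g ! n)) \<le> 4"
      unfolding moves_def both_signs_def half_quadrics_def half_quartics_def sum8 by simp
    then show ?thesis using that by blast
  qed
  then have le: "d \<le> 4" if "d \<in> insert 0 (deg ` PF_moves)" for d
    using that unfolding PF_moves_def by (auto simp: deg_cube_table)
  let ?g = "[1, 1, 1, 1, -1, -1, -1, -1] :: int list"
  have "?g \<in> set moves"
    unfolding moves_def both_signs_def half_quartics_def by simp
  then have "deg (cube_table (nth ?g)) \<in> deg ` PF_moves" unfolding PF_moves_def by blast
  moreover have "deg (cube_table (nth ?g)) = 4" by (simp add: deg_cube_table sum8)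
  ultimately have "4 \<in> insert 0 (deg ` PF_moves)" by simp
  moreover have "finite (insert 0 (deg ` PF_moves))" unfolding PF_moves_def by simp
  ultimately show ?thesis
    unfolding moves_degree_def by (metis (no_types, lifting) Max_eqI le)
qed

text \<open>The lifting consists of the pairs \<open>(m, g - m)\<close> with \<open>m\<close>
  irreducible. As \<open>irreducible_lift\<close> looks only at the indices below 8, the remaining
  values of the parameter are set to 0, which leaves finitely many parameters.\<close>

lemma lifting_exists:
  assumes g: "g \<in> set moves"
  shows "is_lifting (cube_table (nth g)) {m. \<exists>a. m = star_table a (\<lambda>n. g ! n - a n) \<and>
      irreducible_lift (nth g) a \<and> (\<forall>n\<ge>8. a n = 0)}" (is "is_lifting _ ?L")
  unfolding is_lifting_def
proof (intro conjI ballI allI impI)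
  \<comment> \<open>The range comes from \<open>irreducible_lift_bound\<close>: both
    \<open>a n\<close> and \<open>g ! n - a n\<close> are at most one more than the positive part of
    \<open>g ! n\<close>, and \<open>g ! n\<close> lies between -1 and 1.\<close>
  have "finite {a. \<forall>n. (n \<in> {..<8} \<longrightarrow> a n \<in> {- 2..2 :: int}) \<and> (n \<notin> {..<8 :: nat} \<longrightarrow> a n = 0)}"
    by (rule finite_set_of_finite_funs) simp_all
  moreover have "{a. irreducible_lift (nth g) a \<and> (\<forall>n\<ge>8. a n = 0)} \<subseteq>
      {a. \<forall>n. (n \<in> {..<8} \<longrightarrow> a n \<in> {- 2..2 :: int}) \<and> (n \<notin> {..<8 :: nat} \<longrightarrow> a n = 0)}"
  proof (intro subsetI CollectI conjI allI impI)
    fix a :: "nat \<Rightarrow> int" and n :: nat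
    assume a: "a \<in> {a. irreducible_lift (nth g) a \<and> (\<forall>n\<ge>8. a n = 0)}"
    show "a n = 0" if "n \<notin> {..<8}" using a that by auto
    show "a n \<in> {- 2..2}" if "n \<in> {..<8}"
      using irreducible_lift_bound(1)[OF g, of a] a that moves_abs_le[rule_format, OF g, of n] by force
  qed
  ultimately have "finite {a. irreducible_lift (nth g) a \<and> (\<forall>n\<ge>8. a n = 0)}" by (rule rev_finite_subset)
  moreover have "?L = (\<lambda>a. star_table a (\<lambda>n. g ! n - a n)) ` {a. irreducible_lift (nth g) a \<and> (\<forall>n\<ge>8. a n = 0)}"
    by blast
  ultimately show "finite ?L" by simp
  have g0: "same_marg (nth g) (\<lambda>_. 0)" using moves_same_marg g by blast
  have zero: "hierarchical_map star3 (star_table (\<lambda>_. 0) (\<lambda>_. 0)) = (\<lambda>F\<in>facets star3. 0)"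
  proof -
    have "star_table (\<lambda>_. 0) (\<lambda>_. 0) = (\<lambda>_. 0)" by (rule HOL.ext) (auto simp: star_table_def intro!: sum.neutral)
    then show ?thesis by (simp add: hierarchical_map_def marginal_def zero_fun_def restrict_eq_iff cong: if_cong)
  qed
  show "?L \<subseteq> hierarchical_kernel star3"
  proof
    fix m assume "m \<in> ?L"
    then obtain a where a: "m = star_table a (\<lambda>n. g ! n - a n)" "irreducible_lift (nth g) a" by blast
    have a0: "same_marg a (\<lambda>_. 0)" using a(2) unfolding irreducible_lift_def by blast
    have "same_marg (\<lambda>n. g ! n - a n) (\<lambda>_. 0)" using same_marg_diff[OF g0 a0] by simp
    with a0 show "m \<in> hierarchical_kernel star3"
      unfolding hierarchical_kernel_def Union_star3 zero[symmetric] a(1) star_map_eq_iff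
      by (simp add: star_table_in star_map_eq_iff)
  qed
  show "\<xi> m = cube_table (nth g)" if "m \<in> ?L" for m
    using that by (auto simp: \<xi>_star_table)
  fix b u u'
  assume u: "u \<in> \<xi> ` fiber star3 b" and u': "u' \<in> \<xi> ` fiber star3 b" and diff: "u - u' = cube_table (nth g)"
  obtain f a where f: "u = cube_table f" "b = hierarchical_map star3 (star_table a (\<lambda>n. f n - a n))"
    "\<forall>n<8. 0 \<le> a n \<and> a n \<le> f n" using u by (rule projected_fiberE)
  obtain f' where f': "u' = cube_table f'" using projected_fiberE[OF u'] by blast
  obtain a' where a': "\<forall>n<8. 0 \<le> a' n \<and> a' n \<le> f' n" "same_marg a' a" "same_marg (\<lambda>n. f' n - a' n) (\<lambda>n. f n - a n)"
    using u' unfolding f' f(2) projected_fiber_iff by blast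
  have ff: "\<forall>n<8. f n - f' n = g ! n"
    using diff unfolding f(1) f' cube_table_diff cube_table_eq_iff .
  obtain x x' where x: "\<forall>n<8. 0 \<le> x n \<and> x n \<le> f n" "\<forall>n<8. 0 \<le> x' n \<and> x' n \<le> f' n"
    "same_marg x a" "same_marg x' a" "irreducible_lift (nth g) (\<lambda>n. x n - x' n)"
    using ex_irreducible_lift[OF g f(3) a'(1,2) ff] .
  have sf: "same_marg f' f" using same_marg_add[OF a'(2,3)] by simp
  let ?v = "star_table x (\<lambda>n. f n - x n)" and ?v' = "star_table x' (\<lambda>n. f' n - x' n)"
  let ?m = "\<lambda>n. if n < 8 then x n - x' n else 0"
  show "\<exists>v\<in>fiber star3 b. \<exists>v'\<in>fiber star3 b. \<xi> v = u \<and> \<xi> v' = u' \<and> v - v' \<in> ?L"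
  proof (rule bexI[of _ ?v], rule bexI[of _ ?v'], intro conjI)
    show "?v \<in> fiber star3 b" "?v' \<in> fiber star3 b"
      unfolding f(2) star_fiber_iff using x(1-4) same_marg_diff[OF same_marg_refl[of f] x(3)] same_marg_diff[OF sf x(4)] by auto
    show "\<xi> ?v = u" "\<xi> ?v' = u'" by (simp_all add: \<xi>_star_table f(1) f')
    have "?v - ?v' = star_table ?m (\<lambda>n. g ! n - ?m n)"
      unfolding star_table_diff
      by (rule star_table_eqI[OF star_table_in]) (use ff in \<open>auto simp: star_table_vertex\<close>)
    moreover have "irreducible_lift (nth g) ?m"
      using x(5) unfolding irreducible_lift_def reducing_def reducing'_def same_marg_iff
      by (simp cong: conj_cong)
    ultimately show "?v - ?v' \<in> ?L" by force
  qed
qed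

lemma deg_lift:
  "int (deg (star_table a (\<lambda>n. g n - a n))) = (\<Sum>n<8. max (a n) 0 + max (g n - a n) 0)"
  unfolding deg_star_table by (simp add: max_def nat_0_iff split: if_splits) (rule sum.cong; simp)

lemma has_lifting_defect_PF_moves: "has_lifting_defect PF_moves 2"
  unfolding has_lifting_defect_def
proof (intro conjI allI impI)
  show "liftable_with_defect PF_moves 2"
    unfolding liftable_with_defect_def
  proof
    fix k assume "k \<in> PF_moves"
    then obtain g where g: "g \<in> set moves" "k = cube_table (nth g)" unfolding PF_moves_def by blast
    show "\<exists>L. is_lifting k L \<and> (\<forall>m\<in>L. int (deg m) \<le> int (deg k) + 2)"
    proof (intro exI conjI ballI)
      show "is_lifting k {m. \<exists>a. m = star_table a (\<lambda>n. g ! n - a n) \<and>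
          irreducible_lift (nth g) a \<and> (\<forall>n\<ge>8. a n = 0)}"
        unfolding g(2) by (rule lifting_exists[OF g(1)])
      fix m assume "m \<in> {m. \<exists>a. m = star_table a (\<lambda>n. g ! n - a n) \<and>
          irreducible_lift (nth g) a \<and> (\<forall>n\<ge>8. a n = 0)}"
      then obtain a where a: "m = star_table a (\<lambda>n. g ! n - a n)" "irreducible_lift (nth g) a" by blast
      have "int (deg k) = (\<Sum>n<8. max (g ! n) 0)"
        unfolding g(2) deg_cube_table int_sum by (rule sum.cong) auto
      then show "int (deg m) \<le> int (deg k) + 2"
        using irreducible_lift_bound(2)[OF g(1) a(2)] unfolding a(1) deg_lift by simp
    qed
  qed
next
  fix d assume d: "liftable_with_defect PF_moves d"
  \<comment> \<open>Replace 000, 011 by 001, 010 in the presence of 101, 100, with label marginals those of 000, 101: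
    the labelled pairs before and after are forced to be 000, 101 and 001, 100.\<close>
  let ?g = "[0, 0, -1, -1, 1, 1, 0, 0] :: int list"
  let ?f = "nth [0, 1, 0, 0, 1, 1, 1, 0] :: nat \<Rightarrow> int" and ?f' = "nth [0, 1, 1, 1, 0, 0, 1, 0] :: nat \<Rightarrow> int"
  let ?a = "nth [0, 0, 0, 0, 1, 0, 1, 0] :: nat \<Rightarrow> int" and ?c = "nth [0, 1, 0, 0, 0, 1, 0, 0] :: nat \<Rightarrow> int"
  let ?a' = "nth [0, 1, 0, 1, 0, 0, 0, 0] :: nat \<Rightarrow> int"
  let ?b = "hierarchical_map star3 (star_table ?a ?c)"
  have "?g \<in> set moves" unfolding moves_def both_signs_def half_quadrics_def by simp
  then obtain L where L: "is_lifting (cube_table (nth ?g)) L"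
    and deg_L: "\<And>m. m \<in> L \<Longrightarrow> int (deg m) \<le> int (deg (cube_table (nth ?g))) + d"
    using d unfolding liftable_with_defect_def PF_moves_def by blast
  have u: "cube_table ?f \<in> \<xi> ` fiber star3 ?b"
    unfolding projected_fiber_iff
    by (rule exI[of _ ?a]) (simp add: all8 same_marg_iff)
  have u': "cube_table ?f' \<in> \<xi> ` fiber star3 ?b"
    unfolding projected_fiber_iff
    by (rule exI[of _ ?a']) (simp add: all8 same_marg_iff)
  have "cube_table ?f - cube_table ?f' = cube_table (nth ?g)"
    unfolding cube_table_diff cube_table_eq_iff all8 by simp
  with L u u' obtain v v' where v: "v \<in> fiber star3 ?b" "\<xi> v = cube_table ?f"
    and v': "v' \<in> fiber star3 ?b" "\<xi> v' = cube_table ?f'" and vL: "v - v' \<in> L"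
    unfolding is_lifting_def by blast
  obtain x y where x: "v = star_table x y" using star_fiberE[OF v(1)] by blast
  obtain x' y' where x': "v' = star_table x' y'" using star_fiberE[OF v'(1)] by blast
  have "\<forall>n<8. 0 \<le> x n \<and> 0 \<le> y n" "same_marg x ?a" "\<forall>n<8. x n + y n = ?f n"
    using v unfolding x star_fiber_iff \<xi>_star_table cube_table_eq_iff by auto
  then have xs: "x 0 = 0 \<and> x 1 = 0 \<and> x 2 = 0 \<and> x 3 = 0 \<and> x 4 = 1 \<and> x 5 = 0 \<and> x 6 = 1 \<and> x 7 = 0"
    "y 0 = 0 \<and> y 1 = 1 \<and> y 2 = 0 \<and> y 3 = 0 \<and> y 4 = 0 \<and> y 5 = 1 \<and> y 6 = 0 \<and> y 7 = 0"
    unfolding all8 same_marg_iff by (simp; smt (verit))+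
  have "\<forall>n<8. 0 \<le> x' n \<and> 0 \<le> y' n" "same_marg x' ?a" "\<forall>n<8. x' n + y' n = ?f' n"
    using v' unfolding x' star_fiber_iff \<xi>_star_table cube_table_eq_iff by auto
  then have xs': "x' 0 = 0 \<and> x' 1 = 1 \<and> x' 2 = 0 \<and> x' 3 = 1 \<and> x' 4 = 0 \<and> x' 5 = 0 \<and> x' 6 = 0 \<and> x' 7 = 0"
    "y' 0 = 0 \<and> y' 1 = 0 \<and> y' 2 = 1 \<and> y' 3 = 0 \<and> y' 4 = 0 \<and> y' 5 = 0 \<and> y' 6 = 1 \<and> y' 7 = 0"
    unfolding all8 same_marg_iff by (simp; smt (verit))+
  have "deg (v - v') = 4" "deg (cube_table (nth ?g)) = 2"
    unfolding x x' star_table_diff deg_star_table deg_cube_table sum8 using xs xs' by simp_all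
  with deg_L[OF vL] show "2 \<le> d" by simp
qed

section \<open>Tables as families of individuals\<close>

definition tally :: "nat set \<Rightarrow> nat set \<Rightarrow> (nat \<Rightarrow> nat \<Rightarrow> nat) \<Rightarrow> (nat \<Rightarrow> nat) \<Rightarrow> int" where
  "tally I V y x = int (card {k \<in> I. restrict (y k) V = x})"

lemma card_eq_sum: "finite I \<Longrightarrow> int (card {k \<in> I. P k}) = (\<Sum>k\<in>I. if P k then 1 else 0)"
  by (simp add: sum.If_cases Int_def)

lemma restrict_in_configs: "\<forall>i\<in>V. y i \<in> {0, 1} \<Longrightarrow> restrict y V \<in> configs V"
  unfolding configs_def by (simp add: restrict_PiE_iff)

lemma tally_outside:
  assumes "\<forall>k\<in>I. \<forall>i\<in>V. y k i \<in> {0, 1}" "x \<notin> configs V"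
  shows "tally I V y x = 0"
proof -
  have "restrict (y k) V \<in> configs V" if "k \<in> I" for k
    by (rule restrict_in_configs) (use assms(1) that in blast)
  then have "{k \<in> I. restrict (y k) V = x} = {}" using assms(2) by auto
  then show ?thesis unfolding tally_def by (simp only: card.empty of_nat_0)
qed

lemma tally_in: "\<forall>k\<in>I. \<forall>i\<in>V. y k i \<in> {0, 1} \<Longrightarrow> tally I V y \<in> tables V"
  unfolding tables_def using tally_outside by blast

lemma tally_cong:
  assumes "\<And>k i. k \<in> I \<Longrightarrow> i \<in> V \<Longrightarrow> y k i = y' k i"
  shows "tally I V y = tally I V y'"
proof
  fix x
  have "restrict (y k) V = restrict (y' k) V" if "k \<in> I" for k
    using assms that unfolding restrict_eq_iff by blast
  then have "{k \<in> I. restrict (y k) V = x} = {k \<in> I. restrict (y' k) V = x}"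
    by auto
  then show "tally I V y x = tally I V y' x" unfolding tally_def by simp
qed

lemma sum_tally:
  assumes "finite I" "finite V" "\<forall>k\<in>I. \<forall>i\<in>V. y k i \<in> {0, 1}"
  shows "(\<Sum>x\<in>configs V. tally I V y x) = int (card I)"
proof -
  have "(\<Sum>x\<in>configs V. tally I V y x) = (\<Sum>x\<in>configs V. \<Sum>k\<in>I. if restrict (y k) V = x then 1 else 0)"
    unfolding tally_def card_eq_sum[OF assms(1)] ..
  also have "\<dots> = (\<Sum>k\<in>I. \<Sum>x\<in>configs V. if restrict (y k) V = x then 1 else 0)" by (rule sum.swap)
  also have "\<dots> = (\<Sum>k\<in>I. 1)"
  proof (rule sum.cong[OF refl])
    fix k assume "k \<in> I"
    then have "restrict (y k) V \<in> configs V" using assms(3) by (intro restrict_in_configs) blast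
    then show "(\<Sum>x\<in>configs V. if restrict (y k) V = x then 1 else 0) = (1 :: int)"
      using finite_configs[OF assms(2)] by (simp add: sum.delta')
  qed
  finally show ?thesis by simp
qed

text \<open>Taking a marginal amounts to forgetting coordinates of each individual; the sums over
  configurations and over individuals are interchanged.\<close>

lemma marginal_tally:
  assumes fin: "finite I" "finite V" and F: "F \<subseteq> V" and bin: "\<forall>k\<in>I. \<forall>i\<in>V. y k i \<in> {0, 1}"
  shows "marginal V F (tally I V y) = tally I F y"
proof
  fix z show "marginal V F (tally I V y) z = tally I F y z"
  proof (cases "z \<in> configs F")
    case True
    have VF: "V \<inter> F = F" using F by blast
    have "marginal V F (tally I V y) z = (\<Sum>x\<in>configs V. if restrict x F = z then tally I V y x else 0)"
      unfolding marginal_def using True finite_configs[OF fin(2)] by (simp add: sum.inter_filter)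
    also have "\<dots> = (\<Sum>x\<in>configs V. \<Sum>k\<in>I. if restrict (y k) V = x then (if restrict x F = z then 1 else 0) else 0)"
      unfolding tally_def card_eq_sum[OF fin(1)] by (intro sum.cong) (auto intro!: sum.cong sum.neutral[symmetric])
    also have "\<dots> = (\<Sum>k\<in>I. \<Sum>x\<in>configs V. if restrict (y k) V = x then (if restrict x F = z then 1 else 0) else 0)"
      by (rule sum.swap)
    also have "\<dots> = (\<Sum>k\<in>I. if restrict (y k) F = z then 1 else 0)"
    proof (rule sum.cong[OF refl])
      fix k assume "k \<in> I"
      then have "restrict (y k) V \<in> configs V" using bin by (intro restrict_in_configs) blast
      then show "(\<Sum>x\<in>configs V. if restrict (y k) V = x then (if restrict x F = z then 1 else 0) else 0) =
          (if restrict (y k) F = z then 1 else 0 :: int)"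
        using finite_configs[OF fin(2)] by (simp add: sum.delta' VF)
    qed
    finally show ?thesis unfolding tally_def card_eq_sum[OF fin(1)] .
  next
    case False
    then show ?thesis using tally_outside[of I F y z] bin F by (auto simp: marginal_def)
  qed
qed

text \<open>The individuals are the pairs of a configuration and a number below its entry,
  enumerated in some order.\<close>

lemma tally_exhaust:
  assumes V: "finite V" and u: "u \<in> tables V" "\<forall>x. 0 \<le> u x"
  obtains n y where "\<forall>k<n. \<forall>i\<in>V. y k i \<in> {0, 1 :: nat}" "u = tally {..<n} V y"
proof -
  define J where "J = Sigma (configs V) (\<lambda>x. {..<nat (u x)})"
  have "finite J" unfolding J_def using finite_configs[OF V] by blast
  then obtain h where h: "bij_betw h {0..<card J} J" using ex_bij_betw_nat_finite by blast
  define y where "y k = fst (h k)" for k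
  have yV: "y k \<in> configs V" if "k < card J" for k
  proof -
    have "h k \<in> J" using h that by (auto simp: bij_betw_def)
    then show ?thesis unfolding y_def J_def by auto
  qed
  then have yr: "restrict (y k) V = y k" if "k < card J" for k
    using that by (simp add: configs_def PiE_iff extensional_restrict)
  show ?thesis
  proof (rule that[of "card J" y])
    show bin: "\<forall>k<card J. \<forall>i\<in>V. y k i \<in> {0, 1}" using yV unfolding configs_def by blast
    show "u = tally {..<card J} V y"
    proof
      fix x show "u x = tally {..<card J} V y x"
      proof (cases "x \<in> configs V")
        case True
        have e1: "{k \<in> {..<card J}. restrict (y k) V = x} = {k \<in> {0..<card J}. fst (h k) = x}"
          using yr unfolding y_def by auto
        have e2: "bij_betw h {k \<in> {0..<card J}. fst (h k) = x} {p \<in> J. fst p = x}"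
        proof (rule bij_betw_imageI)
          show "inj_on h {k \<in> {0..<card J}. fst (h k) = x}"
            by (rule inj_on_subset[of _ "{0..<card J}"]) (use h in \<open>auto simp: bij_betw_def\<close>)
          have "h ` A = B \<Longrightarrow> h ` {k \<in> A. P (h k)} = {p \<in> B. P p}" for A B P by blast
          from this[of "{0..<card J}" J "\<lambda>p. fst p = x"]
          show "h ` {k \<in> {0..<card J}. fst (h k) = x} = {p \<in> J. fst p = x}"
            using h unfolding bij_betw_def by simp
        qed
        have e3: "{p \<in> J. fst p = x} = {x} \<times> {..<nat (u x)}" unfolding J_def using True by auto
        have "card {k \<in> {..<card J}. restrict (y k) V = x} = card ({x} \<times> {..<nat (u x)})"
          unfolding e1 bij_betw_same_card[OF e2] e3 ..
        then have "card {k \<in> {..<card J}. restrict (y k) V = x} = nat (u x)"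
          by (simp add: card_cartesian_product_singleton)
        then show ?thesis unfolding tally_def using u(2) by simp
      next
        case False
        then show ?thesis using u(1) tally_outside[of "{..<card J}" V y x] bin unfolding tables_def by auto
      qed
    qed
  qed
qed

text \<open>All kernel vectors of bounded degree serve as the Markov basis, so that only
  reachability remains to be shown. Since \<open>deg\<close> sees just the positive part, both signs
  are bounded; this bounds every entry and yields finiteness.\<close>

definition small_moves :: "nat set set \<Rightarrow> nat \<Rightarrow> ((nat \<Rightarrow> nat) \<Rightarrow> int) set" where
  "small_moves \<Gamma> D = {m \<in> hierarchical_kernel \<Gamma>. deg m \<le> D \<and> deg (- m) \<le> D}"

lemma finite_support_tables:
  assumes "finite V" "m \<in> tables V"
  shows "finite {x. 0 < m x}"
  by (rule finite_subset[OF _ finite_configs[OF assms(1)]]) (use assms(2) in \<open>force simp: tables_def\<close>)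

lemma le_deg:
  assumes "finite V" "m \<in> tables V"
  shows "m x \<le> int (deg m)"
proof (cases "0 < m x")
  case True
  then have "nat (m x) \<le> deg m"
    unfolding deg_def by (intro member_le_sum) (use finite_support_tables[OF assms] in auto)
  then show ?thesis by simp
qed simp

lemma finite_small_moves:
  assumes "finite (\<Union>\<Gamma>)"
  shows "finite (small_moves \<Gamma> D)"
proof (rule finite_subset)
  show "finite {m. \<forall>x. (x \<in> configs (\<Union>\<Gamma>) \<longrightarrow> m x \<in> {- int D..int D}) \<and> (x \<notin> configs (\<Union>\<Gamma>) \<longrightarrow> m x = 0)}"
    by (rule finite_set_of_finite_funs) (use finite_configs[OF assms] in auto)
  show "small_moves \<Gamma> D \<subseteq>
     {m. \<forall>x. (x \<in> configs (\<Union>\<Gamma>) \<longrightarrow> m x \<in> {- int D..int D}) \<and> (x \<notin> configs (\<Union>\<Gamma>) \<longrightarrow> m x = 0)}"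
  proof
    fix m assume m: "m \<in> small_moves \<Gamma> D"
    then have t: "m \<in> tables (\<Union>\<Gamma>)" "- m \<in> tables (\<Union>\<Gamma>)"
      unfolding small_moves_def hierarchical_kernel_def tables_def by auto
    have "m x \<le> int D \<and> - int D \<le> m x" for x
      using le_deg[OF assms t(1), of x] le_deg[OF assms t(2), of x] m unfolding small_moves_def by auto
    then show "m \<in> {m. \<forall>x. (x \<in> configs (\<Union>\<Gamma>) \<longrightarrow> m x \<in> {- int D..int D}) \<and> (x \<notin> configs (\<Union>\<Gamma>) \<longrightarrow> m x = 0)}"
      using t(1) unfolding tables_def by auto
  qed
qed

lemma moves_degree_le:
  assumes "finite M" "\<And>m. m \<in> M \<Longrightarrow> deg m \<le> D"
  shows "moves_degree M \<le> D"
  unfolding moves_degree_def using assms by auto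

definition fiber_steps :: "nat set set \<Rightarrow> nat \<Rightarrow> _ \<Rightarrow> (((nat \<Rightarrow> nat) \<Rightarrow> int) \<times> ((nat \<Rightarrow> nat) \<Rightarrow> int)) set" where
  "fiber_steps \<Gamma> D b = {(v, v'). v \<in> fiber \<Gamma> b \<and> v' \<in> fiber \<Gamma> b \<and>
     v - v' \<in> small_moves \<Gamma> D \<union> uminus ` small_moves \<Gamma> D}"

lemma markov_basis_small_moves:
  assumes "finite (\<Union>\<Gamma>)" "\<And>b v v'. v \<in> fiber \<Gamma> b \<Longrightarrow> v' \<in> fiber \<Gamma> b \<Longrightarrow> (v, v') \<in> (fiber_steps \<Gamma> D b)\<^sup>*"
  shows "markov_basis \<Gamma> (small_moves \<Gamma> D)" "moves_degree (small_moves \<Gamma> D) \<le> D"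
proof -
  show "markov_basis \<Gamma> (small_moves \<Gamma> D)"
    unfolding markov_basis_def connects_def
    using assms(2) finite_small_moves[OF assms(1)] unfolding fiber_steps_def
    by (auto simp: small_moves_def)
  show "moves_degree (small_moves \<Gamma> D) \<le> D"
    by (rule moves_degree_le[OF finite_small_moves[OF assms(1)]]) (simp add: small_moves_def)
qed

text \<open>Individuals outside \<open>C\<close> contribute equally to both tallies, so the positive
  part of the difference is dominated by the tally of \<open>C\<close> alone.\<close>

lemma deg_tally_diff:
  assumes fin: "finite I" "finite V" and bin: "\<forall>k\<in>I. \<forall>i\<in>V. y k i \<in> {0, 1}" "\<forall>k\<in>I. \<forall>i\<in>V. y' k i \<in> {0, 1}"
    and C: "C \<subseteq> I" "\<And>k i. k \<in> I - C \<Longrightarrow> i \<in> V \<Longrightarrow> y k i = y' k i"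
  shows "deg (tally I V y - tally I V y') \<le> card C"
proof -
  have finC: "finite C" "finite (I - C)" using fin(1) C(1) finite_subset by auto
  have split: "tally I V z x = tally (I - C) V z x + tally C V z x" for z x
  proof -
    have e: "{k \<in> I. restrict (z k) V = x} = {k \<in> I - C. restrict (z k) V = x} \<union> {k \<in> C. restrict (z k) V = x}"
      using C(1) by auto
    have "card {k \<in> I. restrict (z k) V = x} = card {k \<in> I - C. restrict (z k) V = x} + card {k \<in> C. restrict (z k) V = x}"
      unfolding e by (rule card_Un_disjoint) (use finC in auto)
    then show ?thesis unfolding tally_def by simp
  qed
  have "tally (I - C) V y = tally (I - C) V y'" by (rule tally_cong) (use C(2) in auto)
  then have le: "(tally I V y - tally I V y') x \<le> tally C V y x" for x
  proof -
    assume eq: "tally (I - C) V y = tally (I - C) V y'"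
    have "0 \<le> tally C V y' x" by (simp add: tally_def)
    then show ?thesis using split[of y x] split[of y' x] fun_cong[OF eq, of x] by simp
  qed
  have binC: "\<forall>k\<in>C. \<forall>i\<in>V. y k i \<in> {0, 1}" using bin(1) C(1) by blast
  have "int (deg (tally I V y - tally I V y')) = (\<Sum>x | 0 < (tally I V y - tally I V y') x. (tally I V y - tally I V y') x)"
    unfolding deg_def int_sum by (rule sum.cong) auto
  also have "\<dots> \<le> (\<Sum>x | 0 < (tally I V y - tally I V y') x. tally C V y x)"
    by (rule sum_mono) (rule le)
  also have "\<dots> \<le> (\<Sum>x\<in>configs V. tally C V y x)"
  proof (rule sum_mono2)
    show "finite (configs V)" by (rule finite_configs[OF fin(2)])
    show "{x. 0 < (tally I V y - tally I V y') x} \<subseteq> configs V"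
      using tally_outside[OF bin(1)] tally_outside[OF bin(2)] by fastforce
  qed (simp add: tally_def)
  also have "\<dots> = int (card C)" by (rule sum_tally[OF finC(1) fin(2) binC])
  finally show ?thesis by simp
qed

lemma marginal_diff: "marginal V F (u - v) = marginal V F u - marginal V F v"
  by (rule HOL.ext) (simp add: marginal_def sum_subtractf)

lemma fiber_diff_in_kernel:
  assumes "u \<in> fiber \<Gamma> b" "v \<in> fiber \<Gamma> b"
  shows "u - v \<in> hierarchical_kernel \<Gamma>"
proof -
  have t: "u \<in> tables (\<Union>\<Gamma>)" "v \<in> tables (\<Union>\<Gamma>)" "hierarchical_map \<Gamma> u = hierarchical_map \<Gamma> v"
    using assms unfolding fiber_def by auto
  have "marginal (\<Union>\<Gamma>) F u = marginal (\<Union>\<Gamma>) F v" if "F \<in> facets \<Gamma>" for F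
    using t(3) that unfolding hierarchical_map_def restrict_eq_iff by blast
  then have "hierarchical_map \<Gamma> (u - v) = (\<lambda>F\<in>facets \<Gamma>. 0)"
    unfolding hierarchical_map_def restrict_eq_iff marginal_diff by simp
  then show ?thesis using t(1,2) unfolding hierarchical_kernel_def tables_def by simp
qed

lemma tally_step:
  assumes "finite (\<Union>\<Gamma>)" "finite I"
    and bin: "\<forall>k\<in>I. \<forall>i\<in>\<Union>\<Gamma>. y k i \<in> {0, 1}" "\<forall>k\<in>I. \<forall>i\<in>\<Union>\<Gamma>. y' k i \<in> {0, 1}"
    and fiber: "tally I (\<Union>\<Gamma>) y \<in> fiber \<Gamma> b" "tally I (\<Union>\<Gamma>) y' \<in> fiber \<Gamma> b"
    and C: "C \<subseteq> I" "\<And>k i. k \<in> I - C \<Longrightarrow> i \<in> \<Union>\<Gamma> \<Longrightarrow> y k i = y' k i" "card C \<le> D"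
  shows "(tally I (\<Union>\<Gamma>) y, tally I (\<Union>\<Gamma>) y') \<in> fiber_steps \<Gamma> D b"
proof -
  have "deg (tally I (\<Union>\<Gamma>) y - tally I (\<Union>\<Gamma>) y') \<le> D"
    using deg_tally_diff[OF assms(2,1) bin C(1,2)] C(3) by simp
  moreover have "deg (tally I (\<Union>\<Gamma>) y' - tally I (\<Union>\<Gamma>) y) \<le> D"
    using deg_tally_diff[OF assms(2,1) bin(2,1) C(1)] C(2,3) by fastforce
  ultimately show ?thesis
    using fiber fiber_diff_in_kernel[OF fiber] unfolding fiber_steps_def small_moves_def by simp
qed

section \<open>Individuals with cube vertices and labels\<close>

text \<open>Individual \<open>k\<close> has cube vertex \<open>\<tau> k\<close> and label \<open>L k w\<close> at the node \<open>w\<close>.\<close>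

definition individual :: "(nat \<Rightarrow> nat) \<Rightarrow> (nat \<Rightarrow> nat \<Rightarrow> nat) \<Rightarrow> nat \<Rightarrow> nat \<Rightarrow> nat" where
  "individual \<tau> L k i = (if i \<in> {1, 2, 3} then vertex_bit i (\<tau> k) else L k i)"

definition valid :: "nat set \<Rightarrow> (nat \<Rightarrow> nat) \<Rightarrow> (nat \<Rightarrow> nat \<Rightarrow> nat) \<Rightarrow> bool" where
  "valid I \<tau> L \<longleftrightarrow> (\<forall>k\<in>I. \<tau> k < 8) \<and> (\<forall>k\<in>I. \<forall>i. L k i \<in> {0, 1})"

definition type_count :: "nat set \<Rightarrow> (nat \<Rightarrow> nat) \<Rightarrow> nat \<Rightarrow> int" where
  "type_count I \<tau> n = int (card {k \<in> I. \<tau> k = n})"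

definition label_count :: "nat set \<Rightarrow> (nat \<Rightarrow> nat) \<Rightarrow> (nat \<Rightarrow> nat \<Rightarrow> nat) \<Rightarrow> nat \<Rightarrow> nat \<Rightarrow> nat \<Rightarrow> int" where
  "label_count I \<tau> L w b n = int (card {k \<in> I. \<tau> k = n \<and> L k w = b})"

lemma individual_binary: "valid I \<tau> L \<Longrightarrow> \<forall>k\<in>I. \<forall>i\<in>V. individual \<tau> L k i \<in> {0, 1}"
  unfolding individual_def valid_def using vertex_bit_binary by (metis (full_types))

lemma type_count_mono: "finite I \<Longrightarrow> A \<subseteq> I \<Longrightarrow> type_count A \<tau> n \<le> type_count I \<tau> n"
  unfolding type_count_def by (simp add: card_mono Collect_mono subset_iff)

lemma type_count_cong: "(\<And>k. k \<in> I \<Longrightarrow> \<tau> k = \<tau>' k) \<Longrightarrow> type_count I \<tau> = type_count I \<tau>'"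
proof
  fix n assume "\<And>k. k \<in> I \<Longrightarrow> \<tau> k = \<tau>' k"
  then have "{k \<in> I. \<tau> k = n} = {k \<in> I. \<tau>' k = n}" by auto
  then show "type_count I \<tau> n = type_count I \<tau>' n" unfolding type_count_def by simp
qed

lemma type_count_Un:
  assumes "finite A" "finite B" "A \<inter> B = {}"
  shows "type_count (A \<union> B) \<tau> n = type_count A \<tau> n + type_count B \<tau> n"
proof -
  have e: "{k \<in> A \<union> B. \<tau> k = n} = {k \<in> A. \<tau> k = n} \<union> {k \<in> B. \<tau> k = n}" by auto
  have "card {k \<in> A \<union> B. \<tau> k = n} = card {k \<in> A. \<tau> k = n} + card {k \<in> B. \<tau> k = n}"
    unfolding e by (rule card_Un_disjoint) (use assms in auto)
  then show ?thesis unfolding type_count_def by simp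
qed

lemma type_count_Diff:
  assumes "finite I" "A \<subseteq> I"
  shows "type_count (I - A) \<tau> n = type_count I \<tau> n - type_count A \<tau> n"
proof -
  have "finite A" using assms finite_subset by blast
  then have "type_count (A \<union> (I - A)) \<tau> n = type_count A \<tau> n + type_count (I - A) \<tau> n" using assms by (intro type_count_Un) auto
  moreover have "A \<union> (I - A) = I" using assms by blast
  ultimately show ?thesis by simp
qed

lemma label_count_eq: "label_count I \<tau> L w b = type_count {k \<in> I. L k w = b} \<tau>"
  unfolding label_count_def type_count_def by (simp add: conj_ac)

lemma label_count_nonneg: "0 \<le> label_count I \<tau> L w b n" unfolding label_count_def by simp

lemma label_count_0:
  assumes "finite I" "valid I \<tau> L"
  shows "label_count I \<tau> L w 0 n = type_count I \<tau> n - label_count I \<tau> L w 1 n"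
proof -
  have e: "{k \<in> I. L k w = 0} = I - {k \<in> I. L k w = 1}"
    using assms(2) unfolding valid_def by fastforce
  show ?thesis unfolding label_count_eq e by (rule type_count_Diff) (use assms in auto)
qed

lemma label_count_le: "finite I \<Longrightarrow> label_count I \<tau> L w b n \<le> type_count I \<tau> n"
  unfolding label_count_eq by (rule type_count_mono) auto

lemma card_by_type:
  fixes \<tau> :: "'a \<Rightarrow> nat"
  assumes "finite I" "\<forall>k\<in>I. \<tau> k < 8"
  shows "int (card {k \<in> I. P k}) = (\<Sum>n<8. int (card {k \<in> I. \<tau> k = n \<and> P k}))"
proof -
  have "(\<Sum>n<8. int (card {k \<in> I. \<tau> k = n \<and> P k})) = (\<Sum>n<8. \<Sum>k\<in>I. if \<tau> k = n \<and> P k then 1 else 0)"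
    unfolding card_eq_sum[OF assms(1)] ..
  also have "\<dots> = (\<Sum>k\<in>I. \<Sum>n<8. if \<tau> k = n \<and> P k then 1 else 0)" by (rule sum.swap)
  also have "\<dots> = (\<Sum>k\<in>I. if P k then 1 else 0)"
  proof (rule sum.cong[OF refl])
    fix k assume "k \<in> I"
    then have "\<tau> k < 8" using assms(2) by blast
    then show "(\<Sum>n<8. if \<tau> k = n \<and> P k then 1 else 0) = (if P k then 1 else 0 :: int)"
      by (cases "P k") (simp_all add: sum.delta')
  qed
  finally show ?thesis unfolding card_eq_sum[OF assms(1)] ..
qed

lemma sum_type_count: "finite I \<Longrightarrow> \<forall>k\<in>I. \<tau> k < 8 \<Longrightarrow> (\<Sum>n<8. type_count I \<tau> n) = int (card I)"
  using card_by_type[of I \<tau> "\<lambda>_. True"] unfolding type_count_def by simp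

lemma tally_edge:
  assumes "finite I" "valid I \<tau> L" and i: "i \<in> {1, 2, 3}" and w: "w \<notin> {1, 2, 3}" and z: "z \<in> configs {i, w}"
  shows "tally I {i, w} (individual \<tau> L) z = (\<Sum>n<8. if vertex_bit i n = z i then label_count I \<tau> L w (z w) n else 0)"
proof -
  have "restrict (individual \<tau> L k) {i, w} = z \<longleftrightarrow> vertex_bit i (\<tau> k) = z i \<and> L k w = z w" for k
  proof -
    have "restrict (individual \<tau> L k) {i, w} = z \<longleftrightarrow> restrict (individual \<tau> L k) {i, w} = restrict z {i, w}"
      using z unfolding configs_def by (simp add: PiE_iff extensional_restrict)
    also have "\<dots> \<longleftrightarrow> vertex_bit i (\<tau> k) = z i \<and> L k w = z w"
      unfolding restrict_eq_iff individual_def using i w by auto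
    finally show ?thesis .
  qed
  then have "tally I {i, w} (individual \<tau> L) z = int (card {k \<in> I. vertex_bit i (\<tau> k) = z i \<and> L k w = z w})"
    unfolding tally_def by simp
  also have "\<dots> = (\<Sum>n<8. int (card {k \<in> I. \<tau> k = n \<and> vertex_bit i (\<tau> k) = z i \<and> L k w = z w}))"
    by (rule card_by_type) (use assms in \<open>auto simp: valid_def\<close>)
  also have "\<dots> = (\<Sum>n<8. if vertex_bit i n = z i then label_count I \<tau> L w (z w) n else 0)"
  proof (rule sum.cong[OF refl])
    fix n
    have "{k \<in> I. \<tau> k = n \<and> vertex_bit i (\<tau> k) = z i \<and> L k w = z w} =
        (if vertex_bit i n = z i then {k \<in> I. \<tau> k = n \<and> L k w = z w} else {})" by auto
    then show "int (card {k \<in> I. \<tau> k = n \<and> vertex_bit i (\<tau> k) = z i \<and> L k w = z w}) =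
        (if vertex_bit i n = z i then label_count I \<tau> L w (z w) n else 0)" unfolding label_count_def by simp
  qed
  finally show ?thesis .
qed

lemma tally_cube:
  assumes "valid I \<tau> L"
  shows "tally I {1, 2, 3} (individual \<tau> L) = cube_table (type_count I \<tau>)"
proof (rule cube_table_eqI)
  show "tally I {1, 2, 3} (individual \<tau> L) \<in> tables {1, 2, 3}" by (rule tally_in[OF individual_binary[OF assms]])
  fix n :: nat assume n: "n < 8"
  have "restrict (individual \<tau> L k) {1, 2, 3} = cube_vertex (\<tau> k)" for k
    unfolding cube_vertex_def restrict_eq_iff individual_def by simp
  then have "{k \<in> I. restrict (individual \<tau> L k) {1, 2, 3} = cube_vertex n} = {k \<in> I. \<tau> k = n}"
    using assms cube_vertex_inject n unfolding valid_def by auto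
  then show "tally I {1, 2, 3} (individual \<tau> L) (cube_vertex n) = type_count I \<tau> n" unfolding tally_def type_count_def by simp
qed

text \<open>The three edges at \<open>w\<close> form a three-star, and its statistics are the
  marginals of the label counts, as in \<open>star_map_eq_iff\<close>.\<close>

lemma tally_edge_eq_iff:
  assumes fin: "finite I" "finite I'" and v: "valid I \<tau> L" "valid I' \<tau>' L'" and w: "w \<notin> {1, 2, 3}"
  shows "(\<forall>i\<in>{1, 2, 3}. tally I {i, w} (individual \<tau> L) = tally I' {i, w} (individual \<tau>' L')) \<longleftrightarrow>
    (\<forall>b\<in>{0, 1}. same_marg (label_count I \<tau> L w b) (label_count I' \<tau>' L' w b))"
proof
  assume *: "\<forall>i\<in>{1, 2, 3}. tally I {i, w} (individual \<tau> L) = tally I' {i, w} (individual \<tau>' L')"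
  show "\<forall>b\<in>{0, 1}. same_marg (label_count I \<tau> L w b) (label_count I' \<tau>' L' w b)"
    unfolding same_marg_def
  proof (intro ballI)
    fix b i p :: nat assume i: "i \<in> {1, 2, 3}" and bp: "b \<in> {0, 1}" "p \<in> {0, 1}"
    have "i \<noteq> w" using i w by blast
    then obtain z where z: "z \<in> configs {i, w}" "z i = p" "z w = b" using configs_pair bp by metis
    from *[rule_format, OF i] have "tally I {i, w} (individual \<tau> L) z = tally I' {i, w} (individual \<tau>' L') z" by simp
    then show "(\<Sum>n<8. if vertex_bit i n = p then label_count I \<tau> L w b n else 0) =
        (\<Sum>n<8. if vertex_bit i n = p then label_count I' \<tau>' L' w b n else 0)"
      unfolding tally_edge[OF fin(1) v(1) i w z(1)] tally_edge[OF fin(2) v(2) i w z(1)] z(2,3) .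
  qed
next
  assume s: "\<forall>b\<in>{0, 1}. same_marg (label_count I \<tau> L w b) (label_count I' \<tau>' L' w b)"
  show "\<forall>i\<in>{1, 2, 3}. tally I {i, w} (individual \<tau> L) = tally I' {i, w} (individual \<tau>' L')"
  proof (intro ballI HOL.ext)
    fix i z assume i: "i \<in> {1, 2, 3 :: nat}"
    show "tally I {i, w} (individual \<tau> L) z = tally I' {i, w} (individual \<tau>' L') z"
    proof (cases "z \<in> configs {i, w}")
      case True
      then have z: "z i \<in> {0, 1}" "z w \<in> {0, 1}" unfolding configs_def by (auto simp: PiE_iff)
      show ?thesis
        unfolding tally_edge[OF fin(1) v(1) i w True] tally_edge[OF fin(2) v(2) i w True]
        using s[rule_format, OF z(2), unfolded same_marg_def, rule_format, OF i z(1)] .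
    next
      case False
      then show ?thesis using tally_outside[OF individual_binary[OF v(1)] False] tally_outside[OF individual_binary[OF v(2)] False] by simp
    qed
  qed
qed

section \<open>Facets of \<open>K3 N\<close> and of its codimension-zero product\<close>

definition nodes :: "nat \<Rightarrow> nat set" where
  "nodes N = {1, 2, 3} \<union> wnode ` {1..N}"

definition K3_edges :: "nat \<Rightarrow> nat set set" where
  "K3_edges N = {{i, wnode j} |i j. i \<in> {1, 2, 3} \<and> j \<in> {1..N}}"

lemma wnode_notin: "1 \<le> j \<Longrightarrow> wnode j \<notin> {1, 2, 3}" unfolding wnode_def by auto

lemma Union_K3: "\<Union>(K3 N) = nodes N"
proof
  show "\<Union>(K3 N) \<subseteq> nodes N"
  proof (rule Union_least)
    fix F assume "F \<in> K3 N"
    then show "F \<subseteq> nodes N" unfolding K3_def graph_complex_def nodes_def by auto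
  qed
  show "nodes N \<subseteq> \<Union>(K3 N)"
  proof
    fix i assume "i \<in> nodes N"
    then have "{i} \<in> K3 N" unfolding K3_def graph_complex_def nodes_def by auto
    then show "i \<in> \<Union>(K3 N)" by blast
  qed
qed

lemma finite_nodes: "finite (nodes N)" unfolding nodes_def by simp

lemma K3_cases:
  assumes "F \<in> K3 N"
  obtains "F = {}" | i where "F = {i}" "i \<in> {1, 2, 3}"
    | j where "F = {wnode j}" "j \<in> {1..N}" | "F \<in> K3_edges N"
  using assms unfolding K3_def graph_complex_def K3_edges_def by blast

lemma K3_edges_subset: "K3_edges N \<subseteq> K3 N" unfolding K3_def graph_complex_def K3_edges_def by blast

lemma K3_edge_maximal:
  assumes E: "E \<in> K3_edges N" and F: "F \<in> K3 N \<union> Pow {1, 2, 3}" and sub: "E \<subseteq> F"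
  shows "F = E"
proof -
  obtain i j where ij: "E = {i, wnode j}" "i \<in> {1, 2, 3}" "j \<in> {1..N}" using E unfolding K3_edges_def by blast
  then have w: "wnode j \<notin> {1, 2, 3}" using wnode_notin by auto
  then have "F \<notin> Pow {1, 2, 3}" using sub ij(1) by blast
  then have "F \<in> K3 N" using F by blast
  moreover have "F \<noteq> {}" using sub ij(1) by blast
  moreover have "F \<noteq> {x}" for x using sub ij w by blast
  ultimately have "F \<in> K3_edges N" using K3_cases by metis
  then obtain i' j' where ij': "F = {i', wnode j'}" "i' \<in> {1, 2, 3}" "j' \<in> {1..N}" unfolding K3_edges_def by blast
  then have w': "wnode j' \<notin> {1, 2, 3}" using wnode_notin by auto
  have "i = i' \<or> i = wnode j'" "wnode j = i' \<or> wnode j = wnode j'"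
    using sub unfolding ij(1) ij'(1) by simp_all
  then have "i = i'" "wnode j = wnode j'" using ij(2) ij'(2) w w' by metis+
  then show ?thesis using ij(1) ij'(1) by simp
qed

text \<open>For \<open>N \<ge> 1\<close> every node lies on an edge. For \<open>N = 0\<close> the
  single nodes 1, 2, 3 would be the facets.\<close>

lemma K3_extend:
  assumes "1 \<le> N" "F \<in> K3 N"
  obtains E where "E \<in> K3_edges N" "F \<subseteq> E"
proof -
  have 1: "{1, wnode 1} \<in> K3_edges N" using assms(1) unfolding K3_edges_def by auto
  from assms(2) show ?thesis
  proof (cases rule: K3_cases)
    case (2 i)
    then have "{i, wnode 1} \<in> K3_edges N" using assms(1) unfolding K3_edges_def by auto
    then show ?thesis using that 2 by blast
  next
    case (3 j)
    then have "{1, wnode j} \<in> K3_edges N" unfolding K3_edges_def by auto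
    then show ?thesis using that 3 by blast
  qed (use 1 that in blast)+
qed

lemma facets_K3: "1 \<le> N \<Longrightarrow> facets (K3 N) = K3_edges N"
proof
  assume N: "1 \<le> N"
  show "facets (K3 N) \<subseteq> K3_edges N"
  proof
    fix F assume F: "F \<in> facets (K3 N)"
    then obtain E where "E \<in> K3_edges N" "F \<subseteq> E" using K3_extend[OF N] unfolding facets_def by blast
    then show "F \<in> K3_edges N" using F K3_edges_subset unfolding facets_def by blast
  qed
  show "K3_edges N \<subseteq> facets (K3 N)"
    using K3_edge_maximal K3_edges_subset unfolding facets_def by blast
qed

lemma facets_K3_Un: "1 \<le> N \<Longrightarrow> facets (K3 N \<union> Pow {1, 2, 3}) = insert {1, 2, 3} (K3_edges N)"
proof
  assume N: "1 \<le> N"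
  show "facets (K3 N \<union> Pow {1, 2, 3}) \<subseteq> insert {1, 2, 3} (K3_edges N)"
  proof
    fix F assume F: "F \<in> facets (K3 N \<union> Pow {1, 2, 3})"
    show "F \<in> insert {1, 2, 3} (K3_edges N)"
    proof (cases "F \<in> K3 N")
      case True
      then obtain E where "E \<in> K3_edges N" "F \<subseteq> E" using K3_extend[OF N] by blast
      then show ?thesis using F K3_edges_subset unfolding facets_def by blast
    next
      case False
      then have "F \<subseteq> {1, 2, 3}" using F unfolding facets_def by blast
      then show ?thesis using F unfolding facets_def by blast
    qed
  qed
  have "{1, 2, 3} \<in> facets (K3 N \<union> Pow {1, 2, 3})"
    unfolding facets_def
  proof (intro CollectI conjI ballI impI)
    fix F assume F: "F \<in> K3 N \<union> Pow {1, 2, 3}" "{1, 2, 3} \<subseteq> F"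
    have not_sub: "\<not> {1, 2, 3} \<subseteq> {x}" for x :: nat by auto
    have "F \<notin> K3_edges N"
    proof
      assume "F \<in> K3_edges N"
      then obtain i j where ij: "F = {i, wnode j}" "j \<in> {1..N}" unfolding K3_edges_def by blast
      then have w: "wnode j \<notin> {1, 2, 3}" using wnode_notin by simp
      have "{1, 2, 3} \<subseteq> insert (wnode j) {i}" using F(2) unfolding ij(1) insert_commute[of i] .
      then have "{1, 2, 3} \<subseteq> {i}" unfolding subset_insert[OF w] .
      then show False using not_sub by blast
    qed
    moreover have "F \<noteq> {}" using F(2) by blast
    moreover have "F \<noteq> {x}" for x using F(2) not_sub by blast
    ultimately have "F \<notin> K3 N" using K3_cases by metis
    then show "F = {1, 2, 3}" using F by blast
  qed simp
  moreover have "K3_edges N \<subseteq> facets (K3 N \<union> Pow {1, 2, 3})"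
  proof
    fix E assume E: "E \<in> K3_edges N"
    then have "E \<in> K3 N \<union> Pow {1, 2, 3}" using K3_edges_subset by blast
    then show "E \<in> facets (K3 N \<union> Pow {1, 2, 3})"
      unfolding facets_def using K3_edge_maximal[OF E] by simp
  qed
  ultimately show "insert {1, 2, 3} (K3_edges N) \<subseteq> facets (K3 N \<union> Pow {1, 2, 3})" by simp
qed

section \<open>Selecting individuals and assigning cube vertices with prescribed counts\<close>

lemma choose_subset:
  assumes "finite P" "\<forall>n<8. 0 \<le> e n \<and> e n \<le> type_count P \<tau> n"
  obtains K where "K \<subseteq> P" "\<forall>k\<in>K. \<tau> k < (8 :: nat)" "\<forall>n<8. type_count K \<tau> n = e n"
proof -
  have "\<exists>K\<subseteq>{k \<in> P. \<tau> k = n}. int (card K) = e n" if n: "n < 8" for n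
  proof -
    have "nat (e n) \<le> card {k \<in> P. \<tau> k = n}" "0 \<le> e n" using assms(2) n unfolding type_count_def by auto
    then obtain K where "K \<subseteq> {k \<in> P. \<tau> k = n}" "card K = nat (e n)"
      by (meson obtain_subset_with_card_n)
    then show ?thesis using \<open>0 \<le> e n\<close> by (intro exI[of _ K]) simp
  qed
  then obtain K where K: "\<And>n. n < 8 \<Longrightarrow> K n \<subseteq> {k \<in> P. \<tau> k = n} \<and> int (card (K n)) = e n" by metis
  show ?thesis
  proof (rule that[of "\<Union>n<8. K n"])
    show "(\<Union>n<8. K n) \<subseteq> P" "\<forall>k\<in>\<Union>n<8. K n. \<tau> k < 8" using K by blast+
    show "\<forall>n<8. type_count (\<Union>n<8. K n) \<tau> n = e n"
    proof (intro allI impI)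
      fix n :: nat assume n: "n < 8"
      then have "{k \<in> \<Union>n<8. K n. \<tau> k = n} = K n" using K by blast
      then show "type_count (\<Union>n<8. K n) \<tau> n = e n" unfolding type_count_def using K n by simp
    qed
  qed
qed

lemma retype:
  assumes "finite R" "\<forall>n<8. 0 \<le> c n" "(\<Sum>n<8. c n) = int (card R)"
  obtains \<tau> where "\<forall>k\<in>R. \<tau> k < (8 :: nat)" "\<forall>n<8. type_count R \<tau> n = c n"
proof -
  define J where "J = Sigma {..<8 :: nat} (\<lambda>n. {..<nat (c n)})"
  have finJ: "finite J" unfolding J_def by blast
  have "int (card J) = (\<Sum>n<8. int (nat (c n)))" unfolding J_def by simp
  also have "\<dots> = (\<Sum>n<8. c n)" by (rule sum.cong) (use assms(2) in auto)
  finally have "card J = card R" using assms(3) by simp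
  then obtain h where h: "bij_betw h R J"
    using finite_same_card_bij[OF assms(1) finJ] by metis
  show ?thesis
  proof (rule that[of "fst \<circ> h"])
    show "\<forall>k\<in>R. (fst \<circ> h) k < 8"
    proof
      fix k assume "k \<in> R"
      then have "h k \<in> J" using h by (auto simp: bij_betw_def)
      then show "(fst \<circ> h) k < 8" unfolding J_def by auto
    qed
    show "\<forall>n<8. type_count R (fst \<circ> h) n = c n"
    proof (intro allI impI)
      fix n :: nat assume n: "n < 8"
      have gen: "h ` A = B \<Longrightarrow> h ` {k \<in> A. P (h k)} = {p \<in> B. P p}" for A B P by blast
      have im: "h ` {k \<in> R. fst (h k) = n} = {p \<in> J. fst p = n}"
        using gen[of R J "\<lambda>p. fst p = n"] h unfolding bij_betw_def by blast
      have inj: "inj_on h {k \<in> R. fst (h k) = n}"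
        by (rule inj_on_subset[of _ R]) (use h in \<open>auto simp: bij_betw_def\<close>)
      have "card {k \<in> R. fst (h k) = n} = card {p \<in> J. fst p = n}"
        unfolding im[symmetric] by (rule card_image[OF inj, symmetric])
      moreover have "{p \<in> J. fst p = n} = {n} \<times> {..<nat (c n)}" unfolding J_def using n by auto
      ultimately have "card {k \<in> R. fst (h k) = n} = nat (c n)" by (simp add: card_cartesian_product_singleton)
      then show "type_count R (fst \<circ> h) n = c n" unfolding type_count_def using assms(2) n by simp
    qed
  qed
qed

lemma ball_K3_edges: "(\<forall>F\<in>K3_edges N. P F) \<longleftrightarrow> (\<forall>j\<in>{1..N}. \<forall>i\<in>{1, 2, 3}. P {i, wnode j})"
proof (intro iffI ballI)
  fix i j assume "\<forall>F\<in>K3_edges N. P F" "j \<in> {1..N}" "i \<in> {1, 2, 3 :: nat}"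
  moreover from this have "{i, wnode j} \<in> K3_edges N" unfolding K3_edges_def by blast
  ultimately show "P {i, wnode j}" by blast
next
  fix F assume *: "\<forall>j\<in>{1..N}. \<forall>i\<in>{1, 2, 3}. P {i, wnode j}" and "F \<in> K3_edges N"
  then obtain i j where "F = {i, wnode j}" "i \<in> {1, 2, 3}" "j \<in> {1..N}" unfolding K3_edges_def by blast
  then show "P F" using * by blast
qed

section \<open>Markov bases of the \<open>K\<^sub>3\<^sub>,\<^sub>N\<close> models\<close>

text \<open>Both complexes have the same edges as facets and differ only in whether
  \<open>{1, 2, 3}\<close> is a facet, that is, whether the fiber fixes the vertex counts. Treating
  them together makes the kernel moves available in the model of \<open>K3 N\<close>.\<close>

locale K3_model =
  fixes N :: nat and \<Gamma> :: "nat set set"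
  assumes N: "1 \<le> N" and \<Gamma>: "\<Gamma> = K3 N \<or> \<Gamma> = K3 N \<union> Pow {1, 2, 3}"
begin

lemma Union_\<Gamma>: "\<Union>\<Gamma> = nodes N"
  using \<Gamma>
proof
  assume "\<Gamma> = K3 N \<union> Pow {1, 2, 3}"
  then have "\<Union>\<Gamma> = nodes N \<union> {1, 2, 3}" by (simp only: Union_Un_distrib Union_K3 Union_Pow_eq)
  then show ?thesis unfolding nodes_def by blast
qed (simp add: Union_K3)

lemma facets_\<Gamma>: "facets \<Gamma> = K3_edges N \<or> facets \<Gamma> = insert {1, 2, 3} (K3_edges N)"
  using \<Gamma> facets_K3[OF N] facets_K3_Un[OF N] by auto

definition table :: "nat set \<Rightarrow> (nat \<Rightarrow> nat) \<Rightarrow> (nat \<Rightarrow> nat \<Rightarrow> nat) \<Rightarrow> (nat \<Rightarrow> nat) \<Rightarrow> int" where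
  "table I \<tau> L = tally I (nodes N) (individual \<tau> L)"

definition same_stats where
  "same_stats I \<tau> L I' \<tau>' L' \<longleftrightarrow> (\<forall>j\<in>{1..N}. \<forall>b\<in>{0, 1}. same_marg (label_count I \<tau> L (wnode j) b) (label_count I' \<tau>' L' (wnode j) b))"

lemma same_stats_sym: "same_stats I \<tau> L I' \<tau>' L' \<Longrightarrow> same_stats I' \<tau>' L' I \<tau> L"
  unfolding same_stats_def using same_marg_sym by blast

lemma same_stats_trans:
  "same_stats I \<tau> L I' \<tau>' L' \<Longrightarrow> same_stats I' \<tau>' L' I'' \<tau>'' L'' \<Longrightarrow> same_stats I \<tau> L I'' \<tau>'' L''"
  unfolding same_stats_def using same_marg_trans by blast

lemma map_eq_iff:
  assumes fin: "finite I" "finite I'" and v: "valid I \<tau> L" "valid I' \<tau>' L'"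
  shows "hierarchical_map \<Gamma> (table I \<tau> L) = hierarchical_map \<Gamma> (table I' \<tau>' L') \<longleftrightarrow>
    same_stats I \<tau> L I' \<tau>' L' \<and> ({1, 2, 3} \<in> facets \<Gamma> \<longrightarrow> (\<forall>n<8. type_count I \<tau> n = type_count I' \<tau>' n))"
proof -
  have sub: "F \<subseteq> nodes N" if "F \<in> facets \<Gamma>" for F
    using that Union_\<Gamma> unfolding facets_def by blast
  have "hierarchical_map \<Gamma> (table I \<tau> L) = hierarchical_map \<Gamma> (table I' \<tau>' L') \<longleftrightarrow>
      (\<forall>F\<in>facets \<Gamma>. tally I F (individual \<tau> L) = tally I' F (individual \<tau>' L'))"
    unfolding hierarchical_map_def restrict_eq_iff table_def Union_\<Gamma>
    using marginal_tally[OF fin(1) finite_nodes sub individual_binary[OF v(1)]]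
      marginal_tally[OF fin(2) finite_nodes sub individual_binary[OF v(2)]] by simp
  also have "\<dots> \<longleftrightarrow> (\<forall>F\<in>K3_edges N. tally I F (individual \<tau> L) = tally I' F (individual \<tau>' L')) \<and>
      ({1, 2, 3} \<in> facets \<Gamma> \<longrightarrow> tally I {1, 2, 3} (individual \<tau> L) = tally I' {1, 2, 3} (individual \<tau>' L'))"
    using facets_\<Gamma>
  proof
    assume e: "facets \<Gamma> = K3_edges N"
    show ?thesis unfolding e by metis
  next
    assume e: "facets \<Gamma> = insert {1, 2, 3} (K3_edges N)"
    show ?thesis unfolding e by simp metis
  qed
  also have "(\<forall>F\<in>K3_edges N. tally I F (individual \<tau> L) = tally I' F (individual \<tau>' L')) \<longleftrightarrow>
      (\<forall>j\<in>{1..N}. \<forall>i\<in>{1, 2, 3}. tally I {i, wnode j} (individual \<tau> L) = tally I' {i, wnode j} (individual \<tau>' L'))"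
    by (rule ball_K3_edges)
  also have "\<dots> \<longleftrightarrow> same_stats I \<tau> L I' \<tau>' L'"
    unfolding same_stats_def
    by (rule ball_cong[OF refl]) (use tally_edge_eq_iff[OF fin v wnode_notin] in simp)
  also have "tally I {1, 2, 3} (individual \<tau> L) = tally I' {1, 2, 3} (individual \<tau>' L') \<longleftrightarrow> (\<forall>n<8. type_count I \<tau> n = type_count I' \<tau>' n)"
    unfolding tally_cube[OF v(1)] tally_cube[OF v(2)] cube_table_eq_iff ..
  finally show ?thesis .
qed

lemma table_in_fiber:
  assumes "finite I" "finite I'" "valid I \<tau> L" "valid I' \<tau>' L'" "table I \<tau> L \<in> fiber \<Gamma> b"
  shows "table I' \<tau>' L' \<in> fiber \<Gamma> b \<longleftrightarrow>
    same_stats I \<tau> L I' \<tau>' L' \<and> ({1, 2, 3} \<in> facets \<Gamma> \<longrightarrow> (\<forall>n<8. type_count I \<tau> n = type_count I' \<tau>' n))"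
proof -
  have "table I' \<tau>' L' \<in> tables (\<Union>\<Gamma>)" "\<forall>x. 0 \<le> table I' \<tau>' L' x"
    unfolding table_def Union_\<Gamma> using tally_in[OF individual_binary[OF assms(4)]] by (simp_all add: tally_def)
  then have "table I' \<tau>' L' \<in> fiber \<Gamma> b \<longleftrightarrow>
      hierarchical_map \<Gamma> (table I \<tau> L) = hierarchical_map \<Gamma> (table I' \<tau>' L')"
    using assms(5) unfolding fiber_def by auto
  then show ?thesis unfolding map_eq_iff[OF assms(1-4)] .
qed

lemma table_exhaust:
  assumes "u \<in> fiber \<Gamma> b"
  obtains n \<tau> L where "valid {..<n} \<tau> L" "u = table {..<n} \<tau> L"
proof -
  have u: "u \<in> tables (nodes N)" "\<forall>x. 0 \<le> u x" using assms unfolding fiber_def Union_\<Gamma> by auto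
  obtain n y where y: "\<forall>k<n. \<forall>i\<in>nodes N. y k i \<in> {0, 1 :: nat}" "u = tally {..<n} (nodes N) y"
    using tally_exhaust[OF finite_nodes u] by blast
  have "\<exists>m<8. \<forall>i\<in>{1, 2, 3}. vertex_bit i m = y k i" if k: "k < n" for k
  proof -
    show ?thesis
    proof (rule vertex_bit_surj[of "y k"])
      fix i :: nat assume "i \<in> {1, 2, 3}"
      then have "i \<in> nodes N" unfolding nodes_def by (rule UnI1)
      from y(1)[rule_format, OF k this] show "y k i \<in> {0, 1}" .
    next
      fix m :: nat assume "m < 8" "\<And>i. i \<in> {1, 2, 3} \<Longrightarrow> vertex_bit i m = y k i"
      then show ?thesis by blast
    qed
  qed
  then obtain \<tau> where \<tau>: "\<And>k. k < n \<Longrightarrow> \<tau> k < 8 \<and> (\<forall>i\<in>{1, 2, 3}. vertex_bit i (\<tau> k) = y k i)" by metis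
  define L where "L k i = (if i \<in> nodes N then y k i else 0)" for k i
  show ?thesis
  proof (rule that[of n \<tau> L])
    show "valid {..<n} \<tau> L" unfolding valid_def L_def using \<tau> y(1) by auto
    show "u = table {..<n} \<tau> L"
      unfolding y(2) table_def
      by (rule tally_cong) (use \<tau> in \<open>auto simp: individual_def L_def\<close>)
  qed
qed

text \<open>Only label \<open>j\<close> is corrected. Individuals with label 1 both before and after
  cancel, so those that must lose the 1 (\<open>P\<close>) and those that must gain it
  (\<open>Q\<close>) have equal marginals. By \<open>graver_pair\<close> at most three of each can
  be switched without changing the statistics, and each switched individual receives its final
  label.\<close>

lemma relabel_step:
  assumes I: "finite I" and v: "valid I \<tau> L" "valid I \<tau> L'" and j: "j \<in> {1..N}"
    and s: "same_stats I \<tau> L I \<tau> L'" and k0: "k0 \<in> I" "L k0 (wnode j) \<noteq> L' k0 (wnode j)"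
  obtains L1 C where "valid I \<tau> L1" "same_stats I \<tau> L I \<tau> L1" "C \<subseteq> I" "C \<noteq> {}" "card C \<le> 6"
    "\<And>k. k \<in> C \<Longrightarrow> L k (wnode j) \<noteq> L' k (wnode j)"
    "\<And>k i. L1 k i = (if i = wnode j \<and> k \<in> C then L' k i else L k i)"
proof -
  let ?w = "wnode j"
  define P where "P = {k \<in> I. L k ?w = 1 \<and> L' k ?w = 0}"
  define Q where "Q = {k \<in> I. L k ?w = 0 \<and> L' k ?w = 1}"
  have fin: "finite P" "finite Q" "finite {k \<in> I. L k ?w = b}" for b unfolding P_def Q_def using I by auto
  have types: "\<forall>k\<in>P. \<tau> k < 8" "\<forall>k\<in>Q. \<tau> k < 8" using v(1) unfolding P_def Q_def valid_def by auto
  have bin: "L k ?w = 0 \<or> L k ?w = 1" "L' k ?w = 0 \<or> L' k ?w = 1" if "k \<in> I" for k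
    using v that unfolding valid_def by auto
  have e1: "label_count I \<tau> L ?w 1 n - type_count P \<tau> n = type_count ({k \<in> I. L k ?w = 1} - P) \<tau> n" for n
    unfolding label_count_eq by (subst type_count_Diff) (use fin P_def in auto)
  have e2: "label_count I \<tau> L' ?w 1 n - type_count Q \<tau> n = type_count ({k \<in> I. L' k ?w = 1} - Q) \<tau> n" for n
    unfolding label_count_eq by (subst type_count_Diff) (use I Q_def in auto)
  have e3: "{k \<in> I. L k ?w = 1} - P = {k \<in> I. L' k ?w = 1} - Q"
    unfolding P_def Q_def using bin by auto
  have "same_marg (label_count I \<tau> L ?w 1) (label_count I \<tau> L' ?w 1)" using s j unfolding same_stats_def by auto
  moreover have "label_count I \<tau> L ?w 1 n - type_count P \<tau> n = label_count I \<tau> L' ?w 1 n - type_count Q \<tau> n" for n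
    using e1[of n] e2[of n] e3 by simp
  ultimately have pq: "same_marg (type_count P \<tau>) (type_count Q \<tau>)"
    unfolding same_marg_iff by smt
  have nonneg: "\<forall>n<8. 0 \<le> type_count P \<tau> n" "\<forall>n<8. 0 \<le> type_count Q \<tau> n" unfolding type_count_def by auto
  \<comment> \<open>Equal marginals force equal sizes, so \<open>P\<close> is nonempty even if
    \<open>k0\<close> belongs to \<open>Q\<close>.\<close>
  have "int (card P) = int (card Q)"
    using sum_type_count[OF fin(1) types(1)] sum_type_count[OF fin(2) types(2)] pq unfolding sum8 same_marg_iff by linarith
  moreover have "k0 \<in> P \<union> Q" unfolding P_def Q_def using k0 bin[OF k0(1)] by auto
  then have "0 < card P + card Q" using fin by (auto simp: card_gt_0_iff)
  ultimately have "0 < (\<Sum>n<8. type_count P \<tau> n)" using sum_type_count[OF fin(1) types(1)] by simp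
  then have "\<exists>n<8. 0 < type_count P \<tau> n" using sum_nonpos[of "{..<8}" "type_count P \<tau>"] by (meson lessThan_iff not_le)
  from graver_pair[OF nonneg pq this] obtain e f where
    ef: "\<forall>n<8. 0 \<le> e n \<and> e n \<le> type_count P \<tau> n" "\<forall>n<8. 0 \<le> f n \<and> f n \<le> type_count Q \<tau> n" "same_marg e f"
    "0 < (\<Sum>n<8. e n)" "(\<Sum>n<8. e n) \<le> 3" "(\<Sum>n<8. f n) \<le> 3" by metis
  obtain A where A: "A \<subseteq> P" "\<forall>k\<in>A. \<tau> k < 8" "\<forall>n<8. type_count A \<tau> n = e n" using choose_subset[OF fin(1) ef(1)] .
  obtain B where B: "B \<subseteq> Q" "\<forall>k\<in>B. \<tau> k < 8" "\<forall>n<8. type_count B \<tau> n = f n" using choose_subset[OF fin(2) ef(2)] .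
  have finAB: "finite A" "finite B" using A(1) B(1) fin finite_subset by blast+
  have "int (card A) = (\<Sum>n<8. e n)" "int (card B) = (\<Sum>n<8. f n)"
    using sum_type_count[OF finAB(1) A(2)] sum_type_count[OF finAB(2) B(2)] A(3) B(3) by simp_all
  then have card: "card A \<le> 3" "card B \<le> 3" "0 < card A" using ef(4-6) by simp_all
  define L1 where "L1 k i = (if i = ?w \<and> k \<in> A \<union> B then L' k i else L k i)" for k i
  have lab1: "label_count I \<tau> L1 ?w 1 n = label_count I \<tau> L ?w 1 n - type_count A \<tau> n + type_count B \<tau> n" for n
  proof -
    have "{k \<in> I. L1 k ?w = 1} = ({k \<in> I. L k ?w = 1} - A) \<union> B"
      using A(1) B(1) unfolding L1_def P_def Q_def by auto
    then have "label_count I \<tau> L1 ?w 1 n = type_count (({k \<in> I. L k ?w = 1} - A) \<union> B) \<tau> n" unfolding label_count_eq by simp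
    also have "\<dots> = type_count ({k \<in> I. L k ?w = 1} - A) \<tau> n + type_count B \<tau> n"
      by (rule type_count_Un) (use fin finAB B(1) in \<open>auto simp: Q_def\<close>)
    also have "type_count ({k \<in> I. L k ?w = 1} - A) \<tau> n = type_count {k \<in> I. L k ?w = 1} \<tau> n - type_count A \<tau> n"
      by (rule type_count_Diff) (use fin A(1) in \<open>auto simp: P_def\<close>)
    finally show ?thesis unfolding label_count_eq .
  qed
  have v1: "valid I \<tau> L1" using v unfolding valid_def L1_def by auto
  have sim1: "same_marg (label_count I \<tau> L ?w 1) (label_count I \<tau> L1 ?w 1)"
    using ef(3) lab1 A(3) B(3) unfolding same_marg_iff by simp
  have sim0: "same_marg (label_count I \<tau> L ?w 0) (label_count I \<tau> L1 ?w 0)"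
    using sim1 unfolding same_marg_iff label_count_0[OF I v(1)] label_count_0[OF I v1] by linarith
  have s1: "same_stats I \<tau> L I \<tau> L1"
    unfolding same_stats_def
  proof (intro ballI)
    fix i b :: nat assume "b \<in> {0, 1}"
    show "same_marg (label_count I \<tau> L (wnode i) b) (label_count I \<tau> L1 (wnode i) b)"
    proof (cases "wnode i = ?w")
      case True
      then show ?thesis using sim0 sim1 \<open>b \<in> {0, 1}\<close> by auto
    next
      case False
      then have "label_count I \<tau> L1 (wnode i) b = label_count I \<tau> L (wnode i) b" unfolding label_count_def L1_def by simp
      then show ?thesis by simp
    qed
  qed
  show ?thesis
  proof (rule that[OF v1 s1, of "A \<union> B"])
    show "A \<union> B \<subseteq> I" using A(1) B(1) unfolding P_def Q_def by auto
    show "A \<union> B \<noteq> {}" using card(3) by auto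
    show "card (A \<union> B) \<le> 6" using card_Un_le[of A B] card by linarith
    show "L k ?w \<noteq> L' k ?w" if "k \<in> A \<union> B" for k using that A(1) B(1) unfolding P_def Q_def by auto
  qed (simp add: L1_def)
qed

lemma kernel_path:
  assumes D: "6 \<le> D" and I: "finite I" and v: "valid I \<tau> L" "valid I \<tau> L'"
    and fiber: "table I \<tau> L \<in> fiber \<Gamma> b" and s: "same_stats I \<tau> L I \<tau> L'"
  shows "(table I \<tau> L, table I \<tau> L') \<in> (fiber_steps \<Gamma> D b)\<^sup>*"
  using v(1) fiber s
proof (induction "card {(k, j) \<in> I \<times> {1..N}. L k (wnode j) \<noteq> L' k (wnode j)}" arbitrary: L rule: less_induct)
  case less
  show ?case
  proof (cases "\<exists>k\<in>I. \<exists>j\<in>{1..N}. L k (wnode j) \<noteq> L' k (wnode j)")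
    case False
    then have "table I \<tau> L = table I \<tau> L'"
      unfolding table_def by (intro tally_cong) (auto simp: individual_def nodes_def)
    then show ?thesis by simp
  next
    case True
    then obtain k0 j where k0: "k0 \<in> I" "j \<in> {1..N}" "L k0 (wnode j) \<noteq> L' k0 (wnode j)" by blast
    obtain L1 C where L1: "valid I \<tau> L1" "same_stats I \<tau> L I \<tau> L1" "C \<subseteq> I" "C \<noteq> {}" "card C \<le> 6"
      "\<And>k. k \<in> C \<Longrightarrow> L k (wnode j) \<noteq> L' k (wnode j)"
      "\<And>k i. L1 k i = (if i = wnode j \<and> k \<in> C then L' k i else L k i)"
      using relabel_step[OF I less.prems(1) v(2) k0(2) less.prems(3) k0(1,3)] by metis
    have fib1: "table I \<tau> L1 \<in> fiber \<Gamma> b"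
      unfolding table_in_fiber[OF I I less.prems(1) L1(1) less.prems(2)] using L1(2) by simp
    have step: "(table I \<tau> L, table I \<tau> L1) \<in> fiber_steps \<Gamma> D b"
      unfolding table_def Union_\<Gamma>[symmetric]
    proof (rule tally_step[OF _ I _ _ _ _ L1(3)])
      show "finite (\<Union>\<Gamma>)" unfolding Union_\<Gamma> by (rule finite_nodes)
      show "\<forall>k\<in>I. \<forall>i\<in>\<Union>\<Gamma>. individual \<tau> L k i \<in> {0, 1}" by (rule individual_binary[OF less.prems(1)])
      show "\<forall>k\<in>I. \<forall>i\<in>\<Union>\<Gamma>. individual \<tau> L1 k i \<in> {0, 1}" by (rule individual_binary[OF L1(1)])
      show "tally I (\<Union>\<Gamma>) (individual \<tau> L) \<in> fiber \<Gamma> b" "tally I (\<Union>\<Gamma>) (individual \<tau> L1) \<in> fiber \<Gamma> b"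
        using less.prems(2) fib1 unfolding table_def Union_\<Gamma> by auto
      show "card C \<le> D" using L1(5) D by simp
    qed (simp add: individual_def L1(7))
    have "card {(k, j) \<in> I \<times> {1..N}. L1 k (wnode j) \<noteq> L' k (wnode j)} <
        card {(k, j) \<in> I \<times> {1..N}. L k (wnode j) \<noteq> L' k (wnode j)}"
    proof (rule psubset_card_mono)
      show "finite {(k, j) \<in> I \<times> {1..N}. L k (wnode j) \<noteq> L' k (wnode j)}"
        by (rule finite_subset[of _ "I \<times> {1..N}"]) (use I in auto)
      obtain k1 where k1: "k1 \<in> C" using L1(4) by blast
      have "(k1, j) \<in> {(k, j) \<in> I \<times> {1..N}. L k (wnode j) \<noteq> L' k (wnode j)}"
        "(k1, j) \<notin> {(k, j) \<in> I \<times> {1..N}. L1 k (wnode j) \<noteq> L' k (wnode j)}"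
        using k1 L1(3,6) k0(2) by (auto simp: L1(7))
      moreover have "{(k, j) \<in> I \<times> {1..N}. L1 k (wnode j) \<noteq> L' k (wnode j)} \<subseteq>
          {(k, j) \<in> I \<times> {1..N}. L k (wnode j) \<noteq> L' k (wnode j)}"
        by (auto simp: L1(7) split: if_splits)
      ultimately show "{(k, j) \<in> I \<times> {1..N}. L1 k (wnode j) \<noteq> L' k (wnode j)} \<subset>
          {(k, j) \<in> I \<times> {1..N}. L k (wnode j) \<noteq> L' k (wnode j)}" by blast
    qed
    from less.hyps[OF this L1(1) fib1 same_stats_trans[OF same_stats_sym[OF L1(2)] less.prems(3)]]
    show ?thesis using step by (rule converse_rtrancl_into_rtrancl[rotated])
  qed
qed

text \<open>A table does not record the order of the individuals. Equal vertex counts give a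
  permutation matching the two assignments of vertices, and the labels are carried along it.\<close>

lemma table_permute:
  assumes "finite I" "\<forall>k\<in>I. \<tau> k < 8" "\<forall>k\<in>I. \<tau>' k < 8" "\<forall>n<8. type_count I \<tau> n = type_count I \<tau>' n" "valid I \<tau>' L'"
  obtains L'' where "valid I \<tau> L''" "table I \<tau> L'' = table I \<tau>' L'"
proof -
  have "image_mset \<tau> (mset_set I) = image_mset \<tau>' (mset_set I)"
  proof (rule multiset_eqI)
    fix n
    have c: "int (count (image_mset \<sigma> (mset_set I)) n) = type_count I \<sigma> n" for \<sigma> :: "nat \<Rightarrow> nat"
      unfolding type_count_def count_image_mset using assms(1)
      by (simp add: vimage_def Int_def conj_commute)
    have "type_count I \<tau> n = type_count I \<tau>' n"
    proof (cases "n < 8")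
      case False
      then have "{k \<in> I. \<tau> k = n} = {}" "{k \<in> I. \<tau>' k = n} = {}" using assms(2,3) by auto
      then show ?thesis unfolding type_count_def by (simp only:)
    qed (use assms(4) in blast)
    then show "count (image_mset \<tau> (mset_set I)) n = count (image_mset \<tau>' (mset_set I)) n"
      using c[of \<tau>] c[of \<tau>'] by linarith
  qed
  from image_mset_eq_implies_permutes[OF assms(1) this] obtain p where
    p: "p permutes I" "\<forall>k\<in>I. \<tau> k = \<tau>' (p k)" by blast
  define L'' where "L'' k = L' (p k)" for k
  have pI: "p k \<in> I" if "k \<in> I" for k using permutes_in_image[OF p(1)] that by simp
  show ?thesis
  proof (rule that[of L''])
    show "valid I \<tau> L''" using assms(2,5) pI unfolding valid_def L''_def by blast
    show "table I \<tau> L'' = table I \<tau>' L'"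
    proof
      fix x
      have eq: "restrict (individual \<tau> L'' k) (nodes N) = restrict (individual \<tau>' L' (p k)) (nodes N)" if "k \<in> I" for k
        unfolding restrict_eq_iff individual_def L''_def using p(2) that by simp
      have "{k \<in> I. restrict (individual \<tau>' L' k) (nodes N) = x} = p ` {k \<in> I. restrict (individual \<tau> L'' k) (nodes N) = x}"
      proof -
        have "{k \<in> p ` A. P k} = p ` {k \<in> A. P (p k)}" for A P by blast
        from this[of I "\<lambda>k. restrict (individual \<tau>' L' k) (nodes N) = x", unfolded permutes_image[OF p(1)]]
        have "{k \<in> I. restrict (individual \<tau>' L' k) (nodes N) = x} =
            p ` {k \<in> I. restrict (individual \<tau>' L' (p k)) (nodes N) = x}" .
        also have "{k \<in> I. restrict (individual \<tau>' L' (p k)) (nodes N) = x} =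
            {k \<in> I. restrict (individual \<tau> L'' k) (nodes N) = x}" using eq by auto
        finally show ?thesis .
      qed
      moreover have "inj_on p {k \<in> I. restrict (individual \<tau> L'' k) (nodes N) = x}"
        using permutes_inj_on[OF p(1)] .
      ultimately show "table I \<tau> L'' x = table I \<tau>' L' x"
        unfolding table_def tally_def by (simp add: card_image)
    qed
  qed
qed

end

lemma moves_pos_sum_le: "g \<in> set moves \<Longrightarrow> (\<Sum>n<8. max (g ! n) 0) \<le> 4"
proof -
  have "\<forall>g\<in>set moves. (\<Sum>n<8. max (g ! n) 0) \<le> 4"
    unfolding moves_def both_signs_def half_quadrics_def half_quartics_def sum8 by simp
  then show "g \<in> set moves \<Longrightarrow> (\<Sum>n<8. max (g ! n) 0) \<le> 4" by blast
qed

text \<open>\<open>\<rho> n\<close> is the least number of individuals at vertex \<open>n\<close>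
  that accommodates the positive parts of \<open>g\<close> and of all the liftings
  \<open>(m j, g - m j)\<close>. Being a maximum, its excess over the positive part of
  \<open>g\<close> is at most 1 at each of the eight vertices, and in total at most the sum of the
  excesses of the labels. The third conclusion records that \<open>\<rho>\<close> is least.\<close>

lemma common_support:
  fixes m :: "nat \<Rightarrow> nat \<Rightarrow> int"
  assumes g: "g \<in> set moves" and irr: "\<And>j. j \<in> {1..N} \<Longrightarrow> irreducible_lift (nth g) (m j)"
  obtains \<rho> where "\<forall>n. 0 \<le> \<rho> n \<and> g ! n \<le> \<rho> n"
    "\<forall>n. \<forall>j\<in>{1..N}. m j n \<le> \<rho> n \<and> g ! n - m j n \<le> \<rho> n"
    "\<forall>n c. 0 \<le> c \<longrightarrow> g ! n \<le> c \<longrightarrow> (\<forall>j\<in>{1..N}. m j n \<le> c \<and> g ! n - m j n \<le> c) \<longrightarrow> \<rho> n \<le> c"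
    "(\<Sum>n<8. \<rho> n) \<le> int (min 12 (4 + 2 * N))"
proof -
  define \<rho> where "\<rho> n = Max (insert 0 (insert (g ! n) ((\<lambda>j. max (m j n) (g ! n - m j n)) ` {1..N})))" for n
  have low: "0 \<le> \<rho> n \<and> g ! n \<le> \<rho> n" for n
    unfolding \<rho>_def by (intro conjI Max_ge) auto
  have lowj: "m j n \<le> \<rho> n \<and> g ! n - m j n \<le> \<rho> n" if "j \<in> {1..N}" for n j
  proof -
    have "max (m j n) (g ! n - m j n) \<le> \<rho> n" unfolding \<rho>_def by (rule Max_ge) (use that in auto)
    then show ?thesis by simp
  qed
  have up: "\<rho> n \<le> c" if "0 \<le> c" "g ! n \<le> c" "\<forall>j\<in>{1..N}. m j n \<le> c \<and> g ! n - m j n \<le> c" for n c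
    unfolding \<rho>_def using that by simp
  have "(\<Sum>n<8. \<rho> n) \<le> (\<Sum>n<8. max (g ! n) 0 + 1)"
  proof (rule sum_mono)
    fix n :: nat assume n: "n \<in> {..<8}"
    show "\<rho> n \<le> max (g ! n) 0 + 1"
      by (rule up) (use irreducible_lift_bound(1)[OF g irr] n in auto)
  qed
  also have "\<dots> \<le> 12" using moves_pos_sum_le[OF g] by (simp add: sum.distrib)
  finally have 12: "(\<Sum>n<8. \<rho> n) \<le> 12" .
  \<comment> \<open>The excess of the lifting for label \<open>j\<close> at vertex \<open>n\<close>;
    its sum over the vertices is at most 2 by the lifting bound.\<close>
  define t where "t j n = max (m j n) 0 + max (g ! n - m j n) 0 - max (g ! n) 0" for j n
  have t0: "0 \<le> t j n" for j n unfolding t_def by simp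
  have "(\<Sum>n<8. \<rho> n) \<le> (\<Sum>n<8. max (g ! n) 0 + (\<Sum>j\<in>{1..N}. t j n))"
  proof (rule sum_mono)
    fix n :: nat
    show "\<rho> n \<le> max (g ! n) 0 + (\<Sum>j\<in>{1..N}. t j n)"
    proof (rule up)
      have s0: "0 \<le> (\<Sum>j\<in>{1..N}. t j n)" by (rule sum_nonneg) (rule t0)
      then show "0 \<le> max (g ! n) 0 + (\<Sum>j\<in>{1..N}. t j n)" "g ! n \<le> max (g ! n) 0 + (\<Sum>j\<in>{1..N}. t j n)" by simp_all
      show "\<forall>j\<in>{1..N}. m j n \<le> max (g ! n) 0 + (\<Sum>j\<in>{1..N}. t j n) \<and>
          g ! n - m j n \<le> max (g ! n) 0 + (\<Sum>j\<in>{1..N}. t j n)"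
      proof
        fix j assume "j \<in> {1..N}"
        then have "t j n \<le> (\<Sum>j\<in>{1..N}. t j n)" by (intro member_le_sum t0) auto
        then show "m j n \<le> max (g ! n) 0 + (\<Sum>j\<in>{1..N}. t j n) \<and>
            g ! n - m j n \<le> max (g ! n) 0 + (\<Sum>j\<in>{1..N}. t j n)"
          unfolding t_def[of j n] by linarith
      qed
    qed
  qed
  also have "\<dots> = (\<Sum>n<8. max (g ! n) 0) + (\<Sum>j\<in>{1..N}. \<Sum>n<8. t j n)"
    unfolding sum.distrib by (subst sum.swap) (rule refl)
  also have "(\<Sum>j\<in>{1..N}. \<Sum>n<8. t j n) \<le> (\<Sum>j\<in>{1..N}. 2)"
  proof (rule sum_mono)
    fix j assume "j \<in> {1..N}"
    from irreducible_lift_bound(2)[OF g irr[OF this]] show "(\<Sum>n<8. t j n) \<le> 2"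
      unfolding t_def by (simp add: sum.distrib sum_subtractf)
  qed
  finally have "(\<Sum>n<8. \<rho> n) \<le> 4 + 2 * int N" using moves_pos_sum_le[OF g] by simp
  then show ?thesis using 12 by (intro that[of \<rho>] allI impI ballI low lowj up) auto
qed

lemma label_count_indicator:
  assumes "X \<subseteq> I" "\<And>k. k \<in> I \<Longrightarrow> L k w = (if k \<in> X then 1 else 0 :: nat)"
  shows "label_count I \<tau> L w 1 = type_count X \<tau>"
proof -
  have "{k \<in> I. L k w = 1} = X" using assms by (auto split: if_splits)
  then show ?thesis unfolding label_count_eq by simp
qed

context K3_model
begin

text \<open>Only a set \<open>R\<close> with \<open>\<rho> n\<close> individuals at each vertex
  \<open>n\<close> changes cube vertices. For each label \<open>j\<close> the individuals with label
  1 are \<open>A j\<close> inside \<open>R\<close> before the change, \<open>A' j\<close> inside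
  \<open>R\<close> after it, and the same set \<open>C j\<close> outside \<open>R\<close> both
  times. Kernel moves first bring the labels into the form \<open>L1\<close>; then one step changes
  vertices and labels on \<open>R\<close> together.\<close>

lemma move_step:
  assumes no_cube: "{1, 2, 3} \<notin> facets \<Gamma>" and I: "finite I" and v: "valid I \<tau> L"
    and fiber: "table I \<tau> L \<in> fiber \<Gamma> b" and g: "g \<in> set moves"
    and f': "\<forall>n<8. f' n = type_count I \<tau> n - g ! n"
    and a': "\<forall>j\<in>{1..N}. \<exists>a'. (\<forall>n<8. 0 \<le> a' n \<and> a' n \<le> f' n) \<and> same_marg a' (label_count I \<tau> L (wnode j) 1)"
    and D: "6 \<le> D" "min 12 (4 + 2 * N) \<le> D"
  obtains \<tau>' L' where "valid I \<tau>' L'" "\<forall>n<8. type_count I \<tau>' n = f' n" "table I \<tau>' L' \<in> fiber \<Gamma> b"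
    "(table I \<tau> L, table I \<tau>' L') \<in> (fiber_steps \<Gamma> D b)\<^sup>*"
proof -
  have \<tau>: "\<forall>k\<in>I. \<tau> k < 8" using v unfolding valid_def by blast
  have ff: "\<forall>n<8. type_count I \<tau> n - f' n = g ! n" using f' by simp
  have ex: "\<exists>x x'. (\<forall>n<8. 0 \<le> x n \<and> x n \<le> type_count I \<tau> n) \<and> (\<forall>n<8. 0 \<le> x' n \<and> x' n \<le> f' n) \<and>
    same_marg x (label_count I \<tau> L (wnode j) 1) \<and> same_marg x' (label_count I \<tau> L (wnode j) 1) \<and>
    irreducible_lift (nth g) (\<lambda>n. x n - x' n)" if j: "j \<in> {1..N}" for j
  proof -
    obtain a' where a': "\<forall>n<8. 0 \<le> a' n \<and> a' n \<le> f' n" "same_marg a' (label_count I \<tau> L (wnode j) 1)"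
      using a' j by blast
    have a: "\<forall>n<8. 0 \<le> label_count I \<tau> L (wnode j) 1 n \<and> label_count I \<tau> L (wnode j) 1 n \<le> type_count I \<tau> n"
      using label_count_nonneg label_count_le[OF I] by blast
    obtain y y' where "\<forall>n<8. 0 \<le> y n \<and> y n \<le> type_count I \<tau> n" "\<forall>n<8. 0 \<le> y' n \<and> y' n \<le> f' n"
      "same_marg y (label_count I \<tau> L (wnode j) 1)" "same_marg y' (label_count I \<tau> L (wnode j) 1)"
      "irreducible_lift (nth g) (\<lambda>n. y n - y' n)"
      by (rule ex_irreducible_lift[OF g a a' ff])
    then show ?thesis by (intro exI[of _ y] exI[of _ y'] conjI)
  qed
  define good where "good j p \<longleftrightarrow> (\<forall>n<8. 0 \<le> fst p n \<and> fst p n \<le> type_count I \<tau> n) \<and>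
    (\<forall>n<8. 0 \<le> snd p n \<and> snd p n \<le> f' n) \<and>
    same_marg (fst p) (label_count I \<tau> L (wnode j) 1) \<and> same_marg (snd p) (label_count I \<tau> L (wnode j) 1) \<and>
    irreducible_lift (nth g) (\<lambda>n. fst p n - snd p n)" for j p
  have "\<forall>j\<in>{1..N}. \<exists>p. good j p"
    unfolding good_def split_paired_Ex fst_conv snd_conv using ex by blast
  then obtain p where p: "\<forall>j\<in>{1..N}. good j (p j)" using bchoice by blast
  define x x' where "x j = fst (p j)" and "x' j = snd (p j)" for j
  have x: "\<forall>n<8. 0 \<le> x j n \<and> x j n \<le> type_count I \<tau> n" "\<forall>n<8. 0 \<le> x' j n \<and> x' j n \<le> f' n"
    "same_marg (x j) (label_count I \<tau> L (wnode j) 1)" "same_marg (x' j) (label_count I \<tau> L (wnode j) 1)"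
    "irreducible_lift (nth g) (\<lambda>n. x j n - x' j n)" if "j \<in> {1..N}" for j
    using p[rule_format, OF that] unfolding good_def x_def x'_def by blast+
  obtain \<rho> where \<rho>: "\<forall>n. 0 \<le> \<rho> n \<and> g ! n \<le> \<rho> n"
    "\<forall>n. \<forall>j\<in>{1..N}. x j n - x' j n \<le> \<rho> n \<and> g ! n - (x j n - x' j n) \<le> \<rho> n"
    "\<forall>n c. 0 \<le> c \<longrightarrow> g ! n \<le> c \<longrightarrow> (\<forall>j\<in>{1..N}. x j n - x' j n \<le> c \<and> g ! n - (x j n - x' j n) \<le> c) \<longrightarrow> \<rho> n \<le> c"
    "(\<Sum>n<8. \<rho> n) \<le> int (min 12 (4 + 2 * N))"
    by (rule common_support[where m = "\<lambda>j n. x j n - x' j n", OF g x(5)])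
  have f'0: "\<forall>n<8. 0 \<le> f' n"
  proof -
    have "1 \<in> {1..N}" using N by simp
    from x(2)[OF this] show ?thesis by (meson order_trans)
  qed
  \<comment> \<open>\<open>R\<close> must fit into the family. Since \<open>\<rho>\<close> is least,
    it suffices that the current counts dominate \<open>g\<close>, \<open>x - x'\<close> and
    \<open>g - (x - x')\<close>, which holds because all tables involved are nonnegative.\<close>
  have \<rho>_le: "\<forall>n<8. 0 \<le> \<rho> n \<and> \<rho> n \<le> type_count I \<tau> n"
  proof (intro allI impI conjI)
    fix n :: nat assume n: "n < 8"
    show "0 \<le> \<rho> n" using \<rho>(1) by blast
    show "\<rho> n \<le> type_count I \<tau> n"
    proof (rule \<rho>(3)[THEN spec, THEN spec, THEN mp, THEN mp, THEN mp])
      show "0 \<le> type_count I \<tau> n" unfolding type_count_def by simp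
      show "g ! n \<le> type_count I \<tau> n" using f' f'0 n by (metis diff_ge_0_iff_ge)
      show "\<forall>j\<in>{1..N}. x j n - x' j n \<le> type_count I \<tau> n \<and> g ! n - (x j n - x' j n) \<le> type_count I \<tau> n"
      proof
        fix j assume "j \<in> {1..N}"
        from x(1)[OF this] x(2)[OF this] f' n
        have "0 \<le> x j n" "x j n \<le> type_count I \<tau> n" "0 \<le> x' j n" "x' j n \<le> f' n" "f' n = type_count I \<tau> n - g ! n" by blast+
        then show "x j n - x' j n \<le> type_count I \<tau> n \<and> g ! n - (x j n - x' j n) \<le> type_count I \<tau> n" by linarith
      qed
    qed
  qed
  obtain R where R: "R \<subseteq> I" "\<forall>k\<in>R. \<tau> k < 8" "\<forall>n<8. type_count R \<tau> n = \<rho> n"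
    by (rule choose_subset[OF I \<rho>_le])
  have finR: "finite R" "finite (I - R)" using R(1) I finite_subset by blast+
  have cardR: "int (card R) = (\<Sum>n<8. \<rho> n)" using sum_type_count[OF finR(1) R(2)] R(3) by simp
  have g0: "(\<Sum>n<8. g ! n) = 0"
    using moves_same_marg[rule_format, OF g] unfolding same_marg_iff sum8 by simp
  obtain \<sigma> where \<sigma>: "\<forall>k\<in>R. \<sigma> k < 8" "\<forall>n<8. type_count R \<sigma> n = \<rho> n - g ! n"
  proof (rule retype[OF finR(1)])
    show "\<forall>n<8. 0 \<le> \<rho> n - g ! n" using \<rho>(1) by simp
    show "(\<Sum>n<8. \<rho> n - g ! n) = int (card R)" using g0 cardR by (simp add: sum_subtractf)
  qed
  define \<tau>' where "\<tau>' k = (if k \<in> R then \<sigma> k else \<tau> k)" for k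
  have \<tau>'R: "type_count A \<tau>' = type_count A \<sigma>" if "A \<subseteq> R" for A by (rule type_count_cong) (use that in \<open>auto simp: \<tau>'_def\<close>)
  have \<tau>'I: "type_count C \<tau>' = type_count C \<tau>" if "C \<subseteq> I - R" for C by (rule type_count_cong) (use that in \<open>auto simp: \<tau>'_def\<close>)
  have cnt': "\<forall>n<8. type_count I \<tau>' n = f' n"
  proof (intro allI impI)
    fix n :: nat assume n: "n < 8"
    have "type_count (R \<union> (I - R)) \<tau>' n = type_count R \<tau>' n + type_count (I - R) \<tau>' n" by (rule type_count_Un) (use finR in auto)
    moreover have "R \<union> (I - R) = I" using R(1) by blast
    ultimately show "type_count I \<tau>' n = f' n"
      using \<tau>'R[of R] \<tau>'I[of "I - R"] type_count_Diff[OF I R(1), of \<tau> n] \<sigma>(2) R(3) f' n by simp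
  qed
  define split where "split j p \<longleftrightarrow> fst p \<subseteq> R \<and> fst (snd p) \<subseteq> R \<and> snd (snd p) \<subseteq> I - R \<and>
      (\<forall>n<8. type_count (fst p) \<tau> n + type_count (snd (snd p)) \<tau> n = x j n) \<and>
      (\<forall>n<8. type_count (fst (snd p)) \<sigma> n + type_count (snd (snd p)) \<tau> n = x' j n)" for j p
  have "\<forall>j\<in>{1..N}. \<exists>p. split j p"
  proof
    fix j assume j: "j \<in> {1..N}"
    \<comment> \<open>The number of individuals in \<open>R\<close> at vertex \<open>n\<close> that
      have label 1 before the change. It is at least \<open>x j n - x' j n\<close>, so that the
      number after the change is not negative, and large enough that the other
      \<open>x j n - e n\<close> fit outside \<open>R\<close>.\<close>
    define e where "e n = max 0 (max (x j n - x' j n) (x j n - type_count I \<tau> n + \<rho> n))" for n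
    have bounds: "0 \<le> e n \<and> e n \<le> \<rho> n \<and> e n \<le> x j n \<and> x j n - e n \<le> type_count I \<tau> n - \<rho> n \<and>
      0 \<le> e n - (x j n - x' j n) \<and> e n - (x j n - x' j n) \<le> \<rho> n - g ! n" if n: "n < 8" for n
    proof -
      have "0 \<le> x j n" "x j n \<le> type_count I \<tau> n" "0 \<le> x' j n" "x' j n \<le> f' n" "f' n = type_count I \<tau> n - g ! n"
        "0 \<le> \<rho> n" "\<rho> n \<le> type_count I \<tau> n"
        using x(1,2)[OF j] f' \<rho>_le n by blast+
      moreover have "g ! n \<le> \<rho> n" "x j n - x' j n \<le> \<rho> n" "g ! n - (x j n - x' j n) \<le> \<rho> n"
        using \<rho>(1,2) j by blast+
      ultimately show ?thesis unfolding e_def by linarith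
    qed
    have "\<forall>n<8. 0 \<le> e n \<and> e n \<le> type_count R \<tau> n" using bounds R(3) by simp
    then obtain A where A: "A \<subseteq> R" "\<forall>k\<in>A. \<tau> k < 8" "\<forall>n<8. type_count A \<tau> n = e n"
      by (rule choose_subset[OF finR(1)])
    have "\<forall>n<8. 0 \<le> x j n - e n \<and> x j n - e n \<le> type_count (I - R) \<tau> n"
      using bounds R(3) type_count_Diff[OF I R(1)] by simp
    then obtain C where C: "C \<subseteq> I - R" "\<forall>k\<in>C. \<tau> k < 8" "\<forall>n<8. type_count C \<tau> n = x j n - e n"
      by (rule choose_subset[OF finR(2)])
    have "\<forall>n<8. 0 \<le> e n - (x j n - x' j n) \<and> e n - (x j n - x' j n) \<le> type_count R \<sigma> n"
      using bounds \<sigma>(2) by simp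
    then obtain A' where A': "A' \<subseteq> R" "\<forall>k\<in>A'. \<sigma> k < 8" "\<forall>n<8. type_count A' \<sigma> n = e n - (x j n - x' j n)"
      by (rule choose_subset[OF finR(1)])
    show "\<exists>p. split j p"
      unfolding split_def using A A' C by (intro exI[of _ "(A, A', C)"]) simp
  qed
  then obtain p where p: "\<forall>j\<in>{1..N}. split j (p j)" using bchoice by blast
  define A A' C where "A j = fst (p j)" and "A' j = fst (snd (p j))" and "C j = snd (snd (p j))" for j
  have ACA: "A j \<subseteq> R \<and> A' j \<subseteq> R \<and> C j \<subseteq> I - R \<and>
      (\<forall>n<8. type_count (A j) \<tau> n + type_count (C j) \<tau> n = x j n) \<and> (\<forall>n<8. type_count (A' j) \<sigma> n + type_count (C j) \<tau> n = x' j n)"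
    if "j \<in> {1..N}" for j
    using p[rule_format, OF that] unfolding split_def A_def A'_def C_def .
  \<comment> \<open>\<open>i - 3\<close> inverts \<open>wnode\<close>; at the nodes 1, 2, 3
    \<open>individual\<close> reads the cube vertex instead.\<close>
  define L1 where "L1 k i = (if k \<in> A (i - 3) \<union> C (i - 3) then 1 else 0 :: nat)" for k i
  define L' where "L' k i = (if k \<in> A' (i - 3) \<union> C (i - 3) then 1 else 0 :: nat)" for k i
  have v1: "valid I \<tau> L1" using \<tau> unfolding valid_def L1_def by simp
  have v': "valid I \<tau>' L'" using \<tau> \<sigma>(1) unfolding valid_def L'_def \<tau>'_def by simp
  have lab1: "\<forall>n<8. label_count I \<tau> L1 (wnode j) 1 n = x j n" if j: "j \<in> {1..N}" for j
  proof (intro allI impI)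
    fix n :: nat assume n: "n < 8"
    have *: "A j \<subseteq> R" "C j \<subseteq> I - R" using ACA[OF j] by blast+
    have "label_count I \<tau> L1 (wnode j) 1 = type_count (A j \<union> C j) \<tau>"
      by (rule label_count_indicator) (use * R(1) in \<open>auto simp: L1_def wnode_def\<close>)
    moreover have "type_count (A j \<union> C j) \<tau> n = type_count (A j) \<tau> n + type_count (C j) \<tau> n"
      by (rule type_count_Un) (use * finR finite_subset in \<open>blast+\<close>)
    ultimately show "label_count I \<tau> L1 (wnode j) 1 n = x j n" using ACA[OF j] n by simp
  qed
  have lab': "\<forall>n<8. label_count I \<tau>' L' (wnode j) 1 n = x' j n" if j: "j \<in> {1..N}" for j
  proof (intro allI impI)
    fix n :: nat assume n: "n < 8"
    have *: "A' j \<subseteq> R" "C j \<subseteq> I - R" using ACA[OF j] by blast+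
    have "label_count I \<tau>' L' (wnode j) 1 = type_count (A' j \<union> C j) \<tau>'"
      by (rule label_count_indicator) (use * R(1) in \<open>auto simp: L'_def wnode_def\<close>)
    moreover have "type_count (A' j \<union> C j) \<tau>' n = type_count (A' j) \<tau>' n + type_count (C j) \<tau>' n"
      by (rule type_count_Un) (use * finR finite_subset in \<open>blast+\<close>)
    ultimately show "label_count I \<tau>' L' (wnode j) 1 n = x' j n"
      using ACA[OF j] n \<tau>'R[OF *(1)] \<tau>'I[OF *(2)] by simp
  qed
  have sim_f': "same_marg f' (type_count I \<tau>)"
    using moves_same_marg[rule_format, OF g] f' unfolding same_marg_iff by simp
  have s1: "same_stats I \<tau> L I \<tau> L1"
    unfolding same_stats_def
  proof (intro ballI)
    fix j b :: nat assume j: "j \<in> {1..N}" and b: "b \<in> {0, 1}"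
    have 1: "same_marg (label_count I \<tau> L (wnode j) 1) (label_count I \<tau> L1 (wnode j) 1)"
      using x(3)[OF j] lab1[OF j] unfolding same_marg_iff by simp
    then have "same_marg (label_count I \<tau> L (wnode j) 0) (label_count I \<tau> L1 (wnode j) 0)"
      unfolding same_marg_iff label_count_0[OF I v] label_count_0[OF I v1] by linarith
    with 1 b show "same_marg (label_count I \<tau> L (wnode j) b) (label_count I \<tau> L1 (wnode j) b)" by auto
  qed
  have s': "same_stats I \<tau> L I \<tau>' L'"
    unfolding same_stats_def
  proof (intro ballI)
    fix j b :: nat assume j: "j \<in> {1..N}" and b: "b \<in> {0, 1}"
    have 1: "same_marg (label_count I \<tau> L (wnode j) 1) (label_count I \<tau>' L' (wnode j) 1)"
      using x(4)[OF j] lab'[OF j] unfolding same_marg_iff by simp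
    moreover have "same_marg (type_count I \<tau>) (type_count I \<tau>')" using sim_f' cnt' unfolding same_marg_iff by simp
    ultimately have "same_marg (label_count I \<tau> L (wnode j) 0) (label_count I \<tau>' L' (wnode j) 0)"
      unfolding same_marg_iff label_count_0[OF I v] label_count_0[OF I v'] by linarith
    with 1 b show "same_marg (label_count I \<tau> L (wnode j) b) (label_count I \<tau>' L' (wnode j) b)" by auto
  qed
  have fib1: "table I \<tau> L1 \<in> fiber \<Gamma> b"
    unfolding table_in_fiber[OF I I v v1 fiber] using s1 by simp
  have fib': "table I \<tau>' L' \<in> fiber \<Gamma> b"
    unfolding table_in_fiber[OF I I v v' fiber] using s' no_cube by simp
  have "(table I \<tau> L1, table I \<tau>' L') \<in> fiber_steps \<Gamma> D b"
    unfolding table_def Union_\<Gamma>[symmetric]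
  proof (rule tally_step[OF _ I _ _ _ _ R(1)])
    show "finite (\<Union>\<Gamma>)" unfolding Union_\<Gamma> by (rule finite_nodes)
    show "\<forall>k\<in>I. \<forall>i\<in>\<Union>\<Gamma>. individual \<tau> L1 k i \<in> {0, 1}" by (rule individual_binary[OF v1])
    show "\<forall>k\<in>I. \<forall>i\<in>\<Union>\<Gamma>. individual \<tau>' L' k i \<in> {0, 1}" by (rule individual_binary[OF v'])
    show "tally I (\<Union>\<Gamma>) (individual \<tau> L1) \<in> fiber \<Gamma> b" "tally I (\<Union>\<Gamma>) (individual \<tau>' L') \<in> fiber \<Gamma> b"
      using fib1 fib' unfolding table_def Union_\<Gamma> by auto
    show "card R \<le> D" using cardR \<rho>(4) D(2) by linarith
    fix k i assume k: "k \<in> I - R" and "i \<in> \<Union>\<Gamma>"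
    then have i: "i \<in> {1, 2, 3} \<or> (\<exists>j\<in>{1..N}. i = wnode j)" unfolding Union_\<Gamma> nodes_def by blast
    show "individual \<tau> L1 k i = individual \<tau>' L' k i"
    proof (cases "i \<in> {1, 2, 3}")
      case True
      then show ?thesis using k unfolding individual_def \<tau>'_def by simp
    next
      case False
      with i obtain j where j: "j \<in> {1..N}" "i = wnode j" by blast
      then have "i - 3 = j" unfolding wnode_def by simp
      then have "k \<notin> A (i - 3)" "k \<notin> A' (i - 3)" using ACA[OF j(1)] k by blast+
      then have "L1 k i = L' k i" unfolding L1_def L'_def by simp
      then show ?thesis using False unfolding individual_def by simp
    qed
  qed
  with kernel_path[OF D(1) I v v1 fiber s1]
  have "(table I \<tau> L, table I \<tau>' L') \<in> (fiber_steps \<Gamma> D b)\<^sup>*" by (rule rtrancl_into_rtrancl)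
  from that[OF v' cnt' fib' this] show ?thesis .
qed

text \<open>The marginals of the two layers of one label add up to those of all vertex counts, and
  these determine the total. Hence two tables of a fiber can be described by the same index
  set.\<close>

lemma size_eq:
  assumes fin: "finite I" "finite I'" and v: "valid I \<tau> L" "valid I' \<tau>' L'" and s: "same_stats I \<tau> L I' \<tau>' L'"
  shows "card I = card I'"
proof -
  have "1 \<in> {1..N}" using N by simp
  then have "same_marg (label_count I \<tau> L (wnode 1) b) (label_count I' \<tau>' L' (wnode 1) b)" if "b \<in> {0, 1}" for b
    using s that unfolding same_stats_def by blast
  from this[of 0] this[of 1] have "same_marg (type_count I \<tau>) (type_count I' \<tau>')"
    unfolding same_marg_iff label_count_0[OF fin(1) v(1)] label_count_0[OF fin(2) v(2)] by simp
  moreover have "(\<Sum>n<8. type_count I \<tau> n) = int (card I)" "(\<Sum>n<8. type_count I' \<tau>' n) = int (card I')"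
    using sum_type_count fin v unfolding valid_def by blast+
  ultimately show ?thesis unfolding same_marg_iff sum8 by linarith
qed

lemma same_types_path:
  assumes D: "6 \<le> D" and I: "finite I" and v: "valid I \<tau> L" "valid I \<tau>' L'"
    and fiber: "table I \<tau> L \<in> fiber \<Gamma> b" "table I \<tau>' L' \<in> fiber \<Gamma> b" and c: "\<forall>n<8. type_count I \<tau> n = type_count I \<tau>' n"
  shows "(table I \<tau> L, table I \<tau>' L') \<in> (fiber_steps \<Gamma> D b)\<^sup>*"
proof -
  have "\<forall>k\<in>I. \<tau> k < 8" "\<forall>k\<in>I. \<tau>' k < 8" using v unfolding valid_def by blast+
  then obtain L'' where L'': "valid I \<tau> L''" "table I \<tau> L'' = table I \<tau>' L'"
    using table_permute[OF I _ _ c v(2)] by blast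
  have "same_stats I \<tau> L I \<tau> L''"
    using table_in_fiber[OF I I v(1) L''(1) fiber(1)] fiber(2) L''(2) by simp
  from kernel_path[OF D I v(1) L''(1) fiber(1) this] show ?thesis unfolding L''(2) .
qed

text \<open>Label \<open>j\<close> alone turns the family into a table on the \<open>j\<close>-th
  copy of the three-star. The vertex counts compatible with all labels form the intersection of the
  corresponding projected fibers.\<close>

definition star_fibers where
  "star_fibers I \<tau> L = (\<lambda>j. hierarchical_map star3 (star_table (label_count I \<tau> L (wnode j) 1) (label_count I \<tau> L (wnode j) 0))) ` {1..N}"

lemma star_fibers_cong: "same_stats I \<tau> L I' \<tau>' L' \<Longrightarrow> star_fibers I \<tau> L = star_fibers I' \<tau>' L'"
  unfolding star_fibers_def by (rule image_cong) (simp_all add: star_map_eq_iff same_stats_def)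

lemma type_count_in_star_fibers:
  assumes "finite I" "valid I \<tau> L"
  shows "cube_table (type_count I \<tau>) \<in> (\<Inter>b\<in>star_fibers I \<tau> L. \<xi> ` fiber star3 b)"
proof (rule INT_I)
  fix b assume "b \<in> star_fibers I \<tau> L"
  then obtain j where j: "b = hierarchical_map star3 (star_table (label_count I \<tau> L (wnode j) 1) (label_count I \<tau> L (wnode j) 0))"
    unfolding star_fibers_def by blast
  have "\<forall>n<8. 0 \<le> label_count I \<tau> L (wnode j) 1 n \<and> label_count I \<tau> L (wnode j) 1 n \<le> type_count I \<tau> n"
    using label_count_nonneg label_count_le[OF assms(1)] by blast
  moreover have "label_count I \<tau> L (wnode j) 0 = (\<lambda>n. type_count I \<tau> n - label_count I \<tau> L (wnode j) 1 n)"
    using label_count_0[OF assms] by (rule HOL.ext)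
  ultimately show "cube_table (type_count I \<tau>) \<in> \<xi> ` fiber star3 b"
    unfolding j projected_fiber_iff by (intro exI[of _ "label_count I \<tau> L (wnode j) 1"]) simp
qed

text \<open>Induction along a path of vertex counts, each edge being lifted by
  \<open>move_step\<close>. The set \<open>S\<close> is computed from the initial labels but belongs
  to every table on the way, since the statistics of the labels are constant on the fiber.\<close>

lemma path_lift:
  assumes no_cube: "{1, 2, 3} \<notin> facets \<Gamma>" and D: "6 \<le> D" "min 12 (4 + 2 * N) \<le> D"
    and I: "finite I" and v: "valid I \<tau> L" and fiber: "table I \<tau> L \<in> fiber \<Gamma> b"
    and S: "S = (\<Inter>b\<in>star_fibers I \<tau> L. \<xi> ` fiber star3 b)"
    and path: "(cube_table (type_count I \<tau>), t) \<in> {(v, v'). v \<in> S \<and> v' \<in> S \<and> v - v' \<in> PF_moves \<union> uminus ` PF_moves}\<^sup>*"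
  shows "\<exists>\<tau>' L'. valid I \<tau>' L' \<and> cube_table (type_count I \<tau>') = t \<and> table I \<tau>' L' \<in> fiber \<Gamma> b \<and>
    (table I \<tau> L, table I \<tau>' L') \<in> (fiber_steps \<Gamma> D b)\<^sup>*"
  using path
proof (induction rule: rtrancl_induct)
  case base
  then show ?case using v fiber by blast
next
  case (step y z)
  then obtain \<tau>1 L1 where 1: "valid I \<tau>1 L1" "cube_table (type_count I \<tau>1) = y" "table I \<tau>1 L1 \<in> fiber \<Gamma> b"
    "(table I \<tau> L, table I \<tau>1 L1) \<in> (fiber_steps \<Gamma> D b)\<^sup>*" by blast
  have s1: "same_stats I \<tau> L I \<tau>1 L1" using table_in_fiber[OF I I v 1(1) fiber] 1(3) by blast
  have z: "z \<in> S" "y - z \<in> PF_moves \<union> uminus ` PF_moves" using step.hyps(2) by auto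
  have "uminus ` PF_moves \<subseteq> PF_moves"
  proof
    fix k assume "k \<in> uminus ` PF_moves"
    then obtain g where g: "g \<in> set moves" "k = - cube_table (nth g)" unfolding PF_moves_def by blast
    have "- cube_table (nth g) = cube_table (nth (map uminus g))"
      by (rule cube_table_eqI) (use moves_length g(1) in \<open>auto simp: cube_table_vertex tables_def cube_table_0\<close>)
    then show "k \<in> PF_moves" using moves_uminus[OF g(1)] g(2) unfolding PF_moves_def by blast
  qed
  then obtain g where g: "g \<in> set moves" "y - z = cube_table (nth g)" using z(2) unfolding PF_moves_def by blast
  have zj: "z \<in> \<xi> ` fiber star3 (hierarchical_map star3
      (star_table (label_count I \<tau>1 L1 (wnode j) 1) (label_count I \<tau>1 L1 (wnode j) 0)))" if "j \<in> {1..N}" for j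
  proof -
    have 1: "z \<in> (\<Inter>b\<in>star_fibers I \<tau>1 L1. \<xi> ` fiber star3 b)"
      using z(1) unfolding S star_fibers_cong[OF s1] .
    have 2: "hierarchical_map star3 (star_table (label_count I \<tau>1 L1 (wnode j) 1) (label_count I \<tau>1 L1 (wnode j) 0)) \<in>
        star_fibers I \<tau>1 L1"
      unfolding star_fibers_def by (rule image_eqI[OF refl that])
    show ?thesis by (rule INT_D[OF 1 2])
  qed
  have "1 \<in> {1..N}" using N by simp
  from zj[OF this] obtain f' where f': "z = cube_table f'" by (rule projected_fiberE)
  have "\<forall>n<8. type_count I \<tau>1 n - f' n = g ! n"
    using g(2) unfolding 1(2)[symmetric] f' cube_table_diff cube_table_eq_iff .
  then have "type_count I \<tau>1 n - f' n = g ! n" if "n < 8" for n using that by blast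
  then have "f' n = type_count I \<tau>1 n - g ! n" if "n < 8" for n using that by (smt (verit))
  then have ff: "\<forall>n<8. f' n = type_count I \<tau>1 n - g ! n" by blast
  have a': "\<forall>j\<in>{1..N}. \<exists>a'. (\<forall>n<8. 0 \<le> a' n \<and> a' n \<le> f' n) \<and> same_marg a' (label_count I \<tau>1 L1 (wnode j) 1)"
  proof
    fix j assume "j \<in> {1..N}"
    from zj[OF this] show "\<exists>a'. (\<forall>n<8. 0 \<le> a' n \<and> a' n \<le> f' n) \<and> same_marg a' (label_count I \<tau>1 L1 (wnode j) 1)"
      unfolding f' projected_fiber_iff by blast
  qed
  obtain \<tau>' L' where 2: "valid I \<tau>' L'" "\<forall>n<8. type_count I \<tau>' n = f' n" "table I \<tau>' L' \<in> fiber \<Gamma> b"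
    "(table I \<tau>1 L1, table I \<tau>' L') \<in> (fiber_steps \<Gamma> D b)\<^sup>*"
    using move_step[OF no_cube I 1(1,3) g(1) ff a' D] by blast
  have "cube_table (type_count I \<tau>') = z" unfolding f' cube_table_eq_iff using 2(2) by blast
  then show ?case using 2(1,3) rtrancl_trans[OF 1(4) 2(4)] by blast
qed

lemma fiber_path:
  assumes no_cube: "{1, 2, 3} \<notin> facets \<Gamma>" and D: "6 \<le> D" "min 12 (4 + 2 * N) \<le> D"
    and u: "u \<in> fiber \<Gamma> b" "u' \<in> fiber \<Gamma> b"
  shows "(u, u') \<in> (fiber_steps \<Gamma> D b)\<^sup>*"
proof -
  obtain n \<tau> L where 1: "valid {..<n} \<tau> L" "u = table {..<n} \<tau> L" using table_exhaust[OF u(1)] .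
  obtain n' \<tau>' L' where 2: "valid {..<n'} \<tau>' L'" "u' = table {..<n'} \<tau>' L'" using table_exhaust[OF u(2)] .
  have s: "same_stats {..<n} \<tau> L {..<n'} \<tau>' L'"
    using table_in_fiber[OF _ _ 1(1) 2(1)] u unfolding 1(2) 2(2) by blast
  have n': "n' = n" using size_eq[OF _ _ 1(1) 2(1) s] by simp
  define S where "S = (\<Inter>b\<in>star_fibers {..<n} \<tau> L. \<xi> ` fiber star3 b)"
  have "cube_table (type_count {..<n} \<tau>) \<in> S" unfolding S_def by (rule type_count_in_star_fibers[OF _ 1(1)]) simp
  moreover have "cube_table (type_count {..<n} \<tau>') \<in> S"
    unfolding S_def star_fibers_cong[OF s] using type_count_in_star_fibers[OF _ 2(1)] unfolding n' by simp
  moreover have "star_fibers {..<n} \<tau> L \<noteq> {}" unfolding star_fibers_def using N by simp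
  from pf_connects[OF this] have "connects PF_moves S" unfolding S_def .
  ultimately have path: "(cube_table (type_count {..<n} \<tau>), cube_table (type_count {..<n} \<tau>')) \<in>
      {(v, v'). v \<in> S \<and> v' \<in> S \<and> v - v' \<in> PF_moves \<union> uminus ` PF_moves}\<^sup>*"
    unfolding connects_def by blast
  obtain \<tau>2 L2 where 3: "valid {..<n} \<tau>2 L2" "cube_table (type_count {..<n} \<tau>2) = cube_table (type_count {..<n} \<tau>')"
    "table {..<n} \<tau>2 L2 \<in> fiber \<Gamma> b" "(table {..<n} \<tau> L, table {..<n} \<tau>2 L2) \<in> (fiber_steps \<Gamma> D b)\<^sup>*"
    using path_lift[OF no_cube D finite_lessThan 1(1) _ S_def path] u(1) unfolding 1(2) by blast
  \<comment> \<open>The lifted path ends at the right vertex counts, but in general at other labels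
    than those of \<open>u'\<close>. Kernel moves correct these.\<close>
  have "(table {..<n} \<tau>2 L2, table {..<n} \<tau>' L') \<in> (fiber_steps \<Gamma> D b)\<^sup>*"
  proof (rule same_types_path[OF D(1) finite_lessThan 3(1)])
    show "valid {..<n} \<tau>' L'" "table {..<n} \<tau>' L' \<in> fiber \<Gamma> b" using 2(1) u(2) unfolding 2(2) n' by simp_all
    show "table {..<n} \<tau>2 L2 \<in> fiber \<Gamma> b" by (rule 3(3))
    show "\<forall>m<8. type_count {..<n} \<tau>2 m = type_count {..<n} \<tau>' m" using 3(2) unfolding cube_table_eq_iff .
  qed
  with 3(4) show ?thesis unfolding 1(2) 2(2) n' by (rule rtrancl_trans)
qed

lemma kernel_fiber_path:
  assumes cube: "{1, 2, 3} \<in> facets \<Gamma>" and D: "6 \<le> D" and u: "u \<in> fiber \<Gamma> b" "u' \<in> fiber \<Gamma> b"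
  shows "(u, u') \<in> (fiber_steps \<Gamma> D b)\<^sup>*"
proof -
  obtain n \<tau> L where 1: "valid {..<n} \<tau> L" "u = table {..<n} \<tau> L" using table_exhaust[OF u(1)] .
  obtain n' \<tau>' L' where 2: "valid {..<n'} \<tau>' L'" "u' = table {..<n'} \<tau>' L'" using table_exhaust[OF u(2)] .
  have s: "same_stats {..<n} \<tau> L {..<n'} \<tau>' L' \<and> (\<forall>m<8. type_count {..<n} \<tau> m = type_count {..<n'} \<tau>' m)"
    using table_in_fiber[OF _ _ 1(1) 2(1)] u cube unfolding 1(2) 2(2) by blast
  then have n': "n' = n" using size_eq[OF _ _ 1(1) 2(1)] by simp
  show ?thesis
    unfolding 1(2) 2(2) n'
  proof (rule same_types_path[OF D finite_lessThan 1(1)])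
    show "valid {..<n} \<tau>' L'" "table {..<n} \<tau>' L' \<in> fiber \<Gamma> b" using 2(1) u(2) unfolding 2(2) n' by simp_all
    show "table {..<n} \<tau> L \<in> fiber \<Gamma> b" using u(1) unfolding 1(2) .
    show "\<forall>m<8. type_count {..<n} \<tau> m = type_count {..<n} \<tau>' m" using s unfolding n' by blast
  qed
qed

end

lemma cube_notin_K3_edges: "{1, 2, 3} \<notin> K3_edges N"
proof
  assume "{1, 2, 3} \<in> K3_edges N"
  then obtain i j where "{1, 2, 3} = {i, wnode j}" "j \<in> {1..N}" unfolding K3_edges_def by blast
  then have "wnode j \<in> {1, 2, 3}" "j \<in> {1..N}" by simp_all
  then show False using wnode_notin by auto
qed

text \<open>Stated for any \<open>D\<close> above the minimum, so that \<open>D = 12\<close> and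
  \<open>D = 4 + 2 * N\<close> are both instances.\<close>

lemma K3_basis:
  assumes N: "1 \<le> N" and D: "6 \<le> D" "min 12 (4 + 2 * N) \<le> D"
  shows "markov_degree (K3 N) \<le> enat D"
proof -
  interpret K3_model N "K3 N" by standard (use N in auto)
  have no_cube: "{1, 2, 3} \<notin> facets (K3 N)" unfolding facets_K3[OF N] by (rule cube_notin_K3_edges)
  have fin: "finite (\<Union>(K3 N))" unfolding Union_K3 by (rule finite_nodes)
  have "(v, v') \<in> (fiber_steps (K3 N) D b)\<^sup>*" if "v \<in> fiber (K3 N) b" "v' \<in> fiber (K3 N) b" for b v v'
    by (rule fiber_path[OF no_cube D that])
  note basis = markov_basis_small_moves[OF fin this]
  have "markov_degree (K3 N) \<le> enat (moves_degree (small_moves (K3 N) D))"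
    unfolding markov_degree_def by (rule INF_lower) (use basis(1) in simp)
  also have "\<dots> \<le> enat D" using basis(2) by simp
  finally show ?thesis .
qed

lemma kernel_basis:
  assumes N: "1 \<le> N"
  shows "\<exists>M. kernel_markov_basis N M \<and> moves_degree M \<le> 6"
proof -
  interpret K3_model N "K3 N \<union> Pow {1, 2, 3}" by standard (use N in auto)
  have cube: "{1, 2, 3} \<in> facets (K3 N \<union> Pow {1, 2, 3})" unfolding facets_K3_Un[OF N] by (rule insertI1)
  have fin: "finite (\<Union>(K3 N \<union> Pow {1, 2, 3}))" unfolding Union_\<Gamma> by (rule finite_nodes)
  have "(v, v') \<in> (fiber_steps (K3 N \<union> Pow {1, 2, 3}) 6 b)\<^sup>*"
    if "v \<in> fiber (K3 N \<union> Pow {1, 2, 3}) b" "v' \<in> fiber (K3 N \<union> Pow {1, 2, 3}) b" for b v v'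
    by (rule kernel_fiber_path[OF cube order_refl that])
  from markov_basis_small_moves[OF fin this] show ?thesis unfolding kernel_markov_basis_def by blast
qed

theorem theorem1:
  "(\<forall>N\<ge>1. markov_degree (K3 N) \<le> 12) \<and>
   ((\<forall>N\<ge>1. \<exists>M. kernel_markov_basis N M \<and> moves_degree M \<le> 6) \<and>
    (\<exists>G. pf_markov_basis G \<and> moves_degree G = 4 \<and> has_lifting_defect G 2)) \<and>
   (\<forall>N\<ge>1. markov_degree (K3 N) \<le> enat (4 + 2 * N))"
proof (intro conjI allI impI)
  fix N :: nat assume N: "1 \<le> N"
  have "markov_degree (K3 N) \<le> enat 12" by (rule K3_basis[OF N]) simp_all
  then show "markov_degree (K3 N) \<le> 12" by (simp add: numeral_eq_enat)
  show "\<exists>M. kernel_markov_basis N M \<and> moves_degree M \<le> 6" by (rule kernel_basis[OF N])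
  show "markov_degree (K3 N) \<le> enat (4 + 2 * N)" by (rule K3_basis[OF N]) (use N in simp_all)
next
  show "\<exists>G. pf_markov_basis G \<and> moves_degree G = 4 \<and> has_lifting_defect G 2"
    using pf_markov_basis_moves moves_degree_PF_moves has_lifting_defect_PF_moves by blast
qed

end
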